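(* Let $p(\cdot), q(\cdot), 1/\alpha(\cdot)\in \mathcal{P}(\mathbb{R}^n)$ be such that $1<p(\cdot)\leq q(\cdot)<\infty$. The following assertions hold. (1) Suppose that $M$ is bounded on $L^{q'(\cdot)}(\mathbb R^n)$ and $1\in A_{1/\alpha(\cdot)}(\mathbb{R}^n)$. If $C_{\downarrow}^{\alpha(\cdot)} <\infty$ and $M^{\alpha(\cdot)}:L^{p(\cdot)}(\mathbb R^n)\to L^{q(\cdot)}(\mathbb R^n)$ is bounded, then $I^{\alpha(\cdot)}:L^{p(\cdot)}(\mathbb R^n)\to L^{q(\cdot)}(\mathbb R^n)$ is bounded. (2) Suppose that $1\in A_{p(\cdot)}(\mathbb{R}^n)\cap A_{q(\cdot)}(\mathbb{R}^n)$ and that $1\in A_{1/\alpha(\cdot)}(\mathbb{R}^n)$, $\alpha(\cdot) = \frac{1}{p(\cdot)}-\frac{1}{q(\cdot)}$ and $C_{\uparrow}^{\alpha(\cdot)} <\infty$. If $I^{\alpha(\cdot)}:L^{p(\cdot)}(\mathbb R^n)\to L^{q(\cdot)}(\mathbb R^n)$ is bounded, then $C_{\downarrow}^{\alpha(\cdot)} <\infty$ and $M^{\alpha(\cdot)}:L^{p(\cdot)}(\mathbb R^n)\to L^{q(\cdot)}(\mathbb R^n)$ is bounded.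
   Context: $\mathcal{P}(\mathbb{R}^n)$ is the set of measurable functions $p(\cdot):\mathbb{R}^n\to[1,\infty]$ (Lebesgue measure); pointwise relations between exponents are understood almost everywhere. With $1/\infty=0$, $1/0=\infty$, the condition $1/\alpha(\cdot)\in\mathcal P(\mathbb R^n)$ means that $\alpha:\mathbb{R}^n\to[0,1]$ is measurable. The conjugate exponent is given by $\frac1{p(\cdot)}+\frac1{p'(\cdot)}=1$. The norm of $L^{p(\cdot)}$ is $\|f\|_{L^{p(\cdot)}}=\inf\{\lambda>0:\rho_{p(\cdot)}(f/\lambda)\le1\}$, where $\rho_{p(\cdot)}(f)=\int_{\{p(\cdot)<\infty\}}|f(x)|^{p(x)}\,dx+\|f\|_{L^\infty(\{p(\cdot)=\infty\})}$. For a set $E$ of finite positive measure, $\langle\alpha\rangle_E=\frac1{|E|}\int_E\alpha$. With suprema over all balls $B\subset\mathbb R^n$, $$Mf(x)=\sup_B\frac{1_B(x)}{|B|}\int_B|f|,\qquad M^{\alpha(\cdot)}f(x)=\sup_{B}\frac{1_B(x)}{|B|^{1-\langle\alpha\rangle_B}}\int_B|f|,$$ $$I^{\alpha(\cdot)}f(x)=\int_{\mathbb R^n\setminus\{x\}}\frac{f(y)\,dy}{|x-y|^{n(1-\langle\alpha\rangle_{B(x,|x-y|)})}}.$$ Boundedness $Z\to Y$ means $\|Tf\|_Y\le C\|f\|_Z$ for all $f\in Z$ with a finite constant $C$. $1\in A_{s(\cdot)}(\mathbb R^n)$ means $\sup_B\|1_B\|_{L^{s(\cdot)}}\|1_B\|_{L^{s'(\cdot)}}/|B|<\infty$,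 supremum over all balls. A dyadic lattice on $\mathbb R^n$ is a collection of cubes $\mathcal D=\bigcup_{k\in\mathbb Z}\mathcal D_k$ such that $Q\cap P\in\{Q,P,\emptyset\}$ for all $Q,P\in\mathcal D$, and, for all $k\in\mathbb Z$, $\mathcal D_k=\{Q\in\mathcal D:\ell(Q)=2^k\}$ ($\ell(Q)$ is the side length) and $\mathbb R^n=\bigcup_{Q\in\mathcal D_k}Q$. The packing constants are $$C_{\downarrow}^{\alpha(\cdot)}=\sup_{\mathcal D}\sup_{Q_0\in\mathcal D}\frac{\sum_{Q\in\mathcal D,\,Q\subset Q_0}|Q|^{1+\langle\alpha\rangle_Q}}{|Q_0|^{1+\langle\alpha\rangle_{Q_0}}},\qquad C_{\uparrow}^{\alpha(\cdot)}=\sup_{\mathcal D}\sup_{Q_0\in\mathcal D}\sum_{Q\in\mathcal D,\,Q_0\subset Q}\frac{|Q_0|^{1-\langle\alpha\rangle_{Q_0}}}{|Q|^{1-\langle\alpha\rangle_Q}},$$ where $\sup_{\mathcal D}$ is over all dyadic lattices on $\mathbb R^n$. *)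

theory Defs
  imports "HOL-Analysis.Analysis" "HOL-Probability.Essential_Supremum"
begin

text \<open>
  Exponents take values in \<open>[1, \<infinity>]\<close> and are represented as \<open>ennreal\<close>-valued functions, for which
  \<open>1 / 0 = \<infinity>\<close> and \<open>1 / \<infinity> = 0\<close> hold in the library.
\<close>

definition exponents :: "((real ^ 'n) \<Rightarrow> ennreal) set" where
  "exponents = {p \<in> borel_measurable lebesgue. \<forall>x. 1 \<le> p x}"

definition conj_exponent :: "((real ^ 'n) \<Rightarrow> ennreal) \<Rightarrow> (real ^ 'n) \<Rightarrow> ennreal" where
  "conj_exponent p = (\<lambda>x. 1 / (1 - 1 / p x))"

lemma conj_exponent_eq:
  assumes "1 \<le> p x"
  shows "1 / p x + 1 / conj_exponent p x = 1"
proof -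
  have "1 / p x \<le> 1"
    using assms by (metis divide_le_posI_ennreal mult.right_neutral not_gr_zero not_one_le_zero)
  then show ?thesis
    by (simp add: conj_exponent_def add_diff_inverse_ennreal)
qed

text \<open>
  Functions and operators are extended-real valued, since maximal functions may be infinite.
  \<open>abs_powr a r\<close> is \<open>|a|\<^sup>r\<close>, for \<open>r > 0\<close>.
\<close>

definition abs_powr :: "ereal \<Rightarrow> real \<Rightarrow> ennreal" where
  "abs_powr a r = (if \<bar>a\<bar> = \<infinity> then \<infinity> else ennreal (real_of_ereal \<bar>a\<bar> powr r))"

definition modular :: "((real ^ 'n) \<Rightarrow> ennreal) \<Rightarrow> ((real ^ 'n) \<Rightarrow> ereal) \<Rightarrow> ennreal" where
  "modular p f =
     (\<integral>\<^sup>+x\<in>{x. p x < \<infinity>}. abs_powr (f x) (enn2real (p x)) \<partial>lebesgue)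
     + esssup lebesgue (\<lambda>x. e2ennreal \<bar>f x\<bar> * indicator {x. p x = \<infinity>} x)"

definition Lp_norm :: "((real ^ 'n) \<Rightarrow> ennreal) \<Rightarrow> ((real ^ 'n) \<Rightarrow> ereal) \<Rightarrow> ennreal" where
  "Lp_norm p f = Inf {ennreal t | t. t > 0 \<and> modular p (\<lambda>x. f x / ereal t) \<le> 1}"

definition Lp_space :: "((real ^ 'n) \<Rightarrow> ennreal) \<Rightarrow> ((real ^ 'n) \<Rightarrow> real) set" where
  "Lp_space p = {f \<in> borel_measurable lebesgue. Lp_norm p (\<lambda>x. ereal (f x)) < \<infinity>}"

definition bounded_op ::
  "((real ^ 'n) \<Rightarrow> ennreal) \<Rightarrow> ((real ^ 'n) \<Rightarrow> ennreal) \<Rightarrow>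
   (((real ^ 'n) \<Rightarrow> real) \<Rightarrow> (real ^ 'n) \<Rightarrow> ereal) \<Rightarrow> bool" where
  "bounded_op p q T \<longleftrightarrow>
     (\<exists>C<\<infinity>. \<forall>f\<in>Lp_space p. Lp_norm q (T f) \<le> C * Lp_norm p (\<lambda>x. ereal (f x)))"

definition avg :: "((real ^ 'n) \<Rightarrow> real) \<Rightarrow> (real ^ 'n) set \<Rightarrow> real" where
  "avg \<alpha> E = (LINT x:E|lebesgue. \<alpha> x) / measure lebesgue E"

definition maximal :: "((real ^ 'n) \<Rightarrow> real) \<Rightarrow> (real ^ 'n) \<Rightarrow> ereal" where
  "maximal f x = enn2ereal
     (SUP (c, r) \<in> {(c, r). r > 0}.
        indicator (ball c r) x * (\<integral>\<^sup>+y\<in>ball c r. ennreal \<bar>f y\<bar> \<partial>lebesgue)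
          / ennreal (measure lebesgue (ball c r)))"

definition frac_maximal ::
  "((real ^ 'n) \<Rightarrow> real) \<Rightarrow> ((real ^ 'n) \<Rightarrow> real) \<Rightarrow> (real ^ 'n) \<Rightarrow> ereal" where
  "frac_maximal \<alpha> f x = enn2ereal
     (SUP (c, r) \<in> {(c, r). r > 0}.
        indicator (ball c r) x * (\<integral>\<^sup>+y\<in>ball c r. ennreal \<bar>f y\<bar> \<partial>lebesgue)
          / ennreal (measure lebesgue (ball c r) powr (1 - avg \<alpha> (ball c r))))"

text \<open>
  The value \<open>\<infinity>\<close> is assigned where the integral defining the fractional integral does not converge
  absolutely. A finite norm of \<open>frac_integral \<alpha> f\<close> thus entails absolute convergence almost
  everywhere, and for \<open>f \<ge> 0\<close> this is the usual convention for integrals of nonnegative functions.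
  (The Bochner integral of the library is \<open>0\<close> for non-integrable functions.)
\<close>

definition frac_integral ::
  "((real ^ 'n) \<Rightarrow> real) \<Rightarrow> ((real ^ 'n) \<Rightarrow> real) \<Rightarrow> (real ^ 'n) \<Rightarrow> ereal" where
  "frac_integral \<alpha> f x =
     (let g = (\<lambda>y. f y / dist x y powr (real CARD('n) * (1 - avg \<alpha> (ball x (dist x y)))))
      in if set_integrable lebesgue (- {x}) g then ereal (LINT y:- {x}|lebesgue. g y) else \<infinity>)"

definition one_in_A :: "((real ^ 'n) \<Rightarrow> ennreal) \<Rightarrow> bool" where
  "one_in_A s \<longleftrightarrow>
     (SUP (c, r) \<in> {(c, r). r > 0}.
        Lp_norm s (indicator (ball c r)) * Lp_norm (conj_exponent s) (indicator (ball c r))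
          / ennreal (measure lebesgue (ball c r))) < \<infinity>"

text \<open>
  Cubes are half-open with sides parallel to the axes: for closed cubes, the
  intersection and covering properties of a dyadic lattice are incompatible.
\<close>

definition cube :: "real ^ 'n \<Rightarrow> real \<Rightarrow> (real ^ 'n) set" where
  "cube a l = {x. \<forall>i. a $ i \<le> x $ i \<and> x $ i < a $ i + l}"

definition dyadic_level :: "(real ^ 'n) set set \<Rightarrow> int \<Rightarrow> (real ^ 'n) set set" where
  "dyadic_level \<D> k = {Q \<in> \<D>. \<exists>a. Q = cube a (2 powi k)}"

definition dyadic_lattice :: "(real ^ 'n) set set \<Rightarrow> bool" where
  "dyadic_lattice \<D> \<longleftrightarrow>
     \<D> = (\<Union>k. dyadic_level \<D> k) \<and>
     (\<forall>Q\<in>\<D>. \<forall>P\<in>\<D>. Q \<inter> P \<in> {Q, P, {}}) \<and>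
     (\<forall>k. \<Union>(dyadic_level \<D> k) = UNIV)"

definition C_down :: "((real ^ 'n) \<Rightarrow> real) \<Rightarrow> ennreal" where
  "C_down \<alpha> =
     (SUP \<D> \<in> {\<D>. dyadic_lattice \<D>}. SUP Q0 \<in> \<D>.
        (\<Sum>\<^sub>\<infinity>Q \<in> {Q \<in> \<D>. Q \<subseteq> Q0}. ennreal (measure lebesgue Q powr (1 + avg \<alpha> Q)))
          / ennreal (measure lebesgue Q0 powr (1 + avg \<alpha> Q0)))"

definition C_up :: "((real ^ 'n) \<Rightarrow> real) \<Rightarrow> ennreal" where
  "C_up \<alpha> =
     (SUP \<D> \<in> {\<D>. dyadic_lattice \<D>}. SUP Q0 \<in> \<D>.
        (\<Sum>\<^sub>\<infinity>Q \<in> {Q \<in> \<D>. Q0 \<subseteq> Q}.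
           ennreal (measure lebesgue Q0 powr (1 - avg \<alpha> Q0))
             / ennreal (measure lebesgue Q powr (1 - avg \<alpha> Q))))"

end

theory Submission
  imports Defs
begin

text \<open>
  Write \<open>|E|\<close> for the volume of \<open>E\<close> and \<open>a\<^sub>E\<close> for the mean of \<open>\<alpha>\<close> over \<open>E\<close>.

  The condition A for \<open>1/\<alpha>\<close> is used only through a geometric consequence. For every \<open>E\<close> of finite
  positive volume, Hoelder's inequality applied to the indicator of \<open>E\<close> and \<open>|E|\<close> raised to minus the
  reciprocal of the conjugate exponent, followed by Jensen's inequality, bounds the norm of the
  indicator of \<open>E\<close> below by \<open>|E|\<close> to the mean of the reciprocal exponent, up to a factor 4
  (\<open>indicator_norm_lower\<close>). On balls, condition A turns this lower bound into a two-sided one. As norms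
  of indicators increase with the set, \<open>|E|\<close> to the power \<open>a\<^sub>E\<close>, and \<open>|E|\<close> to the power \<open>1 - a\<^sub>E\<close>, are
  comparable for sets \<open>E\<close> of comparable size in one ball (\<open>one_in_A_comparable_powr\<close>). So the kernel of
  the fractional integral may be computed on any ball or cube of the right size near the two points
  (\<open>kernel_comparison\<close>).

  First implication. Any two points lie in a common cube, of side at most six times their distance,
  of one of finitely many shifted dyadic lattices (the one-third trick, \<open>two_points_in_grid_cube\<close>). Hence
  the fractional integral is dominated by a sum over dyadic cubes of averages of \<open>|f|\<close>
  (\<open>frac_integral_dyadic_domination\<close>), and by duality it suffices to bound
  \<open>\<Sum>\<^sub>Q |Q|\<^sup>1\<^sup>+\<^sup>a \<langle>f\<rangle>\<^sub>Q \<langle>g\<rangle>\<^sub>Q\<close> for finite families in one lattice. The finiteness of \<open>C_down\<close> sums the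
  weights below a cube. Grouping the cubes by the dyadic size of the largest averages of \<open>f\<close> and of
  \<open>g\<close> over their ancestors leaves a sparse family of top cubes, so that the sum is bounded by the
  integral of the product of the fractional maximal function of \<open>f\<close> and the maximal function of \<open>g\<close>
  (\<open>laminar_bilinear_bound\<close>). Hoelder's inequality and the two boundedness hypotheses finish the proof.

  Second implication. Kernel comparison gives the pointwise bound of the fractional maximal
  function by the fractional integral of \<open>|f|\<close> (\<open>frac_maximal_le_frac_integral\<close>). For \<open>C_down\<close>, the
  fractional integral is tested on the indicator of a ball \<open>B\<close> around a cube \<open>Q\<^sub>0\<close>: splitting \<open>B\<close> into
  dyadic shells around \<open>x\<close> shows that its value at \<open>x\<close> bounds the sum of \<open>|Q|\<close> to the power \<open>a\<^sub>Q\<close> over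
  the dyadic cubes \<open>Q\<close> between \<open>x\<close> and \<open>Q\<^sub>0\<close>. Integrating over \<open>Q\<^sub>0\<close>, the conditions A for \<open>p\<close> and \<open>q\<close>
  bound, up to a constant, the product of the norms of the indicator of \<open>B\<close> in \<open>L\<^sup>p\<close> and in the dual of \<open>L\<^sup>q\<close>
  by \<open>|B|\<close> to the power \<open>1 + a\<^sub>B\<close>, because \<open>\<alpha> = 1/p - 1/q\<close>.
\<close>

section \<open>Laminar families\<close>

definition laminar :: "'a set set \<Rightarrow> bool" where
  "laminar F \<longleftrightarrow> (\<forall>Q\<in>F. \<forall>P\<in>F. Q \<inter> P \<in> {Q, P, {}})"

lemma laminarD: "laminar F \<Longrightarrow> Q \<in> F \<Longrightarrow> P \<in> F \<Longrightarrow> x \<in> Q \<Longrightarrow> x \<in> P \<Longrightarrow> Q \<subseteq> P \<or> P \<subseteq> Q"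
  unfolding laminar_def by blast

lemma laminar_subset: "laminar F \<Longrightarrow> G \<subseteq> F \<Longrightarrow> laminar G"
  unfolding laminar_def by blast

text \<open>
  The weak type (1,1) bound for a dyadic maximal function: the maximal members of a finite laminar
  family are disjoint and cover its union.
\<close>

lemma laminar_weak_type:
  fixes f :: "'a \<Rightarrow> ennreal"
  assumes fin: "finite F" and lam: "laminar F"
    and sets: "\<And>Q. Q \<in> F \<Longrightarrow> Q \<in> sets M" and sub: "\<And>Q. Q \<in> F \<Longrightarrow> Q \<subseteq> P"
    and f[measurable]: "f \<in> borel_measurable M"
    and big: "\<And>Q. Q \<in> F \<Longrightarrow> c * emeasure M Q \<le> (\<integral>\<^sup>+x\<in>Q. f x \<partial>M)"
  shows "c * emeasure M (\<Union>F) \<le> (\<integral>\<^sup>+x\<in>P. f x \<partial>M)"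
proof -
  define T where "T = {Q \<in> F. \<forall>R\<in>F. Q \<subseteq> R \<longrightarrow> R = Q}"
  have finT: "finite T" and TF: "T \<subseteq> F" using fin unfolding T_def by auto
  have UT: "\<Union>F \<subseteq> \<Union>T"
  proof
    fix x assume "x \<in> \<Union>F"
    then obtain Q where Q: "Q \<in> F" "x \<in> Q" by auto
    obtain R where "R \<in> F" "Q \<subseteq> R" "\<forall>R'\<in>F. R \<subseteq> R' \<longrightarrow> R' = R"
      using finite_has_maximal2[OF fin Q(1)] by metis
    then show "x \<in> \<Union>T" using Q unfolding T_def by auto
  qed
  have dis: "Q = R" if "Q \<in> T" "R \<in> T" "x \<in> Q" "x \<in> R" for Q R x
    using laminarD[OF lam, of Q R x] that unfolding T_def by auto
  have setsT: "Q \<in> sets M" if "Q \<in> T" for Q using that TF sets by auto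
  have "c * emeasure M (\<Union>F) \<le> c * emeasure M (\<Union>(id ` T))"
    by (intro mult_left_mono emeasure_mono) (use UT finT setsT in auto)
  also have "\<dots> \<le> c * (\<Sum>Q\<in>T. emeasure M (id Q))"
    by (intro mult_left_mono emeasure_subadditive_finite) (use finT setsT in auto)
  also have "\<dots> = (\<Sum>Q\<in>T. c * emeasure M Q)" by (simp add: sum_distrib_left)
  also have "\<dots> \<le> (\<Sum>Q\<in>T. \<integral>\<^sup>+x\<in>Q. f x \<partial>M)"
    by (intro sum_mono big) (use TF in auto)
  also have "\<dots> = (\<integral>\<^sup>+x. (\<Sum>Q\<in>T. f x * indicator Q x) \<partial>M)"
    by (rule nn_integral_sum[symmetric]) (use setsT in auto)
  also have "\<dots> \<le> (\<integral>\<^sup>+x\<in>P. f x \<partial>M)"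
  proof (rule nn_integral_mono)
    fix x
    show "(\<Sum>Q\<in>T. f x * indicator Q x) \<le> f x * indicator P x"
    proof (cases "\<exists>Q\<in>T. x \<in> Q")
      case True
      then obtain Q where Q: "Q \<in> T" "x \<in> Q" by auto
      have "(\<Sum>Q\<in>T. f x * indicator Q x) = (\<Sum>R\<in>{Q}. f x * indicator R x)"
        by (rule sum.mono_neutral_right[OF finT]) (use Q dis in \<open>auto simp: indicator_def\<close>)
      then show ?thesis using Q sub TF by (auto simp: indicator_def)
    next
      case False
      then have "(\<Sum>Q\<in>T. f x * indicator Q x) = 0" by (intro sum.neutral) auto
      then show ?thesis by simp
    qed
  qed
  finally show ?thesis .
qed

lemma floor_log_eq_imp_le:
  fixes z w :: real
  assumes "0 < z" "0 < w" "\<lfloor>log 2 z\<rfloor> = \<lfloor>log 2 w\<rfloor>"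
  shows "z \<le> 2 * w"
proof -
  have "log 2 z \<le> log 2 w + 1"
    using floor_correct[of "log 2 z"] floor_correct[of "log 2 w"] assms(3) by linarith
  also have "\<dots> = log 2 (w * 2)" using assms by (simp add: log_mult)
  finally have "z \<le> w * 2" using assms by (simp add: log_le_cancel_iff)
  then show ?thesis by simp
qed

lemma floor_log_near:
  fixes z w :: real
  assumes "0 < z" "z \<le> w" "w \<le> 4 * z"
  shows "\<lfloor>log 2 z\<rfloor> \<in> {\<lfloor>log 2 w\<rfloor> - 2..\<lfloor>log 2 w\<rfloor>}"
proof -
  have 1: "log 2 z \<le> log 2 w" using assms by (simp add: log_le_cancel_iff)
  have "log 2 w \<le> log 2 (z * 2 powr 2)" using assms by (simp add: log_le_cancel_iff)
  also have "\<dots> = log 2 z + log 2 (2 powr 2)" using assms by (subst log_mult) auto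
  also have "\<dots> = log 2 z + 2" by (subst log_powr_cancel) auto
  finally have "log 2 w \<le> log 2 z + 2" .
  then show ?thesis using 1 by auto linarith+
qed

text \<open>
  Summing the weights \<open>a\<close> naively against products of averages loses a logarithm. Replace the averages
  \<open>\<phi>\<close> and \<open>\<gamma>\<close> by their running maxima \<open>\<Phi>\<close> and \<open>\<Gamma>\<close> over the ancestors, which increase as the sets shrink,
  and group the sets into classes by \<open>(\<lfloor>log 2 \<Phi>\<rfloor>, \<lfloor>log 2 \<Gamma>\<rfloor>)\<close>. Within a class the packing hypothesis sums
  \<open>a\<close> below each top set. The top sets are sparse: by the weak type bound, half of each top set \<open>P\<close>
  sees no average exceeding \<open>4 \<Phi> P\<close> or \<open>4 \<Gamma> P\<close>, and these halves overlap at most 9 times. The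
  monotonicity of \<open>b\<close> is needed because \<open>\<Phi> P\<close> is attained at an ancestor of \<open>P\<close>.
\<close>

lemma laminar_bilinear_bound_pos:
  fixes a b \<phi> \<gamma> :: "'a set \<Rightarrow> real" and f g u v :: "'a \<Rightarrow> real"
  assumes fin: "finite F" and lam: "laminar F"
    and sets: "\<And>Q. Q \<in> F \<Longrightarrow> Q \<in> sets M" and pos: "\<And>Q. Q \<in> F \<Longrightarrow> 0 < measure M Q"
    and f[measurable]: "f \<in> borel_measurable M" and g[measurable]: "g \<in> borel_measurable M"
    and \<phi>: "\<And>Q. Q \<in> F \<Longrightarrow> (\<integral>\<^sup>+x\<in>Q. ennreal (f x) \<partial>M) = ennreal (\<phi> Q * measure M Q)"
    and \<gamma>: "\<And>Q. Q \<in> F \<Longrightarrow> (\<integral>\<^sup>+x\<in>Q. ennreal (g x) \<partial>M) = ennreal (\<gamma> Q * measure M Q)"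
    and \<phi>0: "\<And>Q. Q \<in> F \<Longrightarrow> 0 < \<phi> Q" and \<gamma>0: "\<And>Q. Q \<in> F \<Longrightarrow> 0 < \<gamma> Q"
    and a0: "\<And>Q. Q \<in> F \<Longrightarrow> 0 \<le> a Q" and b0: "\<And>Q. Q \<in> F \<Longrightarrow> 0 \<le> b Q"
    and C: "0 \<le> C1" "0 \<le> C2"
    and pack: "\<And>P. P \<in> F \<Longrightarrow> (\<Sum>Q\<in>{Q\<in>F. Q \<subseteq> P}. a Q) \<le> C1 * (measure M P * b P)"
    and incr: "\<And>Q P. Q \<in> F \<Longrightarrow> P \<in> F \<Longrightarrow> Q \<subseteq> P \<Longrightarrow> b Q \<le> C2 * b P"
    and u[measurable]: "u \<in> borel_measurable M" and v[measurable]: "v \<in> borel_measurable M"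
    and u0: "\<And>x. 0 \<le> u x" and v0: "\<And>x. 0 \<le> v x"
    and u1: "\<And>R x. R \<in> F \<Longrightarrow> x \<in> R \<Longrightarrow> b R * \<phi> R \<le> u x"
    and v1: "\<And>R x. R \<in> F \<Longrightarrow> x \<in> R \<Longrightarrow> \<gamma> R \<le> v x"
  shows "ennreal (\<Sum>Q\<in>F. a Q * \<phi> Q * \<gamma> Q) \<le> ennreal (72 * C1 * C2) * (\<integral>\<^sup>+x. ennreal (u x * v x) \<partial>M)"
proof -
  define up where "up Q = {R\<in>F. Q \<subseteq> R}" for Q
  define \<Phi> where "\<Phi> Q = Max (\<phi> ` up Q)" for Q
  define \<Gamma> where "\<Gamma> Q = Max (\<gamma> ` up Q)" for Q
  define cl where "cl Q = (\<lfloor>log 2 (\<Phi> Q)\<rfloor>, \<lfloor>log 2 (\<Gamma> Q)\<rfloor>)" for Q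
  \<comment> \<open>The top sets of the classes.\<close>
  define S where "S = {P\<in>F. \<forall>R\<in>F. P \<subset> R \<longrightarrow> cl R \<noteq> cl P}"
  define bigf where "bigf P = {R\<in>F. R \<subseteq> P \<and> 4 * \<Phi> P < \<phi> R}" for P
  define bigg where "bigg P = {R\<in>F. R \<subseteq> P \<and> 4 * \<Gamma> P < \<gamma> R}" for P
  \<comment> \<open>The part of \<open>P\<close> on which the averages do not grow much below \<open>P\<close>.\<close>
  define E where "E P = P - \<Union>(bigf P) - \<Union>(bigg P)" for P
  have finup: "finite (up Q)" for Q using fin unfolding up_def by auto
  have finS: "finite S" and SF: "S \<subseteq> F" using fin unfolding S_def by auto
  have \<Phi>ge: "\<phi> R \<le> \<Phi> Q" if "R \<in> F" "Q \<subseteq> R" for R Q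
    unfolding \<Phi>_def using finup that by (intro Max_ge) (auto simp: up_def)
  have \<Gamma>ge: "\<gamma> R \<le> \<Gamma> Q" if "R \<in> F" "Q \<subseteq> R" for R Q
    unfolding \<Gamma>_def using finup that by (intro Max_ge) (auto simp: up_def)
  have \<Phi>pos: "0 < \<Phi> Q" and \<Gamma>pos: "0 < \<Gamma> Q" if "Q \<in> F" for Q
    using \<Phi>ge[OF that, of Q] \<Gamma>ge[OF that, of Q] \<phi>0[OF that] \<gamma>0[OF that] by auto
  have \<Phi>\<Gamma>nn: "0 \<le> \<Phi> Q * \<Gamma> Q" if "Q \<in> F" for Q
    using \<Phi>pos[OF that] \<Gamma>pos[OF that] by simp
  have \<Phi>att: "\<exists>R\<in>F. Q \<subseteq> R \<and> \<Phi> Q = \<phi> R" if "Q \<in> F" for Q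
  proof -
    have "Max (\<phi> ` up Q) \<in> \<phi> ` up Q" using finup that by (intro Max_in) (auto simp: up_def)
    then show ?thesis unfolding \<Phi>_def by (auto simp: up_def)
  qed
  have \<Gamma>att: "\<exists>R\<in>F. Q \<subseteq> R \<and> \<Gamma> Q = \<gamma> R" if "Q \<in> F" for Q
  proof -
    have "Max (\<gamma> ` up Q) \<in> \<gamma> ` up Q" using finup that by (intro Max_in) (auto simp: up_def)
    then show ?thesis unfolding \<Gamma>_def by (auto simp: up_def)
  qed
  have top_of_class: "\<exists>P\<in>S. Q \<subseteq> P \<and> cl P = cl Q" if "Q \<in> F" for Q
  proof -
    have "finite {R\<in>F. cl R = cl Q}" "Q \<in> {R\<in>F. cl R = cl Q}" using fin that by auto
    from finite_has_maximal2[OF this] obtain P where P: "P \<in> F" "cl P = cl Q" "Q \<subseteq> P"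
      "\<forall>R\<in>{R\<in>F. cl R = cl Q}. P \<subseteq> R \<longrightarrow> P = R" by blast
    then show ?thesis unfolding S_def by (intro bexI[of _ P]) auto
  qed
  have term_le: "\<phi> Q * \<gamma> Q \<le> 4 * (\<Phi> P * \<Gamma> P)" if "Q \<in> F" "P \<in> F" "cl P = cl Q" for P Q
  proof -
    have "\<Phi> Q \<le> 2 * \<Phi> P" "\<Gamma> Q \<le> 2 * \<Gamma> P"
      using that(3) \<Phi>pos \<Gamma>pos that(1,2) unfolding cl_def by (auto intro!: floor_log_eq_imp_le)
    then have "\<phi> Q \<le> 2 * \<Phi> P" "\<gamma> Q \<le> 2 * \<Gamma> P"
      using \<Phi>ge[OF that(1) order_refl] \<Gamma>ge[OF that(1) order_refl] by linarith+
    then have "\<phi> Q * \<gamma> Q \<le> (2 * \<Phi> P) * (2 * \<Gamma> P)"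
      using \<phi>0[of Q] \<gamma>0[of Q] \<Phi>pos[of P] that by (intro mult_mono) auto
    then show ?thesis by simp
  qed
  have step1: "(\<Sum>Q\<in>F. a Q * \<phi> Q * \<gamma> Q) \<le> (\<Sum>P\<in>S. 4 * (\<Phi> P * \<Gamma> P) * (C1 * (measure M P * b P)))"
  proof -
    have "(\<Sum>Q\<in>F. a Q * \<phi> Q * \<gamma> Q) \<le> (\<Sum>Q\<in>F. \<Sum>P\<in>{P\<in>S. Q \<subseteq> P}. 4 * (\<Phi> P * \<Gamma> P) * a Q)"
    proof (rule sum_mono)
      fix Q assume Q: "Q \<in> F"
      obtain P where P: "P \<in> S" "Q \<subseteq> P" "cl P = cl Q" using top_of_class[OF Q] by auto
      have nn: "0 \<le> 4 * (\<Phi> R * \<Gamma> R) * a Q" if "R \<in> F" for R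
        using mult_nonneg_nonneg[OF \<Phi>\<Gamma>nn[OF that] a0[OF Q]] by (simp add: mult_ac)
      have "a Q * \<phi> Q * \<gamma> Q = (\<phi> Q * \<gamma> Q) * a Q" by simp
      also have "\<dots> \<le> 4 * (\<Phi> P * \<Gamma> P) * a Q"
        by (rule mult_right_mono[OF term_le]) (use P Q SF a0 in auto)
      also have "\<dots> \<le> (\<Sum>P\<in>{P\<in>S. Q \<subseteq> P}. 4 * (\<Phi> P * \<Gamma> P) * a Q)"
      proof (rule member_le_sum)
        show "P \<in> {P\<in>S. Q \<subseteq> P}" "finite {P\<in>S. Q \<subseteq> P}" using P finS by auto
        show "0 \<le> 4 * (\<Phi> R * \<Gamma> R) * a Q" if "R \<in> {P\<in>S. Q \<subseteq> P} - {P}" for R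
          using that SF by (intro nn) auto
      qed
      finally show "a Q * \<phi> Q * \<gamma> Q \<le> (\<Sum>P\<in>{P\<in>S. Q \<subseteq> P}. 4 * (\<Phi> P * \<Gamma> P) * a Q)" .
    qed
    also have "\<dots> = (\<Sum>P\<in>S. \<Sum>Q\<in>{Q\<in>F. Q \<subseteq> P}. 4 * (\<Phi> P * \<Gamma> P) * a Q)"
      by (rule sum.swap_restrict[OF fin finS])
    also have "\<dots> = (\<Sum>P\<in>S. 4 * (\<Phi> P * \<Gamma> P) * (\<Sum>Q\<in>{Q\<in>F. Q \<subseteq> P}. a Q))"
      by (simp add: sum_distrib_left)
    also have "\<dots> \<le> (\<Sum>P\<in>S. 4 * (\<Phi> P * \<Gamma> P) * (C1 * (measure M P * b P)))"
    proof (rule sum_mono)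
      fix P assume "P \<in> S"
      then have P: "P \<in> F" using SF by auto
      have "0 \<le> 4 * (\<Phi> P * \<Gamma> P)" using \<Phi>\<Gamma>nn[OF P] by linarith
      then show "4 * (\<Phi> P * \<Gamma> P) * (\<Sum>Q\<in>{Q\<in>F. Q \<subseteq> P}. a Q)
          \<le> 4 * (\<Phi> P * \<Gamma> P) * (C1 * (measure M P * b P))"
        by (rule mult_left_mono[OF pack[OF P]])
    qed
    finally show ?thesis .
  qed
  have small: "4 * measure M (\<Union>{R\<in>F. R \<subseteq> P \<and> 4 * c < \<psi> R}) \<le> measure M P"
    if P: "P \<in> F" and h[measurable]: "h \<in> borel_measurable M"
      and \<psi>: "\<And>Q. Q \<in> F \<Longrightarrow> (\<integral>\<^sup>+x\<in>Q. ennreal (h x) \<partial>M) = ennreal (\<psi> Q * measure M Q)"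
      and c: "0 < c" "\<psi> P \<le> c" for P h \<psi> c
  proof -
    let ?G = "{R\<in>F. R \<subseteq> P \<and> 4 * c < \<psi> R}"
    have Pf: "emeasure M P \<noteq> \<infinity>" using pos[OF P] by (metis infinity_ennreal_def less_irrefl measure_eq_emeasure_eq_ennreal measure_zero_top)
    have Uf: "\<Union>?G \<in> sets M" "\<Union>?G \<subseteq> P" using fin sets by auto
    then have "emeasure M (\<Union>?G) \<noteq> \<infinity>"
      using Pf emeasure_mono[OF Uf(2) sets[OF P]] by (auto simp: top_unique)
    then have eU: "emeasure M (\<Union>?G) = ennreal (measure M (\<Union>?G))"
      by (simp add: emeasure_eq_ennreal_measure)
    have "ennreal (4 * c) * emeasure M (\<Union>?G) \<le> (\<integral>\<^sup>+x\<in>P. ennreal (h x) \<partial>M)"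
    proof (rule laminar_weak_type)
      fix Q assume Q: "Q \<in> ?G"
      then have "emeasure M Q \<noteq> \<infinity>" using Pf emeasure_mono[of Q P M] sets[OF P] by (auto simp: top_unique)
      then have "ennreal (4 * c) * emeasure M Q = ennreal (4 * c * measure M Q)"
        using c by (simp add: emeasure_eq_ennreal_measure ennreal_mult)
      also have "\<dots> \<le> ennreal (\<psi> Q * measure M Q)"
        using Q by (intro ennreal_leI mult_right_mono) auto
      finally show "ennreal (4 * c) * emeasure M Q \<le> (\<integral>\<^sup>+x\<in>Q. ennreal (h x) \<partial>M)"
        using \<psi>[of Q] Q by simp
    qed (use fin lam sets in \<open>auto intro: laminar_subset\<close>)
    also have "\<dots> \<le> ennreal (c * measure M P)"
      unfolding \<psi>[OF P] using c by (intro ennreal_leI mult_right_mono) auto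
    finally have "ennreal (4 * c * measure M (\<Union>?G)) \<le> ennreal (c * measure M P)"
      unfolding eU using c by (simp add: ennreal_mult)
    then have "c * (4 * measure M (\<Union>?G)) \<le> c * measure M P"
      using c by (subst (asm) ennreal_le_iff) (auto simp: mult_ac)
    then show ?thesis using c by simp
  qed
  have Esets: "E P \<in> sets M" if "P \<in> F" for P
  proof -
    have "\<Union>(bigf P) \<in> sets M" "\<Union>(bigg P) \<in> sets M"
      using fin sets unfolding bigf_def bigg_def by auto
    then show ?thesis using sets[OF that] unfolding E_def by auto
  qed
  \<comment> \<open>Each of the two removed unions fills at most a quarter of \<open>P\<close>.\<close>
  have Elarge: "ennreal (measure M P) \<le> 2 * emeasure M (E P)" if P: "P \<in> F" for P
  proof -
    have Pf: "emeasure M P \<noteq> \<infinity>" using pos[OF P] by (metis infinity_ennreal_def less_irrefl measure_eq_emeasure_eq_ennreal measure_zero_top)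
    have 1: "4 * measure M (\<Union>(bigf P)) \<le> measure M P" unfolding bigf_def
      by (rule small[OF P f \<phi>]) (use \<Phi>pos \<Phi>ge P in auto)
    have 2: "4 * measure M (\<Union>(bigg P)) \<le> measure M P" unfolding bigg_def
      by (rule small[OF P g \<gamma>]) (use \<Gamma>pos \<Gamma>ge P in auto)
    have Uf: "\<Union>(bigf P) \<in> sets M" "\<Union>(bigf P) \<subseteq> P" "\<Union>(bigg P) \<in> sets M" "\<Union>(bigg P) \<subseteq> P"
      using fin sets unfolding bigf_def bigg_def by auto
    have fm: "emeasure M A \<noteq> \<infinity>" if "A \<subseteq> P" for A
      using Pf emeasure_mono[OF that sets[OF P]] by (auto simp: top_unique)
    have "measure M P = measure M (\<Union>(bigf P) \<union> \<Union>(bigg P) \<union> E P)"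
      using Uf by (intro arg_cong[where f = "measure M"]) (auto simp: E_def)
    also have "\<dots> \<le> measure M (\<Union>(bigf P) \<union> \<Union>(bigg P)) + measure M (E P)"
      by (intro measure_Un_le) (use Uf Esets P in auto)
    also have "\<dots> \<le> measure M (\<Union>(bigf P)) + measure M (\<Union>(bigg P)) + measure M (E P)"
      using measure_Un_le[of "\<Union>(bigf P)" M "\<Union>(bigg P)"] Uf by auto
    finally have "measure M P \<le> 2 * measure M (E P)" using 1 2 by linarith
    then have "ennreal (measure M P) \<le> ennreal (2 * measure M (E P))" by (rule ennreal_leI)
    also have "\<dots> = 2 * emeasure M (E P)"
      using fm[of "E P"] by (subst emeasure_eq_ennreal_measure) (auto simp: E_def ennreal_mult)
    finally show ?thesis .
  qed
  \<comment> \<open>The top sets containing \<open>x\<close> form a chain with distinct classes. If \<open>x \<in> E P\<close>, then \<open>\<Phi> P\<close> is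
    within a factor 4 of the largest average over all sets containing \<open>x\<close>, which leaves three
    values for the first component of the class, and likewise for the second.\<close>
  have overlap: "card {P\<in>S. x \<in> E P} \<le> 9" for x
  proof (cases "{P\<in>S. x \<in> E P} = {}")
    case False
    let ?X = "{P\<in>S. x \<in> E P}" and ?R = "{R\<in>F. x \<in> R}"
    let ?m = "Max (\<phi> ` ?R)" and ?n = "Max (\<gamma> ` ?R)"
    let ?A = "{\<lfloor>log 2 ?m\<rfloor> - 2..\<lfloor>log 2 ?m\<rfloor>} \<times> {\<lfloor>log 2 ?n\<rfloor> - 2..\<lfloor>log 2 ?n\<rfloor>}"
    have inX: "P \<in> F" "x \<in> P" if "P \<in> ?X" for P using that SF unfolding E_def by auto
    have finR: "finite ?R" using fin by simp
    obtain P0 where "P0 \<in> ?X" using False by blast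
    then have neR: "?R \<noteq> {}" using inX[of P0] by blast
    have cases: "P \<subseteq> R \<or> R \<subseteq> P \<and> \<phi> R \<le> 4 * \<Phi> P \<and> \<gamma> R \<le> 4 * \<Gamma> P" if "P \<in> ?X" "R \<in> ?R" for P R
    proof -
      have "P \<subseteq> R \<or> R \<subseteq> P" using laminarD[OF lam, of P R x] inX[OF that(1)] that by auto
      moreover have "\<phi> R \<le> 4 * \<Phi> P \<and> \<gamma> R \<le> 4 * \<Gamma> P" if "R \<subseteq> P"
      proof -
        have "x \<in> E P" "x \<in> R" "R \<in> F" using \<open>P \<in> ?X\<close> \<open>R \<in> ?R\<close> by auto
        then have "R \<notin> bigf P" "R \<notin> bigg P" unfolding E_def by blast+
        then show ?thesis using that \<open>R \<in> F\<close> unfolding bigf_def bigg_def by auto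
      qed
      ultimately show ?thesis by blast
    qed
    have "cl ` ?X \<subseteq> ?A"
    proof
      fix z assume "z \<in> cl ` ?X"
      then obtain P where P: "P \<in> ?X" "z = cl P" by auto
      have "\<Phi> P \<le> ?m"
      proof -
        obtain R where "R \<in> F" "P \<subseteq> R" "\<Phi> P = \<phi> R" using \<Phi>att inX[OF P(1)] by blast
        then show ?thesis using finR inX[OF P(1)] by (auto intro!: Max_ge)
      qed
      moreover have "?m \<le> 4 * \<Phi> P"
      proof (rule Max.boundedI)
        fix t assume "t \<in> \<phi> ` ?R"
        then obtain R where R: "R \<in> ?R" "t = \<phi> R" by auto
        show "t \<le> 4 * \<Phi> P"
          using cases[OF P(1) R(1)]
        proof
          assume "P \<subseteq> R"
          then show ?thesis using \<Phi>ge[of R P] \<Phi>pos[OF inX(1)[OF P(1)]] R by auto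
        qed (use R in auto)
      qed (use finR neR in auto)
      moreover have "\<Gamma> P \<le> ?n"
      proof -
        obtain R where "R \<in> F" "P \<subseteq> R" "\<Gamma> P = \<gamma> R" using \<Gamma>att inX[OF P(1)] by blast
        then show ?thesis using finR inX[OF P(1)] by (auto intro!: Max_ge)
      qed
      moreover have "?n \<le> 4 * \<Gamma> P"
      proof (rule Max.boundedI)
        fix t assume "t \<in> \<gamma> ` ?R"
        then obtain R where R: "R \<in> ?R" "t = \<gamma> R" by auto
        show "t \<le> 4 * \<Gamma> P"
          using cases[OF P(1) R(1)]
        proof
          assume "P \<subseteq> R"
          then show ?thesis using \<Gamma>ge[of R P] \<Gamma>pos[OF inX(1)[OF P(1)]] R by auto
        qed (use R in auto)
      qed (use finR neR in auto)
      ultimately show "z \<in> ?A"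
        unfolding P(2) cl_def
        using floor_log_near[OF \<Phi>pos[OF inX(1)[OF P(1)]]] floor_log_near[OF \<Gamma>pos[OF inX(1)[OF P(1)]]]
        by blast
    qed
    moreover have "inj_on cl ?X"
    proof (rule inj_onI, rule ccontr)
      fix P Q assume PQ: "P \<in> ?X" "Q \<in> ?X" "cl P = cl Q" "P \<noteq> Q"
      then have "P \<subset> Q \<or> Q \<subset> P" using laminarD[OF lam, of P Q x] inX[OF PQ(1)] inX[OF PQ(2)] by blast
      then show False
      proof
        assume "P \<subset> Q"
        then show False using PQ inX(1)[OF PQ(2)] unfolding S_def by auto
      next
        assume "Q \<subset> P"
        then show False using PQ inX(1)[OF PQ(1)] unfolding S_def by auto
      qed
    qed
    ultimately have "card ?X \<le> card ?A" by (intro card_inj_on_le) auto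
    then show ?thesis by simp
  next
    case True
    then show ?thesis by (simp only: card.empty)
  qed
  have at_x: "\<Phi> P * \<Gamma> P * b P \<le> C2 * (u x * v x)" if P: "P \<in> F" "x \<in> P" for P x
  proof -
    obtain R where R: "R \<in> F" "P \<subseteq> R" "\<Phi> P = \<phi> R" using \<Phi>att P by blast
    obtain R' where R': "R' \<in> F" "P \<subseteq> R'" "\<Gamma> P = \<gamma> R'" using \<Gamma>att P by blast
    have "\<phi> R * b P \<le> \<phi> R * (C2 * b R)" using incr[OF P(1) R(1,2)] \<phi>0[OF R(1)] by simp
    also have "\<dots> = C2 * (b R * \<phi> R)" by simp
    also have "\<dots> \<le> C2 * u x" using u1[OF R(1)] R P C by (intro mult_left_mono) auto
    finally have le: "\<phi> R * b P \<le> C2 * u x" .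
    have "\<gamma> R' \<le> v x" using v1[OF R'(1)] R' P by auto
    from mult_mono[OF le this] have "\<phi> R * b P * \<gamma> R' \<le> C2 * u x * v x"
      using C u0[of x] \<gamma>0[OF R'(1)] by auto
    then show ?thesis using R R' by (simp add: mult_ac)
  qed
  define c where "c P = 4 * C1 * (\<Phi> P * \<Gamma> P * b P)" for P
  have c0: "0 \<le> c P" if "P \<in> F" for P
    unfolding c_def using C b0[OF that] \<Phi>pos[OF that] \<Gamma>pos[OF that] by simp
  have "ennreal (\<Sum>Q\<in>F. a Q * \<phi> Q * \<gamma> Q) \<le> ennreal (\<Sum>P\<in>S. c P * measure M P)"
    using step1 by (intro ennreal_leI) (simp add: c_def mult_ac)
  also have "\<dots> = (\<Sum>P\<in>S. ennreal (c P) * ennreal (measure M P))"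
    using c0 SF by (subst sum_ennreal[symmetric]) (auto simp: ennreal_mult intro!: sum.cong mult_nonneg_nonneg)
  also have "\<dots> \<le> (\<Sum>P\<in>S. ennreal (c P) * (2 * emeasure M (E P)))"
    by (intro sum_mono mult_left_mono Elarge) (use SF in auto)
  also have "\<dots> = (\<Sum>P\<in>S. \<integral>\<^sup>+x. ennreal (2 * c P) * indicator (E P) x \<partial>M)"
  proof (rule sum.cong[OF refl])
    fix P assume "P \<in> S"
    then have P: "P \<in> F" using SF by auto
    have "ennreal (c P) * (2 * emeasure M (E P)) = ennreal (2 * c P) * emeasure M (E P)"
      using c0[OF P] by (simp add: ennreal_mult mult_ac)
    then show "ennreal (c P) * (2 * emeasure M (E P)) = (\<integral>\<^sup>+x. ennreal (2 * c P) * indicator (E P) x \<partial>M)"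
      using Esets[OF P] by (simp only: nn_integral_cmult_indicator)
  qed
  also have "\<dots> = (\<integral>\<^sup>+x. (\<Sum>P\<in>S. ennreal (2 * c P) * indicator (E P) x) \<partial>M)"
    by (rule nn_integral_sum[symmetric]) (use Esets SF in auto)
  also have "\<dots> \<le> (\<integral>\<^sup>+x. ennreal (72 * C1 * C2) * ennreal (u x * v x) \<partial>M)"
  proof (rule nn_integral_mono)
    fix x
    have "(\<Sum>P\<in>S. ennreal (2 * c P) * indicator (E P) x) = (\<Sum>P\<in>{P\<in>S. x \<in> E P}. ennreal (2 * c P))"
      by (rule sum.mono_neutral_cong_right[OF finS]) (auto simp: indicator_def)
    also have "\<dots> \<le> (\<Sum>P\<in>{P\<in>S. x \<in> E P}. ennreal (8 * C1 * C2 * (u x * v x)))"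
    proof (intro sum_mono ennreal_leI)
      fix P assume P: "P \<in> {P\<in>S. x \<in> E P}"
      then have "4 * C1 * (\<Phi> P * \<Gamma> P * b P) \<le> 4 * C1 * (C2 * (u x * v x))"
        using at_x[of P x] SF C unfolding E_def by (intro mult_left_mono) auto
      then show "2 * c P \<le> 8 * C1 * C2 * (u x * v x)" unfolding c_def by (simp add: mult_ac)
    qed
    also have "\<dots> = of_nat (card {P\<in>S. x \<in> E P}) * ennreal (8 * C1 * C2 * (u x * v x))" by simp
    also have "\<dots> \<le> of_nat 9 * ennreal (8 * C1 * C2 * (u x * v x))"
      by (intro mult_right_mono of_nat_mono overlap) auto
    also have "\<dots> = ennreal (9 * (8 * C1 * C2 * (u x * v x)))"
      using C u0 v0 by (subst ennreal_mult) auto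
    also have "\<dots> = ennreal (72 * C1 * C2) * ennreal (u x * v x)"
      using C u0 v0 by (simp add: ennreal_mult[symmetric] mult_ac)
    finally show "(\<Sum>P\<in>S. ennreal (2 * c P) * indicator (E P) x) \<le> ennreal (72 * C1 * C2) * ennreal (u x * v x)" .
  qed
  also have "\<dots> = ennreal (72 * C1 * C2) * (\<integral>\<^sup>+x. ennreal (u x * v x) \<partial>M)"
    by (rule nn_integral_cmult) auto
  finally show ?thesis .
qed

text \<open>
  Sets with a vanishing average contribute nothing, which reduces to positive averages, whose
  logarithms make sense.
\<close>

lemma laminar_bilinear_bound:
  fixes a b \<phi> \<gamma> :: "'a set \<Rightarrow> real" and f g u v :: "'a \<Rightarrow> real"
  assumes fin: "finite F" and lam: "laminar F"
    and sets: "\<And>Q. Q \<in> F \<Longrightarrow> Q \<in> sets M" and pos: "\<And>Q. Q \<in> F \<Longrightarrow> 0 < measure M Q"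
    and f: "f \<in> borel_measurable M" and g: "g \<in> borel_measurable M"
    and \<phi>: "\<And>Q. Q \<in> F \<Longrightarrow> (\<integral>\<^sup>+x\<in>Q. ennreal (f x) \<partial>M) = ennreal (\<phi> Q * measure M Q)"
    and \<gamma>: "\<And>Q. Q \<in> F \<Longrightarrow> (\<integral>\<^sup>+x\<in>Q. ennreal (g x) \<partial>M) = ennreal (\<gamma> Q * measure M Q)"
    and \<phi>0: "\<And>Q. Q \<in> F \<Longrightarrow> 0 \<le> \<phi> Q" and \<gamma>0: "\<And>Q. Q \<in> F \<Longrightarrow> 0 \<le> \<gamma> Q"
    and a0: "\<And>Q. Q \<in> F \<Longrightarrow> 0 \<le> a Q" and b0: "\<And>Q. Q \<in> F \<Longrightarrow> 0 \<le> b Q"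
    and C: "0 \<le> C1" "0 \<le> C2"
    and pack: "\<And>P. P \<in> F \<Longrightarrow> (\<Sum>Q\<in>{Q\<in>F. Q \<subseteq> P}. a Q) \<le> C1 * (measure M P * b P)"
    and incr: "\<And>Q P. Q \<in> F \<Longrightarrow> P \<in> F \<Longrightarrow> Q \<subseteq> P \<Longrightarrow> b Q \<le> C2 * b P"
    and u: "u \<in> borel_measurable M" and v: "v \<in> borel_measurable M"
    and u0: "\<And>x. 0 \<le> u x" and v0: "\<And>x. 0 \<le> v x"
    and u1: "\<And>R x. R \<in> F \<Longrightarrow> x \<in> R \<Longrightarrow> b R * \<phi> R \<le> u x"
    and v1: "\<And>R x. R \<in> F \<Longrightarrow> x \<in> R \<Longrightarrow> \<gamma> R \<le> v x"
  shows "ennreal (\<Sum>Q\<in>F. a Q * \<phi> Q * \<gamma> Q) \<le> ennreal (72 * C1 * C2) * (\<integral>\<^sup>+x. ennreal (u x * v x) \<partial>M)"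
proof -
  let ?F = "{Q\<in>F. 0 < \<phi> Q \<and> 0 < \<gamma> Q}"
  have "(\<Sum>Q\<in>F. a Q * \<phi> Q * \<gamma> Q) = (\<Sum>Q\<in>?F. a Q * \<phi> Q * \<gamma> Q)"
    using fin \<phi>0 \<gamma>0 by (intro sum.mono_neutral_right) (auto simp: less_le)
  moreover have "ennreal (\<Sum>Q\<in>?F. a Q * \<phi> Q * \<gamma> Q)
      \<le> ennreal (72 * C1 * C2) * (\<integral>\<^sup>+x. ennreal (u x * v x) \<partial>M)"
  proof (rule laminar_bilinear_bound_pos[where f = f and g = g and b = b])
    show "(\<Sum>Q\<in>{Q\<in>?F. Q \<subseteq> P}. a Q) \<le> C1 * (measure M P * b P)" if "P \<in> ?F" for P
    proof (rule order_trans[OF _ pack[of P]])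
      show "(\<Sum>Q\<in>{Q\<in>?F. Q \<subseteq> P}. a Q) \<le> (\<Sum>Q\<in>{Q\<in>F. Q \<subseteq> P}. a Q)"
        by (intro sum_mono2) (use fin a0 in auto)
    qed (use that in auto)
  qed (use assms laminar_subset[OF lam, of ?F] in auto)
  ultimately show ?thesis by simp
qed

section \<open>Variable exponent norms\<close>

abbreviation vol :: "(real ^ 'n) set \<Rightarrow> real" where
  "vol \<equiv> measure lebesgue"

text \<open>
  The power \<open>a\<^sup>r\<close> on \<open>[0, \<infinity>]\<close> for \<open>r > 0\<close>. It recasts the modular in terms of absolute values, so that
  the norm theory takes place in \<open>[0, \<infinity>]\<close>.
\<close>

definition epow :: "ennreal \<Rightarrow> real \<Rightarrow> ennreal" where
  "epow a r = (if a = \<infinity> then \<infinity> else ennreal (enn2real a powr r))"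

definition nmod :: "(real ^ 'n \<Rightarrow> ennreal) \<Rightarrow> (real ^ 'n \<Rightarrow> ennreal) \<Rightarrow> ennreal" where
  "nmod s F = (\<integral>\<^sup>+x\<in>{x. s x < \<infinity>}. epow (F x) (enn2real (s x)) \<partial>lebesgue)
     + esssup lebesgue (\<lambda>x. F x * indicator {x. s x = \<infinity>} x)"

text \<open>
  For measurable \<open>F\<close>, this says that the infimum defining the norm is at most \<open>t\<close> and that \<open>t\<close> is
  admissible in it. All norm bounds are proved in this form: it avoids manipulating infima, and
  \<open>bounded_opD\<close> and \<open>bounded_opI\<close> translate between it and boundedness of operators.
\<close>

definition norm_le :: "(real ^ 'n \<Rightarrow> ennreal) \<Rightarrow> (real ^ 'n \<Rightarrow> ennreal) \<Rightarrow> real \<Rightarrow> bool" where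
  "norm_le s F t \<longleftrightarrow> 0 < t \<and> nmod s (\<lambda>x. F x / ennreal t) \<le> 1"

lemma ennreal_mult_divide_cancel: "0 < a \<Longrightarrow> ennreal a * (x / ennreal a) = x"
  by (subst ennreal_times_divide, subst mult.commute, rule mult_divide_eq_ennreal) auto

lemma epow_ennreal: "0 \<le> a \<Longrightarrow> epow (ennreal a) r = ennreal (a powr r)"
  by (simp add: epow_def)

lemma epow_mono: "a \<le> b \<Longrightarrow> 0 \<le> r \<Longrightarrow> epow a r \<le> epow b r"
  unfolding epow_def
  by (auto simp: top_unique less_top intro!: ennreal_leI powr_mono2 enn2real_mono)

lemma epow_measurable[measurable]:
  assumes [measurable]: "F \<in> borel_measurable M" "r \<in> borel_measurable M"
  shows "(\<lambda>x. epow (F x) (r x)) \<in> borel_measurable M"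
  unfolding epow_def by measurable

lemma abs_powr_eq_epow: "abs_powr a r = epow (e2ennreal \<bar>a\<bar>) r"
  by (cases a) (auto simp: abs_powr_def epow_def)

lemma modular_eq_nmod: "modular s f = nmod s (\<lambda>x. e2ennreal \<bar>f x\<bar>)"
  unfolding modular_def nmod_def abs_powr_eq_epow ..

lemma e2ennreal_abs_divide: "0 < t \<Longrightarrow> e2ennreal \<bar>a / ereal t\<bar> = e2ennreal \<bar>a\<bar> / ennreal t"
  by (cases a) (auto simp: divide_ennreal ennreal_top_divide)

lemma exponents_measurable: "s \<in> exponents \<Longrightarrow> s \<in> borel_measurable lebesgue"
  by (simp add: exponents_def)

lemma exponents_ge1: "s \<in> exponents \<Longrightarrow> 1 \<le> s x"
  by (simp add: exponents_def)

lemma Lp_norm_eq: "Lp_norm s f = Inf {ennreal t | t. norm_le s (\<lambda>x. e2ennreal \<bar>f x\<bar>) t}"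
  unfolding Lp_norm_def norm_le_def modular_eq_nmod
  by (intro arg_cong[where f = Inf] Collect_cong ex_cong) (auto simp: e2ennreal_abs_divide)

text \<open>
  The second summand of the modular is supported on a null set. Such a function is measurable since
  Lebesgue measure is complete, whatever \<open>F\<close> is; without measurability the essential supremum would be
  infinite by convention.
\<close>

lemma nmod_finite:
  assumes "AE x in lebesgue. s x < \<infinity>"
  shows "nmod s F = (\<integral>\<^sup>+x. epow (F x) (enn2real (s x)) \<partial>lebesgue)"
proof -
  let ?h = "\<lambda>x. F x * indicator {x. s x = \<infinity>} x"
  have ae: "AE x in lebesgue. ?h x = 0" using assms by eventually_elim auto
  have "?h \<in> borel_measurable lebesgue"
  proof (rule measurableI)
    fix A :: "ennreal set" assume "A \<in> sets borel"
    show "?h -` A \<inter> space lebesgue \<in> sets lebesgue"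
      by (rule completion.in_sets_AE[where A = "if 0 \<in> A then UNIV else {}"])
        (use ae in \<open>auto elim: eventually_mono\<close>)
  qed simp
  then have "esssup lebesgue ?h \<le> 0" using ae by (intro esssup_I) auto
  moreover have "(\<integral>\<^sup>+x\<in>{x. s x < \<infinity>}. epow (F x) (enn2real (s x)) \<partial>lebesgue)
      = (\<integral>\<^sup>+x. epow (F x) (enn2real (s x)) \<partial>lebesgue)"
  proof (rule nn_integral_cong_AE)
    show "AE x in lebesgue. epow (F x) (enn2real (s x)) * indicator {x. s x < \<infinity>} x
        = epow (F x) (enn2real (s x))"
      using assms by eventually_elim simp
  qed
  ultimately show ?thesis unfolding nmod_def by simp
qed

text \<open>
  The alternative in the last hypothesis is there because the operators applied to \<open>f\<close> are not known to
  be measurable, and the essential supremum of a nonmeasurable function is infinite.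
\<close>

lemma nmod_mono:
  assumes s: "s \<in> exponents" and le: "\<And>x. F x \<le> G x"
    and m: "F \<in> borel_measurable lebesgue \<or> (AE x in lebesgue. s x < \<infinity>)"
  shows "nmod s F \<le> nmod s G"
proof (cases "AE x in lebesgue. s x < \<infinity>")
  case True
  then show ?thesis by (simp add: nmod_finite) (intro nn_integral_mono epow_mono le enn2real_nonneg)
next
  case False
  then have [measurable]: "F \<in> borel_measurable lebesgue" using m by simp
  have [measurable]: "s \<in> borel_measurable lebesgue" using s by (rule exponents_measurable)
  have "esssup lebesgue (\<lambda>x. F x * indicator {x. s x = \<infinity>} x)
      \<le> esssup lebesgue (\<lambda>x. G x * indicator {x. s x = \<infinity>} x)"
    by (rule esssup_mono) (auto intro!: mult_right_mono le)
  then show ?thesis unfolding nmod_def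
    by (intro add_mono nn_integral_mono mult_right_mono epow_mono le enn2real_nonneg) auto
qed

lemma norm_le_mono:
  assumes s: "s \<in> exponents" and t: "norm_le s G t"
    and m: "F \<in> borel_measurable lebesgue \<or> (AE x in lebesgue. s x < \<infinity>)"
    and c: "0 < c" and le: "\<And>x. F x \<le> ennreal c * G x"
  shows "norm_le s F (c * t)"
proof -
  have t0: "0 < t" using t by (simp add: norm_le_def)
  have "nmod s (\<lambda>x. F x / ennreal (c * t)) \<le> nmod s (\<lambda>x. G x / ennreal t)"
  proof (rule nmod_mono[OF s])
    fix x
    have "F x / ennreal (c * t) \<le> (ennreal c * G x) / (ennreal c * ennreal t)"
      using c t0 by (simp add: ennreal_mult divide_right_mono_ennreal le)
    also have "\<dots> = G x / ennreal t"
      using c by (subst (1 2) mult.commute) (intro divide_mult_eq, auto)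
    finally show "F x / ennreal (c * t) \<le> G x / ennreal t" .
  qed (use m in \<open>auto intro: borel_measurable_divide_ennreal\<close>)
  then show ?thesis using t t0 c unfolding norm_le_def by auto
qed

lemma norm_le_weaken:
  assumes "s \<in> exponents" "norm_le s F t" "t \<le> t'"
    and "F \<in> borel_measurable lebesgue \<or> (AE x in lebesgue. s x < \<infinity>)"
  shows "norm_le s F t'"
proof -
  have t0: "0 < t" using assms by (simp add: norm_le_def)
  have "norm_le s F (t' / t * t)"
  proof (rule norm_le_mono[OF assms(1,2,4)])
    fix x
    have "F x = 1 * F x" by simp
    also have "\<dots> \<le> ennreal (t' / t) * F x"
      using t0 assms(3) by (intro mult_right_mono) (auto simp: one_ennreal_def[symmetric] simp flip: ennreal_1 intro!: ennreal_leI)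
    finally show "F x \<le> ennreal (t' / t) * F x" .
  qed (use t0 assms(3) in auto)
  then show ?thesis using t0 by simp
qed

lemma norm_leI_Lp_norm:
  assumes "s \<in> exponents" "Lp_norm s f < ennreal t"
    and "(\<lambda>x. e2ennreal \<bar>f x\<bar>) \<in> borel_measurable lebesgue \<or> (AE x in lebesgue. s x < \<infinity>)"
  shows "norm_le s (\<lambda>x. e2ennreal \<bar>f x\<bar>) t"
proof -
  obtain t1 where t1: "norm_le s (\<lambda>x. e2ennreal \<bar>f x\<bar>) t1" "ennreal t1 < ennreal t"
    using assms(2) unfolding Lp_norm_eq Inf_less_iff by auto
  then have "t1 \<le> t" by (metis ennreal_leI leD linear)
  then show ?thesis using norm_le_weaken[OF assms(1) t1(1) _ assms(3)] by simp
qed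

lemma Lp_norm_le: "norm_le s (\<lambda>x. e2ennreal \<bar>f x\<bar>) t \<Longrightarrow> Lp_norm s f \<le> ennreal t"
  unfolding Lp_norm_eq by (rule Inf_lower) auto

text \<open>
  Passing from the operator norm to a slightly larger constant makes the scale admissible, although
  the infimum in the norm need not be attained.
\<close>

lemma bounded_opD:
  assumes "q \<in> exponents" "AE x in lebesgue. q x < \<infinity>" "bounded_op p q T"
  obtains C where "0 < C" "\<And>f t. f \<in> borel_measurable lebesgue \<Longrightarrow> norm_le p (\<lambda>x. ennreal \<bar>f x\<bar>) t \<Longrightarrow>
    norm_le q (\<lambda>x. e2ennreal \<bar>T f x\<bar>) (C * t)"
proof -
  obtain C0 where C0: "C0 < \<infinity>"
    "\<And>f. f \<in> Lp_space p \<Longrightarrow> Lp_norm q (T f) \<le> C0 * Lp_norm p (\<lambda>x. ereal (f x))"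
    using assms(3) unfolding bounded_op_def by auto
  define C where "C = enn2real C0 + 1"
  have C0C: "C0 = ennreal (enn2real C0)" using C0(1) by simp
  show ?thesis
  proof (rule that[of C])
    show "0 < C" unfolding C_def by (simp add: add_nonneg_pos)
    fix f :: "real^'a \<Rightarrow> real" and t assume f: "f \<in> borel_measurable lebesgue"
      and t: "norm_le p (\<lambda>x. ennreal \<bar>f x\<bar>) t"
    have t0: "0 < t" using t by (simp add: norm_le_def)
    have 1: "Lp_norm p (\<lambda>x. ereal (f x)) \<le> ennreal t" using t by (intro Lp_norm_le) simp
    then have "f \<in> Lp_space p" using f unfolding Lp_space_def by (auto intro: le_less_trans)
    from C0(2)[OF this] have "Lp_norm q (T f) \<le> C0 * ennreal t"
      using 1 by (meson mult_left_mono order_trans zero_le)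
    also have "\<dots> = ennreal (enn2real C0 * t)" using t0 C0C by (metis ennreal_mult'' less_imp_le)
    also have "\<dots> < ennreal (C * t)" using t0 unfolding C_def by (intro ennreal_lessI) (auto simp: add_nonneg_pos)
    finally show "norm_le q (\<lambda>x. e2ennreal \<bar>T f x\<bar>) (C * t)"
      using assms by (intro norm_leI_Lp_norm) auto
  qed
qed

lemma bounded_opI:
  assumes C: "0 < C" and *: "\<And>f t. f \<in> borel_measurable lebesgue \<Longrightarrow>
    norm_le p (\<lambda>x. ennreal \<bar>f x\<bar>) t \<Longrightarrow> norm_le q (\<lambda>x. e2ennreal \<bar>T f x\<bar>) (C * t)"
  shows "bounded_op p q T"
  unfolding bounded_op_def
proof (intro exI[of _ "ennreal C"] conjI ballI)
  fix f assume "f \<in> Lp_space p"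
  then have f: "f \<in> borel_measurable lebesgue" by (simp add: Lp_space_def)
  have "Lp_norm q (T f) / ennreal C \<le> Lp_norm p (\<lambda>x. ereal (f x))"
    unfolding Lp_norm_eq[of p]
  proof (rule Inf_greatest, clarsimp)
    fix t assume t: "norm_le p (\<lambda>x. ennreal \<bar>f x\<bar>) t"
    have "Lp_norm q (T f) \<le> ennreal (C * t)" by (rule Lp_norm_le[OF *[OF f t]])
    also have "\<dots> = ennreal t * ennreal C" using C t by (simp add: norm_le_def ennreal_mult mult.commute)
    finally show "Lp_norm q (T f) / ennreal C \<le> ennreal t"
      using C by (simp add: divide_le_posI_ennreal mult.commute)
  qed
  then have *: "Lp_norm q (T f) / ennreal C * ennreal C \<le> Lp_norm p (\<lambda>x. ereal (f x)) * ennreal C"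
    by (intro mult_right_mono) auto
  show "Lp_norm q (T f) \<le> ennreal C * Lp_norm p (\<lambda>x. ereal (f x))"
  proof -
    have "Lp_norm q (T f) / ennreal C * ennreal C = Lp_norm q (T f)"
      unfolding ennreal_divide_times using C by (simp add: ennreal_divide_self)
    with * show ?thesis by (simp add: mult.commute)
  qed
qed simp

subsection \<open>Conjugate exponents\<close>

text \<open>
  A symmetric relation rather than the function \<open>conj_exponent\<close>, so that the two exponents can be
  exchanged without proving that conjugation is an involution.
\<close>

definition conj_pair :: "(real ^ 'n \<Rightarrow> ennreal) \<Rightarrow> (real ^ 'n \<Rightarrow> ennreal) \<Rightarrow> bool" where
  "conj_pair s s' \<longleftrightarrow> s \<in> exponents \<and> s' \<in> exponents \<and> (\<forall>x. 1 / s x + 1 / s' x = 1)"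

lemma conj_pair_sym: "conj_pair s s' \<Longrightarrow> conj_pair s' s"
  by (auto simp: conj_pair_def add.commute)

lemma conj_pair_conj_exponent:
  assumes "s \<in> exponents"
  shows "conj_pair s (conj_exponent s)"
proof -
  have [measurable]: "s \<in> borel_measurable lebesgue" using assms by (rule exponents_measurable)
  have "1 \<le> conj_exponent s x" for x
  proof -
    have "1 - 1 / s x \<le> 1" by (rule diff_le_self_ennreal)
    then have "1 \<le> 1 / (1 - 1 / s x)"
    proof (cases "1 - 1 / s x")
      case (real d)
      then have "d \<le> 1" using \<open>1 - 1 / s x \<le> 1\<close> by (simp flip: ennreal_1)
      then show ?thesis
        using real by (cases "d = 0") (auto simp: divide_ennreal simp flip: ennreal_1)
    qed simp
    then show ?thesis by (simp add: conj_exponent_def)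
  qed
  moreover have "conj_exponent s \<in> borel_measurable lebesgue"
    unfolding conj_exponent_def by measurable
  ultimately show ?thesis using assms conj_exponent_eq[of s]
    by (auto simp: conj_pair_def exponents_def)
qed

definition recip :: "(real ^ 'n \<Rightarrow> ennreal) \<Rightarrow> real ^ 'n \<Rightarrow> real" where
  "recip s x = enn2real (1 / s x)"

lemma recip_measurable: "s \<in> exponents \<Longrightarrow> recip s \<in> borel_measurable lebesgue"
  unfolding recip_def using exponents_measurable[of s] by measurable

lemma recip_cases:
  assumes "s \<in> exponents"
  obtains "s x = \<infinity>" "recip s x = 0"
    | r where "1 \<le> r" "s x = ennreal r" "recip s x = 1 / r"
proof (cases "s x")
  case (real r)
  then have "1 \<le> r" using exponents_ge1[OF assms, of x] by (simp add: one_ennreal_def[symmetric] flip: ennreal_1)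
  then show ?thesis using real that(2)[of r]
    by (simp add: recip_def divide_ennreal flip: ennreal_1)
next
  case top
  then show ?thesis using that(1) by (simp add: recip_def)
qed

lemma recip_eq_1D: "s \<in> exponents \<Longrightarrow> recip s x = 1 \<Longrightarrow> s x = 1"
  by (rule recip_cases[of s x]) (auto simp flip: ennreal_1)

lemma recip_bounds: "s \<in> exponents \<Longrightarrow> 0 \<le> recip s x \<and> recip s x \<le> 1"
  by (rule recip_cases[of s x]) auto

lemma recip_conj:
  assumes "conj_pair s s'"
  shows "recip s' x = 1 - recip s x"
proof -
  have s: "s \<in> exponents" "s' \<in> exponents" "1 / s x + 1 / s' x = 1" using assms by (auto simp: conj_pair_def)
  have fin: "1 / s x < top" "1 / s' x < top" using s(3)
    by (metis add_top_right_ennreal add_top_left_ennreal ennreal_one_less_top less_top order_less_irrefl)+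
  have "enn2real (1 / s x + 1 / s' x) = enn2real (1 / s x) + enn2real (1 / s' x)"
    by (rule enn2real_plus) (use fin in auto)
  then show ?thesis using s(3) unfolding recip_def by simp
qed

lemma Young_real:
  fixes a b r r' :: real
  assumes "0 \<le> a" "0 \<le> b" "1 < r" "1 < r'" "1 / r + 1 / r' = 1"
  shows "a * b \<le> a powr r + b powr r'"
proof -
  have "a * b \<le> a powr r / r + b powr r' / r'"
    using Youngs_inequality[of r r' a b] assms by auto
  also have "\<dots> \<le> a powr r / 1 + b powr r' / 1"
    using assms by (intro add_mono divide_left_mono) auto
  finally show ?thesis by simp
qed

text \<open>
  Where an exponent is infinite, the bound by 1 provided by the essential supremum replaces the power,
  and the conjugate exponent is 1 there.
\<close>

lemma Young_pointwise:
  assumes conj: "conj_pair s s'"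
    and F: "s x = \<infinity> \<Longrightarrow> F \<le> 1" and G: "s' x = \<infinity> \<Longrightarrow> G \<le> 1"
  shows "F * G \<le> epow F (enn2real (s x)) * indicator {x. s x < \<infinity>} x
    + epow G (enn2real (s' x)) * indicator {x. s' x < \<infinity>} x"
proof -
  have s: "s \<in> exponents" "s' \<in> exponents" and rc: "recip s' x = 1 - recip s x"
    using conj recip_conj[OF conj] by (auto simp: conj_pair_def)
  have one: "epow H 1 = H" for H by (cases H) (auto simp: epow_def)
  have side: "a * b \<le> b" if "a \<le> 1" for a b :: ennreal
    using mult_right_mono[OF that, of b] by simp
  show ?thesis
  proof (rule recip_cases[OF s(1), of x])
    assume "s x = \<infinity>" "recip s x = 0"
    then have sx: "s x = \<infinity>" "s' x = 1"
      using rc recip_eq_1D[OF s(2)] by auto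
    then show ?thesis using side[OF F[OF sx(1)], of G] by (auto simp: one)
  next
    fix r assume r: "1 \<le> r" "s x = ennreal r" "recip s x = 1 / r"
    show ?thesis
    proof (rule recip_cases[OF s(2), of x])
      assume "s' x = \<infinity>" "recip s' x = 0"
      then have sx: "s' x = \<infinity>" "s x = 1" using rc recip_eq_1D[OF s(1)] by auto
      then show ?thesis using side[OF G[OF sx(1)], of F] by (auto simp: one mult.commute)
    next
      fix r' assume r': "1 \<le> r'" "s' x = ennreal r'" "recip s' x = 1 / r'"
      have sum: "1 / r + 1 / r' = 1" using rc r r' by simp
      then have gt: "1 < r" "1 < r'" using r(1) r'(1) by (auto simp: less_le)
      show ?thesis
      proof (cases "F = \<infinity> \<or> G = \<infinity>")
        case True
        then show ?thesis using r r' by (auto simp: epow_def)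
      next
        case False
        then obtain a b where ab: "0 \<le> a" "F = ennreal a" "0 \<le> b" "G = ennreal b"
          by (cases F; cases G) auto
        have "F * G = ennreal (a * b)" using ab by (simp add: ennreal_mult)
        also have "\<dots> \<le> ennreal (a powr r + b powr r')"
          by (intro ennreal_leI Young_real) (use ab gt sum in auto)
        finally show ?thesis using ab r r' by (simp add: epow_ennreal)
      qed
    qed
  qed
qed

text \<open>
  Integrate Young's inequality for the normalised functions: each of the two modulars contributes at
  most 1, whence the constant 2.
\<close>

lemma Hoelder_norm_le:
  assumes conj: "conj_pair s s'"
    and F[measurable]: "F \<in> borel_measurable lebesgue" and G[measurable]: "G \<in> borel_measurable lebesgue"
    and a: "norm_le s F a" and b: "norm_le s' G b"
  shows "(\<integral>\<^sup>+x. F x * G x \<partial>lebesgue) \<le> ennreal (2 * a * b)"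
proof -
  have s[measurable]: "s \<in> borel_measurable lebesgue" "s' \<in> borel_measurable lebesgue"
    using conj by (auto simp: conj_pair_def exponents_measurable)
  have ab: "0 < a" "0 < b" using a b by (auto simp: norm_le_def)
  let ?F = "\<lambda>x. F x / ennreal a" and ?G = "\<lambda>x. G x / ennreal b"
  let ?I = "\<lambda>s F. \<integral>\<^sup>+x\<in>{x. s x < \<infinity>}. epow (F x) (enn2real (s x)) \<partial>lebesgue"
  have sup: "AE x in lebesgue. s x = \<infinity> \<longrightarrow> F x \<le> 1" if "nmod s F \<le> 1" for s F
  proof -
    have "esssup lebesgue (\<lambda>x. F x * indicator {x. s x = \<infinity>} x) \<le> 1"
      using that unfolding nmod_def by (meson add_increasing le_zero_eq order_trans zero_le order_refl)
    with esssup_AE[where f = "\<lambda>x. F x * indicator {x. s x = \<infinity>} x" and M = lebesgue]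
    have "AE x in lebesgue. F x * indicator {x. s x = \<infinity>} x \<le> 1"
      by (elim eventually_mono) (rule order_trans)
    then show ?thesis by eventually_elim (auto simp: indicator_def)
  qed
  have le1: "?I s F \<le> 1" if "nmod s F \<le> 1" for s F
    using that unfolding nmod_def by (rule order_trans[rotated]) (simp add: add_increasing2)
  have "(\<integral>\<^sup>+x. ?F x * ?G x \<partial>lebesgue) \<le> (\<integral>\<^sup>+x. epow (?F x) (enn2real (s x)) * indicator {x. s x < \<infinity>} x
      + epow (?G x) (enn2real (s' x)) * indicator {x. s' x < \<infinity>} x \<partial>lebesgue)"
  proof (rule nn_integral_mono_AE)
    have "AE x in lebesgue. s x = \<infinity> \<longrightarrow> ?F x \<le> 1" "AE x in lebesgue. s' x = \<infinity> \<longrightarrow> ?G x \<le> 1"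
      using sup[of s ?F] sup[of s' ?G] a b by (auto simp: norm_le_def)
    then show "AE x in lebesgue. ?F x * ?G x \<le> epow (?F x) (enn2real (s x)) * indicator {x. s x < \<infinity>} x
      + epow (?G x) (enn2real (s' x)) * indicator {x. s' x < \<infinity>} x"
      by eventually_elim (rule Young_pointwise[OF conj], auto)
  qed
  also have "\<dots> = ?I s ?F + ?I s' ?G"
    by (rule nn_integral_add) measurable
  also have "\<dots> \<le> 1 + 1"
    using le1[of s ?F] le1[of s' ?G] a b unfolding norm_le_def by (intro add_mono) auto
  finally have 1: "(\<integral>\<^sup>+x. ?F x * ?G x \<partial>lebesgue) \<le> 2" by simp
  have "F x * G x = ennreal (a * b) * (?F x * ?G x)" for x
  proof -
    have "ennreal (a * b) * (?F x * ?G x) = (ennreal a * ?F x) * (ennreal b * ?G x)"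
      using ab by (simp add: ennreal_mult ac_simps)
    then show ?thesis using ab by (simp only: ennreal_mult_divide_cancel)
  qed
  then have "(\<integral>\<^sup>+x. F x * G x \<partial>lebesgue) = ennreal (a * b) * (\<integral>\<^sup>+x. ?F x * ?G x \<partial>lebesgue)"
    by (subst nn_integral_cmult[symmetric]) auto
  also have "\<dots> \<le> ennreal (a * b) * 2" by (intro mult_left_mono 1) auto
  also have "\<dots> = ennreal (2 * a * b)" using ab by (simp add: ennreal_mult mult_ac)
  finally show ?thesis .
qed

section \<open>Norms of indicators, the condition A and duality\<close>

lemma e2ennreal_abs_indicator: "e2ennreal \<bar>indicator E x\<bar> = indicator E x"
  by (cases "x \<in> E") (simp_all add: one_ereal_def e2ennreal_neg)

lemma epow_divide_le:
  assumes "1 \<le> c" "1 \<le> r" "0 \<le> a"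
  shows "epow (ennreal a / ennreal c) r \<le> ennreal (a powr r / c)"
proof -
  have "c powr 1 \<le> c powr r" using assms by (intro powr_mono) auto
  then have "(a / c) powr r \<le> a powr r / c"
    using assms by (simp add: powr_divide divide_left_mono)
  then show ?thesis using assms by (simp add: divide_ennreal epow_ennreal ennreal_leI)
qed

lemma enn2real_exponent_ge1:
  assumes "s \<in> exponents" "s x < \<infinity>" shows "1 \<le> enn2real (s x)"
  by (rule recip_cases[OF assms(1), of x]) (use assms in auto)

lemma emeasure_lebesgue_finite:
  assumes "0 < vol E" shows "emeasure lebesgue E = ennreal (vol E)"
  using assms by (metis emeasure_eq_ennreal_measure less_irrefl measure_zero_top)

text \<open>
  A crude bound, which serves to show that functions of finite norm are locally integrable.
\<close>

lemma norm_le_indicator: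
  assumes s: "s \<in> exponents" and E[measurable]: "E \<in> sets lebesgue" and fin: "emeasure lebesgue E \<noteq> \<infinity>"
  shows "norm_le s (indicator E) (vol E + 1)"
proof -
  have [measurable]: "s \<in> borel_measurable lebesgue" using s by (rule exponents_measurable)
  let ?t = "vol E + 1"
  have t: "1 \<le> ?t" by simp
  have "1 / ennreal ?t = ennreal (1 / ?t)" using divide_ennreal[of 1 ?t] t by (simp only: ennreal_1)
  then have i: "indicator E x / ennreal ?t \<le> ennreal (1 / ?t) * indicator E x" for x
    by (cases "x \<in> E") simp_all
  have "(\<integral>\<^sup>+x\<in>{x. s x < \<infinity>}. epow (indicator E x / ennreal ?t) (enn2real (s x)) \<partial>lebesgue)
      \<le> (\<integral>\<^sup>+x. ennreal (1 / ?t) * indicator E x \<partial>lebesgue)"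
  proof (rule nn_integral_mono)
    fix x
    show "epow (indicator E x / ennreal ?t) (enn2real (s x)) * indicator {x. s x < \<infinity>} x
      \<le> ennreal (1 / ?t) * indicator E x"
      using epow_divide_le[OF t, of "enn2real (s x)" 1] enn2real_exponent_ge1[OF s, of x]
        epow_ennreal[of 0]
      by (auto simp: indicator_def)
  qed
  also have "\<dots> = ennreal (1 / ?t) * emeasure lebesgue E" by (rule nn_integral_cmult_indicator) simp
  also have "\<dots> = ennreal (vol E / ?t)"
    using fin by (simp add: emeasure_eq_ennreal_measure ennreal_mult[symmetric])
  finally have 1: "(\<integral>\<^sup>+x\<in>{x. s x < \<infinity>}. epow (indicator E x / ennreal ?t) (enn2real (s x)) \<partial>lebesgue)
      \<le> ennreal (vol E / ?t)" .
  have 2: "esssup lebesgue (\<lambda>x. indicator E x / ennreal ?t * indicator {x. s x = \<infinity>} x) \<le> ennreal (1 / ?t)"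
  proof (rule esssup_I, measurable, rule AE_I2)
    show "indicator E x / ennreal ?t * indicator {x. s x = \<infinity>} x \<le> ennreal (1 / ?t)" for x
      using i[of x] by (auto simp: indicator_def split: if_splits)
  qed
  have "nmod s (\<lambda>x. indicator E x / ennreal ?t) \<le> ennreal (vol E / ?t) + ennreal (1 / ?t)"
    unfolding nmod_def by (rule add_mono[OF 1 2])
  also have "\<dots> = ennreal (vol E / ?t + 1 / ?t)" by (rule ennreal_plus[symmetric]) auto
  also have "vol E / ?t + 1 / ?t = 1"
  proof -
    have "?t \<noteq> 0" using t by linarith
    then show ?thesis by (subst add_divide_distrib[symmetric]) (rule divide_self)
  qed
  finally show ?thesis using t unfolding norm_le_def by (auto simp: add_nonneg_pos)
qed

lemma norm_le_locally_integrable: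
  assumes s: "s \<in> exponents" and F: "F \<in> borel_measurable lebesgue" and t: "norm_le s F t"
    and E: "E \<in> sets lebesgue" "emeasure lebesgue E \<noteq> \<infinity>"
  shows "(\<integral>\<^sup>+x\<in>E. F x \<partial>lebesgue) < \<infinity>"
proof -
  have c: "conj_pair s (conj_exponent s)" using s by (rule conj_pair_conj_exponent)
  then have "norm_le (conj_exponent s) (indicator E) (vol E + 1)"
    using E by (intro norm_le_indicator) (auto simp: conj_pair_def)
  from Hoelder_norm_le[OF c F _ t this] E show ?thesis by (auto intro: le_less_trans)
qed

lemma recip_set_integrable:
  assumes "s \<in> exponents" "E \<in> sets lebesgue" "emeasure lebesgue E \<noteq> \<infinity>"
  shows "set_integrable lebesgue E (recip s)"
  unfolding set_integrable_def
proof (rule integrableI_bounded_set_indicator[where B = 1])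
  show "AE x in lebesgue. x \<in> E \<longrightarrow> norm (recip s x) \<le> 1"
    using recip_bounds[OF assms(1)] by auto
qed (use assms recip_measurable[of s] in \<open>auto simp: less_top\<close>)

lemma avg_recip_conj:
  assumes "conj_pair s s'" "E \<in> sets lebesgue" "0 < vol E"
  shows "avg (recip s') E = 1 - avg (recip s) E"
proof -
  have s: "s \<in> exponents" using assms by (simp add: conj_pair_def)
  have fin: "emeasure lebesgue E \<noteq> \<infinity>" using emeasure_lebesgue_finite[OF assms(3)] by simp
  have "(LINT x:E|lebesgue. recip s' x) = (LINT x:E|lebesgue. 1 - recip s x)"
    by (simp add: recip_conj[OF assms(1)])
  also have "\<dots> = (LINT x:E|lebesgue. 1) - (LINT x:E|lebesgue. recip s x)"
    by (rule set_integral_diff(2)[OF _ recip_set_integrable[OF s assms(2) fin]])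
      (use assms fin in \<open>auto simp: set_integrable_def less_top\<close>)
  also have "(LINT x:E|lebesgue. 1) = vol E"
    using assms fin by (simp add: set_lebesgue_integral_def)
  finally show ?thesis using assms(3) unfolding avg_def by (simp add: diff_divide_distrib)
qed

text \<open>
  The tangent line of the exponential at the mean gives Jensen's inequality, which here reads
  \<open>m\<^sup>\<theta> \<le> \<integral>\<^sub>E m\<^sup>r\<^sup>-\<^sup>1\<close> with \<open>r = recip s\<close> and \<open>\<theta>\<close> the mean of \<open>r\<close>.
\<close>

lemma Jensen_powr_avg:
  assumes s: "s \<in> exponents" and E[measurable]: "E \<in> sets lebesgue" and pos: "0 < vol E"
  defines "m \<equiv> vol E"
  shows "ennreal (m powr avg (recip s) E) \<le> (\<integral>\<^sup>+x\<in>E. ennreal (m powr (recip s x - 1)) \<partial>lebesgue)"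
proof -
  have fin: "emeasure lebesgue E = ennreal m" using emeasure_lebesgue_finite[OF pos] by (simp add: m_def)
  have m: "0 < m" using pos by (simp add: m_def)
  define a where "a = avg (recip s) E"
  have int: "set_integrable lebesgue E (recip s)" using s E fin by (intro recip_set_integrable) auto
  have int1: "set_integrable lebesgue E (\<lambda>x. c)" for c :: real
    using fin by (auto simp: set_integrable_def less_top)
  let ?h = "\<lambda>x. m powr (a - 1) * (1 + (recip s x - a) * ln m)"
  have int2: "set_integrable lebesgue E ?h"
    by (intro set_integrable_mult_right set_integral_add set_integrable_mult_left set_integral_diff int int1)
  have val: "(LINT x:E|lebesgue. ?h x) = m powr a"
  proof -
    have I1: "(LINT x:E|lebesgue. c) = c * m" for c :: real
      using fin by (simp add: set_lebesgue_integral_def m_def)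
    have Ir: "(LINT x:E|lebesgue. recip s x) = a * m" using m by (simp add: a_def avg_def m_def)
    have "(LINT x:E|lebesgue. (recip s x - a)) = 0"
      using set_integral_diff(2)[OF int int1[of a]] by (simp add: I1 Ir)
    moreover have "set_integrable lebesgue E (\<lambda>x. (recip s x - a))" by (intro set_integral_diff int int1)
    ultimately have "(LINT x:E|lebesgue. 1 + (recip s x - a) * ln m) = m"
      using set_integral_add(2)[OF int1[of 1], of "\<lambda>x. (recip s x - a) * ln m"]
      by (simp add: I1)
    then have "(LINT x:E|lebesgue. ?h x) = m powr (a - 1) * m" by simp
    also have "\<dots> = m powr a" using m by (simp add: powr_diff)
    finally show ?thesis .
  qed
  have point: "?h x \<le> m powr (recip s x - 1)" for x
  proof -
    have "1 + (recip s x - a) * ln m \<le> exp ((recip s x - a) * ln m)" by (rule exp_ge_add_one_self)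
    also have "\<dots> = m powr (recip s x - a)" using m by (simp add: powr_def)
    finally have "?h x \<le> m powr (a - 1) * m powr (recip s x - a)" by (intro mult_left_mono) auto
    also have "\<dots> = m powr (recip s x - 1)" by (simp add: powr_add[symmetric])
    finally show ?thesis .
  qed
  have "ennreal (m powr a) = ennreal (LINT x|lebesgue. indicator E x *\<^sub>R ?h x)"
    using val unfolding set_lebesgue_integral_def by simp
  also have "\<dots> \<le> (\<integral>\<^sup>+x. ennreal (norm (indicator E x *\<^sub>R (m powr (recip s x - 1)))) \<partial>lebesgue)"
  proof -
    have "ennreal (LINT x|lebesgue. indicator E x *\<^sub>R ?h x) \<le> (\<integral>\<^sup>+x. ennreal (indicator E x *\<^sub>R ?h x) \<partial>lebesgue)"
    proof -
      have i: "integrable lebesgue (\<lambda>x. indicator E x *\<^sub>R ?h x)" using int2 by (simp add: set_integrable_def)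
      have "(LINT x|lebesgue. indicator E x *\<^sub>R ?h x) \<le> (LINT x|lebesgue. max 0 (indicator E x *\<^sub>R ?h x))"
        by (rule integral_mono[OF i integrable_max[OF integrable_zero i]]) simp
      then have "ennreal (LINT x|lebesgue. indicator E x *\<^sub>R ?h x)
          \<le> ennreal (LINT x|lebesgue. max 0 (indicator E x *\<^sub>R ?h x))" by (rule ennreal_leI)
      also have "\<dots> = (\<integral>\<^sup>+x. ennreal (max 0 (indicator E x *\<^sub>R ?h x)) \<partial>lebesgue)"
        by (rule nn_integral_eq_integral[symmetric]) (use integrable_max[OF integrable_zero i] in simp_all)
      also have "\<dots> = (\<integral>\<^sup>+x. ennreal (indicator E x *\<^sub>R ?h x) \<partial>lebesgue)"
        by (intro nn_integral_cong) (auto simp: max_def ennreal_neg)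
      finally show ?thesis .
    qed
    also have "\<dots> \<le> (\<integral>\<^sup>+x. ennreal (norm (indicator E x *\<^sub>R (m powr (recip s x - 1)))) \<partial>lebesgue)"
      using point by (intro nn_integral_mono ennreal_leI) (auto simp: indicator_def)
    finally show ?thesis .
  qed
  also have "\<dots> = (\<integral>\<^sup>+x\<in>E. ennreal (m powr (recip s x - 1)) \<partial>lebesgue)"
    by (intro nn_integral_cong) (auto simp: indicator_def)
  finally show ?thesis unfolding a_def m_def .
qed

text \<open>
  With \<open>m\<close> the volume of \<open>E\<close>, the function \<open>m\<close> to the power \<open>recip s - 1\<close>, restricted to \<open>E\<close>, has norm at
  most 2 in the conjugate space, because its power with the conjugate exponent is \<open>1 / m\<close>. Pair it with
  the indicator of \<open>E\<close> by Hoelder's inequality and bound the integral below by Jensen's inequality.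
\<close>

lemma indicator_norm_lower:
  assumes conj: "conj_pair s s'" and E[measurable]: "E \<in> sets lebesgue" and pos: "0 < vol E"
    and b: "norm_le s (indicator E) b"
  shows "vol E powr avg (recip s) E \<le> 4 * b"
proof -
  define m where "m = vol E"
  have m: "0 < m" using pos by (simp add: m_def)
  have fin: "emeasure lebesgue E = ennreal m" using emeasure_lebesgue_finite[OF pos] by (simp add: m_def)
  have s: "s \<in> exponents" "s' \<in> exponents" using conj by (auto simp: conj_pair_def)
  have [measurable]: "s \<in> borel_measurable lebesgue" "s' \<in> borel_measurable lebesgue" "recip s \<in> borel_measurable lebesgue"
    using s by (auto intro: exponents_measurable recip_measurable)
  define G where "G x = ennreal (m powr (recip s x - 1)) * indicator E x" for x
  have Gm[measurable]: "G \<in> borel_measurable lebesgue" unfolding G_def by measurable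
  have "norm_le s' G 2"
  proof -
    have 1: "(\<integral>\<^sup>+x\<in>{x. s' x < \<infinity>}. epow (G x / ennreal 2) (enn2real (s' x)) \<partial>lebesgue)
        \<le> (\<integral>\<^sup>+x. ennreal (1 / m / 2) * indicator E x \<partial>lebesgue)"
    proof (rule nn_integral_mono)
      fix x
      show "epow (G x / ennreal 2) (enn2real (s' x)) * indicator {x. s' x < \<infinity>} x
        \<le> ennreal (1 / m / 2) * indicator E x"
      proof (cases "s' x < \<infinity> \<and> x \<in> E")
        case True
        then obtain r where r: "1 \<le> r" "s' x = ennreal r" "recip s' x = 1 / r"
          using recip_cases[OF s(2), of x] by (metis infinity_ennreal_def less_irrefl)
        have e: "recip s x - 1 = - (1 / r)" using recip_conj[OF conj, of x] r by simp
        have "(m powr (recip s x - 1)) powr r = m powr (- 1)"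
          unfolding e powr_powr using r by simp
        also have "\<dots> = 1 / m" using m by (simp add: powr_minus_divide)
        finally have "epow (ennreal (m powr (recip s x - 1)) / ennreal 2) r \<le> ennreal (1 / m / 2)"
          using epow_divide_le[of 2 r "m powr (recip s x - 1)"] r by simp
        then show ?thesis using True r by (simp add: G_def)
      next
        case False
        then show ?thesis using epow_ennreal[of 0 "enn2real (s' x)"] by (auto simp: G_def)
      qed
    qed
    also have "\<dots> = ennreal (1 / m / 2) * emeasure lebesgue E" by (rule nn_integral_cmult_indicator) simp
    also have "\<dots> = ennreal (1 / 2)" unfolding fin using m by (simp add: ennreal_mult[symmetric])
    finally have 1: "(\<integral>\<^sup>+x\<in>{x. s' x < \<infinity>}. epow (G x / ennreal 2) (enn2real (s' x)) \<partial>lebesgue) \<le> ennreal (1 / 2)" .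
    have 2: "esssup lebesgue (\<lambda>x. G x / ennreal 2 * indicator {x. s' x = \<infinity>} x) \<le> ennreal (1 / 2)"
    proof (rule esssup_I, measurable, rule AE_I2)
      fix x
      show "G x / ennreal 2 * indicator {x. s' x = \<infinity>} x \<le> ennreal (1 / 2)"
      proof (cases "s' x = \<infinity> \<and> x \<in> E")
        case True
        then have "recip s' x = 0" by (simp add: recip_def)
        then have "recip s x = 1" using recip_conj[OF conj, of x] by simp
        then have "G x = ennreal 1" using True m by (simp add: G_def)
        then have "G x / ennreal 2 = ennreal (1 / 2)" using divide_ennreal[of 1 2] by simp
        then show ?thesis by (simp add: indicator_def)
      qed (auto simp: G_def)
    qed
    have "nmod s' (\<lambda>x. G x / ennreal 2) \<le> ennreal (1 / 2) + ennreal (1 / 2)"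
      unfolding nmod_def by (rule add_mono[OF 1 2])
    also have "\<dots> = 1" by (subst ennreal_plus[symmetric]) auto
    finally show ?thesis by (simp add: norm_le_def)
  qed
  moreover have "indicator E \<in> borel_measurable lebesgue" by simp
  ultimately have "(\<integral>\<^sup>+x. indicator E x * G x \<partial>lebesgue) \<le> ennreal (2 * b * 2)"
    using Hoelder_norm_le[OF conj _ Gm b] by blast
  moreover have "(\<integral>\<^sup>+x. indicator E x * G x \<partial>lebesgue) = (\<integral>\<^sup>+x\<in>E. ennreal (m powr (recip s x - 1)) \<partial>lebesgue)"
    by (intro nn_integral_cong) (auto simp: G_def indicator_def)
  ultimately have "ennreal (m powr avg (recip s) E) \<le> ennreal (4 * b)"
    using Jensen_powr_avg[OF s(1) E pos] by (simp add: m_def mult_ac)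
  then show ?thesis using b by (subst (asm) ennreal_le_iff) (auto simp: m_def norm_le_def)
qed

lemma indicator_Lp_norm_lower:
  assumes conj: "conj_pair s s'" and E: "E \<in> sets lebesgue" "0 < vol E"
  shows "ennreal (vol E powr avg (recip s) E / 4) \<le> Lp_norm s (indicator E)"
  unfolding Lp_norm_eq
proof (rule Inf_greatest)
  fix z assume "z \<in> {ennreal t | t. norm_le s (\<lambda>x. e2ennreal \<bar>indicator E x\<bar>) t}"
  then obtain t where t: "z = ennreal t" "norm_le s (\<lambda>x. e2ennreal \<bar>indicator E x\<bar>) t" by auto
  have "(\<lambda>x. e2ennreal \<bar>indicator E x\<bar>) = indicator E" by (simp only: e2ennreal_abs_indicator)
  then show "ennreal (vol E powr avg (recip s) E / 4) \<le> z"
    using indicator_norm_lower[OF conj E, of t] t by (intro ord_le_eq_trans[OF ennreal_leI t(1)[symmetric]]) auto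
qed

lemma measure_ball_pos: "0 < r \<Longrightarrow> 0 < vol (ball (c :: real ^ 'n) r)"
  using content_ball_gt_0_iff[of c r] by (simp del: content_ball_gt_0_iff)

text \<open>
  Condition A bounds the product of the two indicator norms by a multiple of the volume; dividing by
  the lower bound for the conjugate norm leaves the upper bound for the other one. The condition is
  spelled out for an arbitrary conjugate pair so that the lemma also applies to the exchanged pair.
\<close>

lemma one_in_A_norm_le:
  fixes s :: "real ^ 'n \<Rightarrow> ennreal"
  assumes conj: "conj_pair s s'" and fin: "(SUP (c, r) \<in> {(c, r). r > 0}.
        Lp_norm s (indicator (ball c r)) * Lp_norm s' (indicator (ball c r))
          / ennreal (vol (ball c r))) < \<infinity>"
  obtains C where "0 < C" "\<And>c r. 0 < r \<Longrightarrow>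
    norm_le s (indicator (ball c r)) (C * vol (ball c r) powr avg (recip s) (ball c r))"
proof -
  define A where "A = (SUP (c, r) \<in> {(c, r). r > 0}.
        Lp_norm s (indicator (ball (c :: real ^ 'n) r)) * Lp_norm s' (indicator (ball c r))
          / ennreal (vol (ball c r)))"
  have A: "A = ennreal (enn2real A)" using fin by (simp add: A_def)
  define C where "C = 4 * enn2real A + 1"
  have C: "0 < C" unfolding C_def by (simp add: add_nonneg_pos)
  have s: "s \<in> exponents" using conj by (simp add: conj_pair_def)
  show ?thesis
  proof (rule that[OF C])
    fix c :: "real ^ 'n" and r :: real assume r: "0 < r"
    let ?B = "ball c r" and ?m = "vol (ball c r)"
    let ?\<theta> = "avg (recip s) ?B"
    have m: "0 < ?m" by (rule measure_ball_pos[OF r])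
    have Bs: "?B \<in> sets lebesgue" by simp
    define N where "N = Lp_norm s (indicator ?B)"
    define N' where "N' = Lp_norm s' (indicator ?B)"
    have "(case (c, r) of (c, r) \<Rightarrow> Lp_norm s (indicator (ball c r)) * Lp_norm s' (indicator (ball c r))
          / ennreal (vol (ball c r))) \<le> A"
      unfolding A_def by (rule SUP_upper) (use r in simp)
    then have "N * N' / ennreal ?m \<le> A" unfolding N_def N'_def by simp
    then have "N * N' / ennreal ?m * ennreal ?m \<le> A * ennreal ?m" by (rule mult_right_mono) simp
    then have NN: "N * N' \<le> A * ennreal ?m"
      unfolding ennreal_divide_times using m by (simp add: ennreal_divide_self)
    have "ennreal (?m powr (1 - ?\<theta>) / 4) \<le> N'"
      using indicator_Lp_norm_lower[OF conj_pair_sym[OF conj] Bs m] avg_recip_conj[OF conj Bs m]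
      unfolding N'_def by simp
    then have "N * ennreal (?m powr (1 - ?\<theta>) / 4) \<le> A * ennreal ?m"
      using NN by (meson mult_left_mono order_trans zero_le)
    also have "\<dots> = ennreal (enn2real A * ?m)" by (subst A) (simp add: ennreal_mult)
    finally have le: "N * ennreal (?m powr (1 - ?\<theta>) / 4) \<le> ennreal (enn2real A * ?m)" .
    have "N \<noteq> \<infinity>"
    proof
      assume "N = \<infinity>"
      then show False using le m by (simp add: ennreal_top_mult top_unique)
    qed
    then obtain n where n: "0 \<le> n" "N = ennreal n" by (cases N) auto
    have "n * (?m powr (1 - ?\<theta>) / 4) \<le> enn2real A * ?m"
      using le n by (simp add: ennreal_mult[symmetric])
    then have "n * ?m powr (1 - ?\<theta>) \<le> (4 * enn2real A * ?m powr ?\<theta>) * ?m powr (1 - ?\<theta>)"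
      using m by (simp add: mult.assoc powr_add[symmetric])
    then have "n \<le> 4 * enn2real A * ?m powr ?\<theta>" using m by simp
    also have "\<dots> < C * ?m powr ?\<theta>" using m unfolding C_def by simp
    finally have "N < ennreal (C * ?m powr ?\<theta>)" using n by (simp add: ennreal_lessI)
    moreover have eq: "(\<lambda>x. e2ennreal \<bar>indicator ?B x\<bar>) = indicator ?B"
      by (simp only: e2ennreal_abs_indicator)
    moreover have "(indicator ?B :: real ^ 'n \<Rightarrow> ennreal) \<in> borel_measurable lebesgue"
      by (rule borel_measurable_indicator[OF Bs])
    ultimately show "norm_le s (indicator ?B) (C * ?m powr ?\<theta>)"
      using norm_leI_Lp_norm[OF s, of "indicator ?B" "C * ?m powr ?\<theta>"] unfolding N_def eq by blast
  qed
qed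

lemma one_in_A_indicator_norms:
  fixes s :: "real ^ 'n \<Rightarrow> ennreal"
  assumes s: "s \<in> exponents" and A: "one_in_A s"
  obtains C where "0 < C"
    "\<And>c r. 0 < r \<Longrightarrow> norm_le s (indicator (ball c r)) (C * vol (ball c r) powr avg (recip s) (ball c r))"
    "\<And>c r. 0 < r \<Longrightarrow> norm_le (conj_exponent s) (indicator (ball c r))
      (C * vol (ball c r) powr (1 - avg (recip s) (ball c r)))"
proof -
  have conj: "conj_pair s (conj_exponent s)" using s by (rule conj_pair_conj_exponent)
  have s': "conj_exponent s \<in> exponents" using conj by (simp add: conj_pair_def)
  obtain C1 where C1: "0 < C1" "\<And>c r. 0 < r \<Longrightarrow>
    norm_le s (indicator (ball c r)) (C1 * vol (ball c r) powr avg (recip s) (ball c r))"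
    using one_in_A_norm_le[OF conj A[unfolded one_in_A_def]] by metis
  have A': "(SUP (c, r) \<in> {(c, r). r > 0}.
        Lp_norm (conj_exponent s) (indicator (ball (c :: real ^ 'n) r)) * Lp_norm s (indicator (ball c r))
          / ennreal (vol (ball c r))) < \<infinity>"
    using A unfolding one_in_A_def by (simp add: mult.commute)
  obtain C2 where C2: "0 < C2" "\<And>c r. 0 < r \<Longrightarrow> norm_le (conj_exponent s) (indicator (ball c r))
      (C2 * vol (ball c r) powr avg (recip (conj_exponent s)) (ball c r))"
    using one_in_A_norm_le[OF conj_pair_sym[OF conj] A'] by metis
  have meas: "(indicator (ball c r) :: real ^ 'n \<Rightarrow> ennreal) \<in> borel_measurable lebesgue" for c r
    by (rule borel_measurable_indicator) simp
  show ?thesis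
  proof (rule that[of "max C1 C2"])
    fix c :: "real ^ 'n" and r :: real assume r: "0 < r"
    show "norm_le s (indicator (ball c r)) (max C1 C2 * vol (ball c r) powr avg (recip s) (ball c r))"
      by (rule norm_le_weaken[OF s C1(2)[OF r] _ disjI1[OF meas]]) (rule mult_right_mono, auto)
    have e: "avg (recip (conj_exponent s)) (ball c r) = 1 - avg (recip s) (ball c r)"
      by (rule avg_recip_conj[OF conj]) (use measure_ball_pos[OF r] in auto)
    show "norm_le (conj_exponent s) (indicator (ball c r))
      (max C1 C2 * vol (ball c r) powr (1 - avg (recip s) (ball c r)))"
      by (rule norm_le_weaken[OF s' C2(2)[OF r] _ disjI1[OF meas]], unfold e) (rule mult_right_mono, auto)
  qed (use C1 in auto)
qed

text \<open>
  The norm of the indicator of \<open>E\<close> is at least \<open>vol E powr avg (recip s) E\<close> up to a constant, it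
  increases with \<open>E\<close>, and on balls it is at most the corresponding power.
\<close>

lemma one_in_A_subset_powr:
  fixes s :: "real ^ 'n \<Rightarrow> ennreal"
  assumes s: "s \<in> exponents" and A: "one_in_A s"
  obtains C where "1 \<le> C"
    "\<And>c r E. 0 < r \<Longrightarrow> E \<in> sets lebesgue \<Longrightarrow> 0 < vol E \<Longrightarrow> E \<subseteq> ball c r \<Longrightarrow>
      vol E powr avg (recip s) E \<le> C * vol (ball c r) powr avg (recip s) (ball c r)"
    "\<And>c r E. 0 < r \<Longrightarrow> E \<in> sets lebesgue \<Longrightarrow> 0 < vol E \<Longrightarrow> E \<subseteq> ball c r \<Longrightarrow>
      vol E powr (1 - avg (recip s) E)
        \<le> C * vol (ball c r) powr (1 - avg (recip s) (ball c r))"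
proof -
  have conj: "conj_pair s (conj_exponent s)" using s by (rule conj_pair_conj_exponent)
  have s': "conj_exponent s \<in> exponents" using conj by (simp add: conj_pair_def)
  obtain C where C: "0 < C"
    "\<And>c r. 0 < r \<Longrightarrow> norm_le s (indicator (ball c r)) (C * vol (ball c r) powr avg (recip s) (ball c r))"
    "\<And>c r. 0 < r \<Longrightarrow> norm_le (conj_exponent s) (indicator (ball c r))
      (C * vol (ball c r) powr (1 - avg (recip s) (ball c r)))"
    using one_in_A_indicator_norms[OF s A] by metis
  have smaller: "norm_le u (indicator E) t" if "u \<in> exponents" "norm_le u (indicator B) t" "E \<subseteq> B" "E \<in> sets lebesgue"
    for u :: "real ^ 'n \<Rightarrow> ennreal" and B E t
    using norm_le_mono[OF that(1,2), of "indicator E" 1] that by (auto simp: indicator_def)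
  show ?thesis
  proof (rule that[of "max 1 (4 * C)"])
    fix c :: "real ^ 'n" and r :: real and E :: "(real ^ 'n) set"
    assume r: "0 < r" and E: "E \<in> sets lebesgue" "0 < vol E" "E \<subseteq> ball c r"
    let ?m = "vol (ball c r)" and ?a = "avg (recip s) (ball c r)"
    have "vol E powr avg (recip s) E \<le> 4 * (C * ?m powr ?a)"
      by (rule indicator_norm_lower[OF conj E(1,2)]) (rule smaller[OF s C(2)[OF r] E(3,1)])
    also have "\<dots> \<le> max 1 (4 * C) * ?m powr ?a"
      unfolding mult.assoc[symmetric] by (rule mult_right_mono) auto
    finally show "vol E powr avg (recip s) E \<le> max 1 (4 * C) * ?m powr ?a" .
    have "vol E powr avg (recip (conj_exponent s)) E \<le> 4 * (C * ?m powr (1 - ?a))"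
      by (rule indicator_norm_lower[OF conj_pair_sym[OF conj] E(1,2)]) (rule smaller[OF s' C(3)[OF r] E(3,1)])
    also have "\<dots> \<le> max 1 (4 * C) * ?m powr (1 - ?a)"
      unfolding mult.assoc[symmetric] by (rule mult_right_mono) auto
    finally show "vol E powr (1 - avg (recip s) E) \<le> max 1 (4 * C) * ?m powr (1 - ?a)"
      using avg_recip_conj[OF conj E(1,2)] by simp
  qed auto
qed

text \<open>
  The powers with the mean and with one minus the mean multiply to the volume. So the upper bound of
  one of them by the value on the ball gives a lower bound for the other one on any subset that fills
  a fixed fraction of the ball.
\<close>

lemma one_in_A_comparable_powr:
  fixes s :: "real ^ 'n \<Rightarrow> ennreal"
  assumes s: "s \<in> exponents" and A: "one_in_A s"
  obtains C where "1 \<le> C"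
    "\<And>c r E F k. 0 < r \<Longrightarrow> E \<in> sets lebesgue \<Longrightarrow> F \<in> sets lebesgue \<Longrightarrow> 0 < vol E \<Longrightarrow>
      0 < vol F \<Longrightarrow> E \<subseteq> ball c r \<Longrightarrow> F \<subseteq> ball c r \<Longrightarrow>
      vol (ball c r) \<le> k * vol F \<Longrightarrow>
      vol E powr (1 - avg (recip s) E) \<le> C * k * vol F powr (1 - avg (recip s) F)
      \<and> vol E powr avg (recip s) E \<le> C * k * vol F powr avg (recip s) F"
proof -
  obtain C where C: "1 \<le> C"
    "\<And>c r E. 0 < r \<Longrightarrow> E \<in> sets lebesgue \<Longrightarrow> 0 < vol E \<Longrightarrow> E \<subseteq> ball c r \<Longrightarrow>
      vol E powr avg (recip s) E \<le> C * vol (ball c r) powr avg (recip s) (ball c r)"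
    "\<And>c r E. 0 < r \<Longrightarrow> E \<in> sets lebesgue \<Longrightarrow> 0 < vol E \<Longrightarrow> E \<subseteq> ball c r \<Longrightarrow>
      vol E powr (1 - avg (recip s) E)
        \<le> C * vol (ball c r) powr (1 - avg (recip s) (ball c r))"
    using one_in_A_subset_powr[OF s A] by metis
  have aux: "e \<le> C * C * k * (f powr (1 - v))"
    if "e \<le> C * b powr (1 - u)" "f powr v \<le> C * b powr u" "b \<le> k * f" "0 < b" "0 < f"
    for e b f u v k :: real
  proof -
    have "e * f powr v \<le> (C * b powr (1 - u)) * (C * b powr u)"
      using that C(1) by (intro mult_mono) auto
    also have "\<dots> = C * C * (b powr (1 - u) * b powr u)" by (simp only: mult_ac)
    also have "\<dots> = C * C * b" using that(4) by (simp add: powr_add[symmetric])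
    also have "\<dots> \<le> C * C * (k * f)" using that C(1) by (intro mult_left_mono) auto
    also have "\<dots> = (C * C * k * f powr (1 - v)) * f powr v"
      using that(5) by (simp add: powr_add[symmetric])
    finally show ?thesis using that(5) by simp
  qed
  show ?thesis
  proof (rule that[of "C * C"])
    show "1 \<le> C * C" using mult_mono[of 1 C 1 C] C(1) by simp
    fix c :: "real ^ 'n" and r :: real and E F :: "(real ^ 'n) set" and k :: real
    assume r: "0 < r" and E: "E \<in> sets lebesgue" and F: "F \<in> sets lebesgue"
      and E0: "0 < vol E" and F0: "0 < vol F"
      and EB: "E \<subseteq> ball c r" and FB: "F \<subseteq> ball c r"
      and k: "vol (ball c r) \<le> k * vol F"
    note b0 = measure_ball_pos[OF r, of c]
    show "vol E powr (1 - avg (recip s) E) \<le> C * C * k * vol F powr (1 - avg (recip s) F)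
      \<and> vol E powr avg (recip s) E \<le> C * C * k * vol F powr avg (recip s) F"
      using aux[OF C(3)[OF r E E0 EB] C(2)[OF r F F0 FB] k b0 F0]
        aux[of "vol E powr avg (recip s) E" _ "1 - avg (recip s) (ball c r)", OF _ C(3)[OF r F F0 FB] k b0 F0]
        C(2)[OF r E E0 EB]
      by simp
  qed
qed

lemma conj_exponent_finite:
  assumes q: "q \<in> exponents" and gt: "AE x in lebesgue. 1 < q x"
  shows "AE x in lebesgue. conj_exponent q x < \<infinity>"
  using gt
proof eventually_elim
  case (elim x)
  have "recip (conj_exponent q) x \<noteq> 0"
    using elim recip_conj[OF conj_pair_conj_exponent[OF q], of x] recip_eq_1D[OF q, of x] by auto
  then show ?case by (cases "conj_exponent q x = \<infinity>") (auto simp: recip_def less_top)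
qed

text \<open>
  Test against \<open>g = (h / 2K)\<close> to the power \<open>r - 1\<close>. If the modular \<open>R\<close> of \<open>h / 2K\<close> exceeds 1, then \<open>g / R\<close>
  has conjugate modular at most 1, while the integral of \<open>h g\<close> is \<open>2 K R\<close>. The factor 2 makes this
  contradict the bound \<open>K R\<close>, so no continuity of the modular in the scale is needed. Since the
  exponent may be unbounded, the argument is carried out on sets where it is bounded, so that \<open>R\<close> is
  finite, and the modular is recovered by monotone convergence.
\<close>

lemma norm_le_by_duality:
  fixes q :: "real ^ 'n \<Rightarrow> ennreal" and h :: "real ^ 'n \<Rightarrow> real"
  assumes q: "q \<in> exponents" and qfin: "AE x in lebesgue. 1 < q x \<and> q x < \<infinity>"
    and h[measurable]: "h \<in> borel_measurable lebesgue" and h0: "\<And>x. 0 \<le> h x" and hB: "\<And>x. h x \<le> B"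
    and E[measurable]: "E \<in> sets lebesgue" and Efin: "emeasure lebesgue E \<noteq> \<infinity>" and supp: "\<And>x. x \<notin> E \<Longrightarrow> h x = 0"
    and K: "0 < K"
    and dual: "\<And>g b. g \<in> borel_measurable lebesgue \<Longrightarrow> (\<And>x. 0 \<le> g x) \<Longrightarrow>
      norm_le (conj_exponent q) (\<lambda>x. ennreal (g x)) b \<Longrightarrow> (\<integral>\<^sup>+x. ennreal (h x * g x) \<partial>lebesgue) \<le> ennreal (K * b)"
  shows "norm_le q (\<lambda>x. ennreal (h x)) (2 * K)"
proof -
  have conj: "conj_pair q (conj_exponent q)" using q by (rule conj_pair_conj_exponent)
  have q': "conj_exponent q \<in> exponents" using conj by (simp add: conj_pair_def)
  have [measurable]: "q \<in> borel_measurable lebesgue" "conj_exponent q \<in> borel_measurable lebesgue"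
    using q q' by (auto intro: exponents_measurable)
  define r where "r x = enn2real (q x)" for x
  have [measurable]: "r \<in> borel_measurable lebesgue" unfolding r_def by measurable
  define D where "D N = {x. 1 < q x \<and> q x \<le> of_nat N}" for N :: nat
  have [measurable]: "D N \<in> sets lebesgue" for N
  proof -
    have "{x \<in> space lebesgue. 1 < q x \<and> q x \<le> of_nat N} \<in> sets lebesgue" by measurable
    then show ?thesis unfolding D_def by simp
  qed
  have on_D: "q x = ennreal (r x) \<and> 1 < r x \<and> r x \<le> real N" if "x \<in> D N" for x N
  proof -
    have "q x \<noteq> \<infinity>" using that unfolding D_def by (auto simp: top_unique)
    then have e: "q x = ennreal (r x)" unfolding r_def by (simp add: less_top)
    have "0 \<le> r x" unfolding r_def by simp
    then show ?thesis using that e unfolding D_def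
      by (auto simp: ennreal_of_nat_eq_real_of_nat ennreal_less_iff simp flip: ennreal_1)
  qed
  define G where "G N x = (h x / (2 * K)) powr r x * indicator (D N) x" for N x
  have [measurable]: "G N \<in> borel_measurable lebesgue" for N unfolding G_def by measurable
  have G0: "0 \<le> G N x" for N x unfolding G_def by simp
  have each: "(\<integral>\<^sup>+x. ennreal (G N x) \<partial>lebesgue) \<le> 1" for N
  proof (rule ccontr)
    assume "\<not> ?thesis"
    then have gt: "1 < (\<integral>\<^sup>+x. ennreal (G N x) \<partial>lebesgue)" by simp
    have "(\<integral>\<^sup>+x. ennreal (G N x) \<partial>lebesgue)
        \<le> (\<integral>\<^sup>+x. ennreal (max 1 (B / (2 * K)) powr real N) * indicator E x \<partial>lebesgue)"
    proof (rule nn_integral_mono)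
      fix x
      show "ennreal (G N x) \<le> ennreal (max 1 (B / (2 * K)) powr real N) * indicator E x"
      proof (cases "x \<in> D N \<and> x \<in> E")
        case True
        have "(h x / (2 * K)) powr r x \<le> max 1 (B / (2 * K)) powr r x"
          using on_D[of x N] True h0[of x] hB[of x] K
          by (intro powr_mono2) (auto simp: le_max_iff_disj divide_right_mono)
        also have "\<dots> \<le> max 1 (B / (2 * K)) powr real N"
          using on_D[of x N] True by (intro powr_mono) auto
        finally show ?thesis using True by (simp add: G_def ennreal_leI)
      qed (auto simp: G_def supp)
    qed
    also have "\<dots> < \<infinity>" using Efin by (simp add: nn_integral_cmult_indicator ennreal_mult_less_top less_top)
    finally obtain R where R: "0 \<le> R" "(\<integral>\<^sup>+x. ennreal (G N x) \<partial>lebesgue) = ennreal R"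
      by (cases "\<integral>\<^sup>+x. ennreal (G N x) \<partial>lebesgue") auto
    have R1: "1 < R" using gt R by (simp add: ennreal_less_iff flip: ennreal_1)
    define g where "g x = (h x / (2 * K)) powr (r x - 1) * indicator (D N) x" for x
    have gm[measurable]: "g \<in> borel_measurable lebesgue" unfolding g_def by measurable
    have g0: "0 \<le> g x" for x unfolding g_def by simp
    have fin': "AE x in lebesgue. conj_exponent q x < \<infinity>"
      by (rule conj_exponent_finite[OF q]) (use qfin in \<open>auto elim: eventually_mono\<close>)
    have "norm_le (conj_exponent q) (\<lambda>x. ennreal (g x)) R"
    proof -
      have "nmod (conj_exponent q) (\<lambda>x. ennreal (g x) / ennreal R)
          = (\<integral>\<^sup>+x. epow (ennreal (g x) / ennreal R) (enn2real (conj_exponent q x)) \<partial>lebesgue)"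
        by (rule nmod_finite[OF fin'])
      also have "\<dots> \<le> (\<integral>\<^sup>+x. ennreal (1 / R) * ennreal (G N x) \<partial>lebesgue)"
      proof (rule nn_integral_mono_AE, use fin' in eventually_elim)
        case (elim x)
        obtain r' where r': "1 \<le> r'" "conj_exponent q x = ennreal r'" "recip (conj_exponent q) x = 1 / r'"
          using recip_cases[OF q', of x] elim by (metis infinity_ennreal_def less_irrefl)
        have "g x powr r' = G N x"
        proof (cases "x \<in> D N")
          case True
          note d = on_D[OF True]
          have "recip q x = 1 / r x" unfolding recip_def using d by (simp add: divide_ennreal flip: ennreal_1)
          then have "1 / r' = 1 - 1 / r x" using recip_conj[OF conj, of x] r' by simp
          then have "(r x - 1) * r' = r x" using d r' by (simp add: field_simps)
          then show ?thesis using True by (simp add: g_def G_def powr_powr)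
        qed (simp add: g_def G_def)
        then have "epow (ennreal (g x) / ennreal R) r' \<le> ennreal (G N x / R)"
          using epow_divide_le[of R r' "g x"] R1 r' g0[of x] by simp
        also have "\<dots> = ennreal (1 / R) * ennreal (G N x)"
          using R1 G0 by (simp add: ennreal_mult[symmetric])
        finally show ?case using r' by simp
      qed
      also have "\<dots> = ennreal (1 / R) * ennreal R"
        unfolding R(2)[symmetric] by (rule nn_integral_cmult) measurable
      also have "\<dots> = 1" using R1 by (simp add: ennreal_mult[symmetric])
      finally show ?thesis using R1 by (simp add: norm_le_def)
    qed
    from dual[OF gm g0 this] have "(\<integral>\<^sup>+x. ennreal (h x * g x) \<partial>lebesgue) \<le> ennreal (K * R)" .
    also have "(\<integral>\<^sup>+x. ennreal (h x * g x) \<partial>lebesgue) = (\<integral>\<^sup>+x. ennreal (2 * K) * ennreal (G N x) \<partial>lebesgue)"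
    proof (rule nn_integral_cong)
      fix x
      have "h x * g x = 2 * K * G N x"
      proof (cases "h x = 0")
        case False
        have "(h x / (2 * K)) powr r x = (h x / (2 * K)) powr (r x - 1) * (h x / (2 * K)) powr 1"
          unfolding powr_add[symmetric] by simp
        also have "(h x / (2 * K)) powr 1 = h x / (2 * K)" using h0[of x] K by simp
        finally show ?thesis using K by (simp add: g_def G_def)
      qed (simp add: g_def G_def)
      then show "ennreal (h x * g x) = ennreal (2 * K) * ennreal (G N x)"
        using K G0 by (simp add: ennreal_mult)
    qed
    also have "\<dots> = ennreal (2 * K) * ennreal R"
      unfolding R(2)[symmetric] by (rule nn_integral_cmult) measurable
    also have "\<dots> = ennreal (2 * K * R)" using K R by (simp add: ennreal_mult)
    finally have "2 * K * R \<le> K * R" using K R by simp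
    then show False using K R1 by simp
  qed
  have "nmod q (\<lambda>x. ennreal (h x) / ennreal (2 * K)) = (\<integral>\<^sup>+x. epow (ennreal (h x) / ennreal (2 * K)) (r x) \<partial>lebesgue)"
    unfolding r_def by (rule nmod_finite) (use qfin in \<open>auto elim: eventually_mono\<close>)
  also have "\<dots> = (\<integral>\<^sup>+x. (SUP N. ennreal (G N x)) \<partial>lebesgue)"
  proof (rule nn_integral_cong_AE, use qfin in eventually_elim)
    case (elim x)
    have ep: "epow (ennreal (h x) / ennreal (2 * K)) (r x) = ennreal ((h x / (2 * K)) powr r x)"
      using h0[of x] K by (simp add: divide_ennreal epow_ennreal)
    obtain N :: nat where "q x \<le> of_nat N"
      using elim ennreal_Ex_less_of_nat[of "q x"] by (auto intro: less_imp_le)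
    then have "x \<in> D N" using elim by (simp add: D_def)
    then have "ennreal ((h x / (2 * K)) powr r x) = ennreal (G N x)" by (simp add: G_def)
    moreover have "ennreal (G M x) \<le> ennreal ((h x / (2 * K)) powr r x)" for M
      unfolding G_def by (intro ennreal_leI) (auto simp: indicator_def)
    ultimately show ?case unfolding ep by (intro antisym SUP_least) (auto intro: SUP_upper2[of N])
  qed
  also have "\<dots> = (SUP N. \<integral>\<^sup>+x. ennreal (G N x) \<partial>lebesgue)"
  proof (rule nn_integral_monotone_convergence_SUP)
    show "incseq (\<lambda>N x. ennreal (G N x))"
    proof (intro incseq_SucI le_funI ennreal_leI)
      fix N x
      have "of_nat N \<le> (of_nat (Suc N) :: ennreal)" by (rule of_nat_mono) simp
      then have "D N \<subseteq> D (Suc N)" unfolding D_def by (blast intro: order_trans)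
      then show "G N x \<le> G (Suc N) x" unfolding G_def by (auto simp: indicator_def)
    qed
  qed measurable
  also have "\<dots> \<le> 1" by (rule SUP_least) (rule each)
  finally show ?thesis using K by (simp add: norm_le_def)
qed

section \<open>Balls, cubes and dyadic lattices\<close>

lemma measure_ball:
  fixes c :: "real ^ 'n"
  assumes "0 \<le> r"
  shows "vol (ball c r) = unit_ball_vol (real CARD('n)) * r ^ CARD('n)"
  using content_ball[OF assms, of c] by simp

lemma cube_measure:
  fixes a :: "real ^ 'n"
  assumes "0 \<le> l"
  shows "cube a l \<in> sets lebesgue" "vol (cube a l) = l ^ CARD('n)"
proof -
  let ?b = "\<chi> i. a $ i + l"
  have N: "cbox a ?b - cube a l \<in> null_sets lebesgue"
  proof -
    have "cbox a ?b - cube a l \<subseteq> cbox a ?b - box a ?b"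
      by (auto simp: cube_def mem_box_cart less_imp_le)
    moreover have "cbox a ?b - box a ?b \<in> null_sets lebesgue"
      using negligible_frontier_interval[of a ?b] by (simp add: negligible_iff_null_sets)
    ultimately show ?thesis by (rule completion.complete2)
  qed
  have eq: "cube a l = cbox a ?b - (cbox a ?b - cube a l)"
    by (auto simp: cube_def mem_box_cart less_imp_le)
  have c: "cbox a ?b \<in> sets lebesgue" by simp
  show "cube a l \<in> sets lebesgue" by (subst eq) (use N c in \<open>blast intro: sets.Diff null_setsD2\<close>)
  have "vol (cube a l) = vol (cbox a ?b)"
    by (subst eq) (rule measure_Diff_null_set[OF c N])
  also have "\<dots> = measure lborel (cbox a ?b)" by simp
  also have "\<dots> = (\<Prod>i\<in>UNIV. ?b $ i - a $ i)"
    by (rule content_cbox_cart) (use assms in \<open>auto simp: interval_ne_empty_cart\<close>)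
  finally show "vol (cube a l) = l ^ CARD('n)" by simp
qed

lemma cube_dist_less:
  fixes a x :: "real ^ 'n"
  assumes "x \<in> cube a l"
  shows "dist x a < real CARD('n) * l"
proof -
  have "dist x a \<le> (\<Sum>i\<in>UNIV. \<bar>x $ i - a $ i\<bar>)"
    using norm_le_l1_cart[of "x - a"] by (simp add: dist_norm)
  also have "\<dots> < (\<Sum>i\<in>(UNIV :: 'n set). l)"
  proof (rule sum_strict_mono)
    fix i
    have "a $ i \<le> x $ i \<and> x $ i < a $ i + l" using assms by (simp add: cube_def)
    then show "\<bar>x $ i - a $ i\<bar> < l" by auto
  qed auto
  finally show ?thesis by simp
qed

lemma cube_dist_less2:
  fixes a x y :: "real ^ 'n"
  assumes "x \<in> cube a l" "y \<in> cube a l"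
  shows "dist x y < 2 * real CARD('n) * l"
  using cube_dist_less[OF assms(1)] cube_dist_less[OF assms(2)] dist_triangle2[of x y a] by linarith

text \<open>
  Cubes of a dyadic lattice that have a common point and the same side therefore coincide.
\<close>

lemma cube_subset_imp_eq:
  fixes a b :: "real ^ 'n"
  assumes l: "0 < l" and sub: "cube a l \<subseteq> cube b l"
  shows "a = b"
proof (rule vec_eq_iff[THEN iffD2], rule allI, rule ccontr)
  fix i assume ne: "a $ i \<noteq> b $ i"
  have "a \<in> cube b l" using l sub by (auto simp: cube_def)
  then have ab: "b $ i < a $ i" "a $ i < b $ i + l" using ne by (auto simp: cube_def less_le)
  let ?z = "\<chi> j. if j = i then b $ i + l else a $ j"
  have "?z \<in> cube a l" using l ab by (auto simp: cube_def)
  then have "?z \<in> cube b l" using sub by auto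
  then have "?z $ i < b $ i + l" unfolding cube_def by blast
  then show False by simp
qed

text \<open>
  The numerical core of the one-third trick: the integers and their translates by a third are at mutual
  distance at least a third, so an interval shorter than a third cannot meet both grids.
\<close>

lemma floor_eq_shift:
  fixes X Y d :: real
  assumes "\<bar>X - Y\<bar> < 1 / 3" "d = 1 / 3 \<or> d = - (1 / 3)"
  shows "\<lfloor>X\<rfloor> = \<lfloor>Y\<rfloor> \<or> \<lfloor>X - d\<rfloor> = \<lfloor>Y - d\<rfloor>"
proof -
  have aux: False if "\<bar>U - V\<bar> < 1 / 3" "\<lfloor>U\<rfloor> < \<lfloor>V\<rfloor>" "\<lfloor>U - d\<rfloor> \<noteq> \<lfloor>V - d\<rfloor>" for U V :: real
  proof -
    have UV: "U < V" using that(2) by (meson floor_mono leD not_le)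
    then have "\<lfloor>U - d\<rfloor> < \<lfloor>V - d\<rfloor>" using that(3) floor_mono[of "U - d" "V - d"] by simp
    then have "U - d < of_int \<lfloor>V - d\<rfloor>" "of_int \<lfloor>V - d\<rfloor> \<le> V - d"
      "U < of_int \<lfloor>V\<rfloor>" "of_int \<lfloor>V\<rfloor> \<le> V"
      using that(2) floor_correct[of "U - d"] floor_correct[of "V - d"] floor_correct[of U] floor_correct[of V]
      by linarith+
    then have b: "of_int \<lfloor>V\<rfloor> - of_int \<lfloor>V - d\<rfloor> - d < 1 / 3" "- (1 / 3) < of_int \<lfloor>V\<rfloor> - of_int \<lfloor>V - d\<rfloor> - d"
      using that(1) by linarith+
    define D where "D = \<lfloor>V\<rfloor> - \<lfloor>V - d\<rfloor>"
    have b': "of_int D < 1 / 3 + d" "d - 1 / 3 < of_int D" using b unfolding D_def by auto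
    have "(1 \<le> D \<or> D \<le> 0) \<and> (0 \<le> D \<or> D \<le> -1)" by linarith
    then have "((1::real) \<le> of_int D \<or> of_int D \<le> (0::real)) \<and> ((0::real) \<le> of_int D \<or> of_int D \<le> (-1::real))"
      by linarith
    then show False using b' assms(2) by (elim conjE disjE; linarith)
  qed
  show ?thesis using aux[of X Y] aux[of Y X] assms(1) by (metis abs_minus_commute linorder_neqE_linordered_idom)
qed

text \<open>
  The alternating sign makes the offsets of consecutive levels differ by a multiple of the finer side
  length: \<open>2\<^sup>k\<^sup>+\<^sup>1/3 + 2\<^sup>k/3 = 2\<^sup>k\<close>. This is what makes the shifted grids nested. The vector \<open>u\<close> in the
  definitions below selects, for each coordinate, the standard or the shifted grid.
\<close>

definition grid_offset :: "bool \<Rightarrow> int \<Rightarrow> real" where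
  "grid_offset b k = (if b then (if even k then 1 else -1) * 2 powi k / 3 else 0)"

definition grid_corner :: "bool ^ 'n \<Rightarrow> int \<Rightarrow> int ^ 'n \<Rightarrow> real ^ 'n" where
  "grid_corner u k m = (\<chi> i. 2 powi k * of_int (m $ i) + grid_offset (u $ i) k)"

definition grid_cube :: "bool ^ 'n \<Rightarrow> int \<Rightarrow> int ^ 'n \<Rightarrow> (real ^ 'n) set" where
  "grid_cube u k m = cube (grid_corner u k m) (2 powi k)"

definition shifted_lattice :: "bool ^ 'n \<Rightarrow> (real ^ 'n) set set" where
  "shifted_lattice u = (\<Union>k. range (grid_cube u k))"

lemma mem_grid_cube:
  "x \<in> grid_cube u k m \<longleftrightarrow> (\<forall>i. \<lfloor>(x $ i - grid_offset (u $ i) k) / 2 powi k\<rfloor> = m $ i)"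
proof -
  have p: "(0::real) < 2 powi k" by simp
  have "(2 powi k * of_int z + o' \<le> t \<and> t < 2 powi k * of_int z + o' + 2 powi k) \<longleftrightarrow> \<lfloor>(t - o') / 2 powi k\<rfloor> = z"
    for t o' :: real and z :: int
  proof -
    have "2 powi k * of_int z + o' \<le> t \<longleftrightarrow> of_int z \<le> (t - o') / 2 powi k"
      using p by (simp add: pos_le_divide_eq algebra_simps)
    moreover have "t < 2 powi k * of_int z + o' + 2 powi k \<longleftrightarrow> (t - o') / 2 powi k < of_int z + 1"
      using p by (simp add: pos_divide_less_eq algebra_simps)
    ultimately show ?thesis by (simp add: floor_eq_iff)
  qed
  then show ?thesis by (simp add: grid_cube_def cube_def grid_corner_def)
qed

lemma grid_offset_Suc:
  "\<exists>t::int. \<forall>z::real. (z - grid_offset b (k + 1)) / 2 powi (k + 1)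
      = ((z - grid_offset b k) / 2 powi k + of_int t) / 2"
proof -
  have p: "(0::real) < 2 powi k" by simp
  have e: "(2::real) powi (k + 1) = 2 * 2 powi k" by (simp add: power_int_add)
  have e': "(2::real) powi (1 + k) = 2 * 2 powi k" by (simp add: power_int_add)
  define t :: int where "t = (if b then (if even k then 1 else -1) else 0)"
  show ?thesis
    by (rule exI[of _ t]) (use p in \<open>auto simp: e e' t_def grid_offset_def field_simps\<close>)
qed

lemma grid_cell_coarser:
  fixes x y :: real
  assumes "\<lfloor>(x - grid_offset b k) / 2 powi k\<rfloor> = \<lfloor>(y - grid_offset b k) / 2 powi k\<rfloor>" "k \<le> j"
  shows "\<lfloor>(x - grid_offset b j) / 2 powi j\<rfloor> = \<lfloor>(y - grid_offset b j) / 2 powi j\<rfloor>"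
  using assms(2)
proof (induction j rule: int_ge_induct)
  case (step i)
  obtain t :: int where t: "\<And>z::real. (z - grid_offset b (i + 1)) / 2 powi (i + 1)
      = ((z - grid_offset b i) / 2 powi i + of_int t) / 2" using grid_offset_Suc[of b i] by auto
  have "\<lfloor>(w + of_int t) / 2\<rfloor> = (\<lfloor>w\<rfloor> + t) div 2" for w :: real
    using floor_divide_real_eq_div[of 2 "w + of_int t"] by simp
  then show ?case unfolding t using step by simp
qed (rule assms)

lemma grid_cube_nested:
  assumes "z \<in> grid_cube u k m" "z \<in> grid_cube u j m'" "k \<le> j"
  shows "grid_cube u k m \<subseteq> grid_cube u j m'"
proof
  fix x assume x: "x \<in> grid_cube u k m"
  show "x \<in> grid_cube u j m'" unfolding mem_grid_cube
  proof
    fix i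
    have "\<lfloor>(x $ i - grid_offset (u $ i) k) / 2 powi k\<rfloor> = \<lfloor>(z $ i - grid_offset (u $ i) k) / 2 powi k\<rfloor>"
      using x assms(1) by (simp add: mem_grid_cube)
    from grid_cell_coarser[OF this assms(3)] show "\<lfloor>(x $ i - grid_offset (u $ i) j) / 2 powi j\<rfloor> = m' $ i"
      using assms(2) by (simp add: mem_grid_cube)
  qed
qed

lemma dyadic_lattice_shifted: "dyadic_lattice (shifted_lattice u)"
proof -
  have lev: "grid_cube u k m \<in> dyadic_level (shifted_lattice u) k" for k m
    by (auto simp: dyadic_level_def shifted_lattice_def grid_cube_def)
  have "shifted_lattice u = (\<Union>k. dyadic_level (shifted_lattice u) k)"
    using lev by (auto simp: shifted_lattice_def dyadic_level_def)
  moreover have "Q \<inter> P \<in> {Q, P, {}}" if QP: "Q \<in> shifted_lattice u" "P \<in> shifted_lattice u" for Q P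
  proof (cases "Q \<inter> P = {}")
    case False
    obtain k m j m' where "Q = grid_cube u k m" "P = grid_cube u j m'"
      using QP unfolding shifted_lattice_def by auto
    then have "Q \<subseteq> P \<or> P \<subseteq> Q"
      using False grid_cube_nested[of _ u k m j m'] grid_cube_nested[of _ u j m' k m] linear[of k j] by blast
    then show ?thesis by auto
  qed simp
  moreover have "\<Union>(dyadic_level (shifted_lattice u) k) = UNIV" for k
  proof -
    have "x \<in> grid_cube u k (\<chi> i. \<lfloor>(x $ i - grid_offset (u $ i) k) / 2 powi k\<rfloor>)" for x
      by (simp add: mem_grid_cube)
    then show ?thesis using lev[of k] by blast
  qed
  ultimately show ?thesis unfolding dyadic_lattice_def by (intro conjI ballI allI)
qed

text \<open>
  At a scale \<open>2\<^sup>k\<close> between three and six times the distance, each coordinate admits one of the two grids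
  that does not separate the two points.
\<close>

lemma two_points_in_grid_cube:
  fixes x y :: "real ^ 'n"
  assumes "x \<noteq> y"
  shows "\<exists>u k m. x \<in> grid_cube u k m \<and> y \<in> grid_cube u k m \<and> 2 powi k \<le> 6 * dist x y"
proof -
  define k where "k = \<lfloor>log 2 (3 * dist x y)\<rfloor> + 1"
  have d: "0 < 3 * dist x y" using assms by simp
  have kr: "(2::real) powi k = 2 powr of_int k" by (simp add: powr_real_of_int')
  have "3 * dist x y = 2 powr log 2 (3 * dist x y)" using d by simp
  also have "\<dots> < 2 powr of_int k" by (rule powr_less_mono) (use floor_correct[of "log 2 (3 * dist x y)"] in \<open>auto simp: k_def\<close>)
  finally have lo: "3 * dist x y < 2 powi k" by (simp only: kr)
  have "(2::real) powi k = 2 powr of_int k" by (rule kr)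
  also have "\<dots> \<le> 2 powr (log 2 (3 * dist x y) + 1)" by (rule powr_mono) (auto simp: k_def)
  also have "\<dots> = 6 * dist x y" using d by (simp add: powr_add)
  finally have hi: "2 powi k \<le> 6 * dist x y" .
  have p: "(0::real) < 2 powi k" by simp
  have "\<exists>b. \<lfloor>(x $ i - grid_offset b k) / 2 powi k\<rfloor> = \<lfloor>(y $ i - grid_offset b k) / 2 powi k\<rfloor>" for i
  proof -
    let ?d = "(if even k then 1 else -1) / 3 :: real"
    have "\<bar>x $ i - y $ i\<bar> \<le> dist x y" using component_le_norm_cart[of "x - y" i] by (simp add: dist_norm)
    then have "\<bar>x $ i / 2 powi k - y $ i / 2 powi k\<bar> < 1 / 3"
      using lo p by (simp add: diff_divide_distrib[symmetric] abs_divide pos_divide_less_eq)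
    from floor_eq_shift[OF this, of ?d]
    have "\<lfloor>x $ i / 2 powi k\<rfloor> = \<lfloor>y $ i / 2 powi k\<rfloor> \<or> \<lfloor>x $ i / 2 powi k - ?d\<rfloor> = \<lfloor>y $ i / 2 powi k - ?d\<rfloor>" by auto
    moreover have "(z - grid_offset True k) / 2 powi k = z / 2 powi k - ?d" for z :: real
      using p by (simp add: grid_offset_def diff_divide_distrib)
    moreover have "(z - grid_offset False k) / 2 powi k = z / 2 powi k" for z :: real
      by (simp add: grid_offset_def)
    ultimately show ?thesis by metis
  qed
  then obtain b where b: "\<And>i. \<lfloor>(x $ i - grid_offset (b i) k) / 2 powi k\<rfloor> = \<lfloor>(y $ i - grid_offset (b i) k) / 2 powi k\<rfloor>"
    by metis
  define u :: "bool ^ 'n" where "u = (\<chi> i. b i)"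
  define m :: "int ^ 'n" where "m = (\<chi> i. \<lfloor>(x $ i - grid_offset (b i) k) / 2 powi k\<rfloor>)"
  have "x \<in> grid_cube u k m" "y \<in> grid_cube u k m" using b by (simp_all add: mem_grid_cube u_def m_def)
  then show ?thesis using hi by blast
qed

lemma dyadic_lattice_cube:
  assumes "dyadic_lattice D" "Q \<in> D"
  obtains a k where "Q = cube a (2 powi k)"
proof -
  have "D = (\<Union>k. dyadic_level D k)" using assms(1) unfolding dyadic_lattice_def by (elim conjE) assumption
  then obtain k where "Q \<in> dyadic_level D k" using assms(2) by auto
  then show ?thesis using that unfolding dyadic_level_def by blast
qed

lemma dyadic_lattice_laminar:
  assumes "dyadic_lattice D" "F \<subseteq> D"
  shows "laminar F"
proof -
  have "laminar D" using assms(1) unfolding dyadic_lattice_def laminar_def by (elim conjE) assumption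
  then show ?thesis using assms(2) by (rule laminar_subset)
qed

lemma dyadic_lattice_measurable:
  assumes "dyadic_lattice D" "Q \<in> D"
  shows "Q \<in> sets lebesgue" "0 < vol Q"
proof -
  obtain a k where Q: "Q = cube a (2 powi k)" using dyadic_lattice_cube[OF assms] .
  show "Q \<in> sets lebesgue" unfolding Q by (rule cube_measure) simp
  show "0 < vol Q" unfolding Q by (subst cube_measure) simp_all
qed

text \<open>
  An exhaustion of all cubes of all shifted lattices by finite families, which allows monotone
  convergence. It uses the countability of the index type, and cubes may be enumerated repeatedly.
\<close>

definition grid_cubes_upto :: "nat \<Rightarrow> (real ^ 'n) set set" where
  "grid_cubes_upto N = (\<lambda>(u, k, m). grid_cube u k m) ` from_nat ` {..<N}"

lemma grid_cubes_upto_finite: "finite (grid_cubes_upto N)"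
  unfolding grid_cubes_upto_def by simp

lemma grid_cubes_upto_mono: "N \<le> M \<Longrightarrow> grid_cubes_upto N \<subseteq> grid_cubes_upto M"
  unfolding grid_cubes_upto_def by (intro image_mono) auto

lemma grid_cubes_upto_lattice: "Q \<in> grid_cubes_upto N \<Longrightarrow> \<exists>u. Q \<in> shifted_lattice u"
  unfolding grid_cubes_upto_def shifted_lattice_def by fastforce

lemma grid_cubes_upto_ex: "\<exists>N. grid_cube u k m \<in> grid_cubes_upto N"
proof
  let ?i = "to_nat (u, k, m)"
  have "(u, k, m) \<in> from_nat ` {..<Suc ?i}" by (rule image_eqI[of _ _ ?i]) auto
  then show "grid_cube u k m \<in> grid_cubes_upto (Suc ?i)"
    unfolding grid_cubes_upto_def by (force simp: image_iff)
qed

section \<open>The fractional integral and the fractional maximal operator\<close>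

definition frac_kernel :: "(real ^ 'n \<Rightarrow> real) \<Rightarrow> real ^ 'n \<Rightarrow> real ^ 'n \<Rightarrow> real" where
  "frac_kernel \<alpha> x y = dist x y powr (real CARD('n) * (1 - avg \<alpha> (ball x (dist x y))))"

lemma e2ennreal_abs_enn2ereal: "e2ennreal \<bar>enn2ereal a\<bar> = a"
  by (simp add: abs_of_nonneg)

lemma avg_recip_bounds:
  assumes s: "s \<in> exponents" and E: "E \<in> sets lebesgue" "0 < vol E"
  shows "0 \<le> avg (recip s) E \<and> avg (recip s) E \<le> 1"
proof -
  have fin: "emeasure lebesgue E \<noteq> \<infinity>" using emeasure_lebesgue_finite[OF E(2)] by simp
  have int: "set_integrable lebesgue E (recip s)" by (rule recip_set_integrable[OF s E(1) fin])
  have int1: "set_integrable lebesgue E (\<lambda>x. 1 :: real)"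
    using E fin by (auto simp: set_integrable_def less_top)
  have "0 \<le> (LINT x:E|lebesgue. recip s x)"
    unfolding set_lebesgue_integral_def using recip_bounds[OF s]
    by (intro Bochner_Integration.integral_nonneg) (auto simp: indicator_def)
  moreover have "(LINT x:E|lebesgue. recip s x) \<le> (LINT x:E|lebesgue. 1)"
    by (rule set_integral_mono[OF int int1]) (use recip_bounds[OF s] in auto)
  moreover have "(LINT x:E|lebesgue. (1::real)) = vol E"
    using E fin by (simp add: set_lebesgue_integral_def)
  ultimately show ?thesis using E(2) unfolding avg_def by simp
qed

text \<open>
  As a function of the radius, both the integral over a ball and the volume of a ball are monotone,
  hence Borel measurable.
\<close>

lemma frac_kernel_measurable:
  fixes s :: "real ^ 'n \<Rightarrow> ennreal"
  assumes s: "s \<in> exponents"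
  shows "frac_kernel (recip s) x \<in> borel_measurable lebesgue"
proof -
  have fin: "emeasure lebesgue (ball x r) \<noteq> \<infinity>" for r
    using emeasure_bounded_finite[OF bounded_ball, of x r] by simp
  have int: "set_integrable lebesgue (ball x r) (recip s)" for r
    by (rule recip_set_integrable[OF s _ fin]) simp
  have "mono (\<lambda>r. LINT y:ball x r|lebesgue. recip s y)"
  proof (rule monoI)
    fix r r' :: real assume "r \<le> r'"
    then have "ball x r \<subseteq> ball x r'" by (rule subset_ball)
    then show "(LINT y:ball x r|lebesgue. recip s y) \<le> (LINT y:ball x r'|lebesgue. recip s y)"
      using int[of r] int[of r'] recip_bounds[OF s] unfolding set_lebesgue_integral_def set_integrable_def
      by (intro integral_mono) (auto simp: indicator_def)
  qed
  then have [measurable]: "(\<lambda>r. LINT y:ball x r|lebesgue. recip s y) \<in> borel_measurable borel"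
    by (rule borel_measurable_mono)
  have "mono (\<lambda>r. vol (ball x r))"
  proof (rule monoI)
    fix r r' :: real assume "r \<le> r'"
    then show "vol (ball x r) \<le> vol (ball x r')"
      by (intro measure_mono_fmeasurable subset_ball) auto
  qed
  then have [measurable]: "(\<lambda>r. vol (ball x r)) \<in> borel_measurable borel"
    by (rule borel_measurable_mono)
  define k where "k r = r powr (real CARD('n) * (1 - avg (recip s) (ball x r)))" for r
  have [measurable]: "k \<in> borel_measurable borel" unfolding k_def avg_def by measurable
  have "(\<lambda>y. k (dist x y)) \<in> borel_measurable lborel" by measurable
  then have "(\<lambda>y. k (dist x y)) \<in> borel_measurable lebesgue" by (rule measurable_completion)
  then show ?thesis unfolding k_def frac_kernel_def[abs_def] .
qed

lemma frac_kernel_pos: "x \<noteq> y \<Longrightarrow> 0 < frac_kernel \<alpha> x y"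
  by (simp add: frac_kernel_def)

lemma frac_kernel_nonneg: "0 \<le> frac_kernel \<alpha> x y"
  by (simp add: frac_kernel_def)

text \<open>
  By the convention for divergent integrals, equality for nonnegative functions holds without any
  integrability.
\<close>

lemma frac_integral_abs_le:
  fixes s :: "real ^ 'n \<Rightarrow> ennreal"
  assumes s: "s \<in> exponents" and f[measurable]: "f \<in> borel_measurable lebesgue"
  shows "e2ennreal \<bar>frac_integral (recip s) f x\<bar>
    \<le> (\<integral>\<^sup>+y\<in>-{x}. ennreal (\<bar>f y\<bar> / frac_kernel (recip s) x y) \<partial>lebesgue)"
    "(\<And>y. 0 \<le> f y) \<Longrightarrow> e2ennreal \<bar>frac_integral (recip s) f x\<bar>
    = (\<integral>\<^sup>+y\<in>-{x}. ennreal (\<bar>f y\<bar> / frac_kernel (recip s) x y) \<partial>lebesgue)"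
proof -
  define g where "g y = f y / frac_kernel (recip s) x y" for y
  note [measurable] = frac_kernel_measurable[OF s, of x]
  have [measurable]: "g \<in> borel_measurable lebesgue" unfolding g_def by measurable
  define h where "h y = indicator (-{x}) y *\<^sub>R g y" for y
  have hm[measurable]: "h \<in> borel_measurable lebesgue"
    unfolding h_def by (intro borel_measurable_scaleR borel_measurable_indicator) simp_all
  have nn: "(\<integral>\<^sup>+y\<in>-{x}. ennreal (\<bar>f y\<bar> / frac_kernel (recip s) x y) \<partial>lebesgue) = (\<integral>\<^sup>+y. ennreal (norm (h y)) \<partial>lebesgue)"
    by (intro nn_integral_cong) (auto simp: h_def g_def indicator_def frac_kernel_nonneg)
  have fi: "frac_integral (recip s) f x = (if integrable lebesgue h then ereal (integral\<^sup>L lebesgue h) else \<infinity>)"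
    unfolding frac_integral_def Let_def set_integrable_def set_lebesgue_integral_def
      h_def[abs_def] g_def[abs_def] frac_kernel_def ..
  have "e2ennreal \<bar>frac_integral (recip s) f x\<bar> \<le> (\<integral>\<^sup>+y. ennreal (norm (h y)) \<partial>lebesgue)
    \<and> ((\<forall>y. 0 \<le> f y) \<longrightarrow> e2ennreal \<bar>frac_integral (recip s) f x\<bar> = (\<integral>\<^sup>+y. ennreal (norm (h y)) \<partial>lebesgue))"
  proof (cases "integrable lebesgue h")
    case True
    have "ennreal \<bar>integral\<^sup>L lebesgue h\<bar> \<le> (\<integral>\<^sup>+y. ennreal (norm (h y)) \<partial>lebesgue)"
      using integral_norm_bound_ennreal[OF True] by simp
    moreover have "ennreal \<bar>integral\<^sup>L lebesgue h\<bar> = (\<integral>\<^sup>+y. ennreal (norm (h y)) \<partial>lebesgue)" if "\<forall>y. 0 \<le> f y"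
    proof -
      have h0: "0 \<le> h y" for y using that by (simp add: h_def g_def frac_kernel_nonneg)
      then have "0 \<le> integral\<^sup>L lebesgue h" by simp
      moreover have "(\<integral>\<^sup>+y. ennreal (norm (h y)) \<partial>lebesgue) = (\<integral>\<^sup>+y. ennreal (h y) \<partial>lebesgue)"
        using h0 by (intro nn_integral_cong) simp
      ultimately show ?thesis using nn_integral_eq_integral[OF True] h0 by simp
    qed
    ultimately show ?thesis using True by (simp add: fi)
  next
    case False
    then have "(\<integral>\<^sup>+y. ennreal (norm (h y)) \<partial>lebesgue) = \<infinity>"
      using integrableI_bounded[OF hm] by (metis infinity_ennreal_def less_top)
    then show ?thesis using False by (simp add: fi)
  qed
  then show "e2ennreal \<bar>frac_integral (recip s) f x\<bar>
    \<le> (\<integral>\<^sup>+y\<in>-{x}. ennreal (\<bar>f y\<bar> / frac_kernel (recip s) x y) \<partial>lebesgue)"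
    "(\<And>y. 0 \<le> f y) \<Longrightarrow> e2ennreal \<bar>frac_integral (recip s) f x\<bar>
    = (\<integral>\<^sup>+y\<in>-{x}. ennreal (\<bar>f y\<bar> / frac_kernel (recip s) x y) \<partial>lebesgue)"
    unfolding nn by auto
qed

text \<open>
  The kernel uses powers of the distance instead of the volume of the ball. The discrepancy is a power
  with exponent in \<open>[0, 1]\<close> of the volume of the unit ball.
\<close>

lemma frac_kernel_ball:
  fixes x y :: "real ^ 'n"
  assumes s: "s \<in> exponents" and ne: "x \<noteq> y"
  defines "\<omega> \<equiv> unit_ball_vol (real CARD('n))" and "B \<equiv> ball x (dist x y)"
  shows "vol B powr (1 - avg (recip s) B) \<le> max \<omega> (1 / \<omega>) * frac_kernel (recip s) x y"
    and "frac_kernel (recip s) x y \<le> max \<omega> (1 / \<omega>) * vol B powr (1 - avg (recip s) B)"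
proof -
  have w: "0 < \<omega>" unfolding \<omega>_def by simp
  have d: "0 < dist x y" using ne by simp
  define b where "b = 1 - avg (recip s) B"
  have b: "0 \<le> b" "b \<le> 1" using avg_recip_bounds[OF s, of B] measure_ball_pos[OF d, of x]
    unfolding b_def B_def by auto
  have max1: "1 \<le> max \<omega> (1 / \<omega>)" using w by (cases "1 \<le> \<omega>") (auto simp: le_max_iff_disj)
  have pw: "t powr b \<le> max \<omega> (1 / \<omega>)" if t: "0 < t" "t \<le> max \<omega> (1 / \<omega>)" for t
  proof (cases "1 \<le> t")
    case True
    then have "t powr b \<le> t powr 1" using b by (intro powr_mono) auto
    then show ?thesis using t by simp
  next
    case False
    then have "t powr b \<le> 1 powr b" using t b by (intro powr_mono2) auto
    then show ?thesis using max1 by simp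
  qed
  have m: "vol B powr b = \<omega> powr b * frac_kernel (recip s) x y"
  proof -
    have "vol B = \<omega> * dist x y powr real CARD('n)"
      unfolding B_def \<omega>_def by (subst measure_ball) (use d in \<open>simp_all add: powr_realpow\<close>)
    then have "vol B powr b = \<omega> powr b * (dist x y powr real CARD('n)) powr b"
      using w by (simp add: powr_mult)
    also have "(dist x y powr real CARD('n)) powr b = frac_kernel (recip s) x y"
      unfolding frac_kernel_def powr_powr b_def B_def ..
    finally show ?thesis .
  qed
  show "vol B powr (1 - avg (recip s) B) \<le> max \<omega> (1 / \<omega>) * frac_kernel (recip s) x y"
    using mult_right_mono[OF pw[of \<omega>], of "frac_kernel (recip s) x y"] w m
    unfolding b_def by (simp add: frac_kernel_nonneg)
  have "frac_kernel (recip s) x y = (1 / \<omega>) powr b * vol B powr b"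
    unfolding m using w by (simp add: powr_divide)
  also have "\<dots> \<le> max \<omega> (1 / \<omega>) * vol B powr b"
    using pw[of "1 / \<omega>"] w by (intro mult_right_mono) auto
  finally show "frac_kernel (recip s) x y \<le> max \<omega> (1 / \<omega>) * vol B powr (1 - avg (recip s) B)"
    unfolding b_def .
qed

text \<open>
  The exponent \<open>s\<close> stands for \<open>1/\<alpha>\<close>, so that \<open>\<alpha> = recip s\<close>. The abbreviations are \<open>|E|\<close> to the power of the
  mean of \<open>\<alpha>\<close> over \<open>E\<close> and its complementary power.
\<close>

locale fractional_order =
  fixes s :: "real ^ 'n \<Rightarrow> ennreal"
  assumes s: "s \<in> exponents" and A: "one_in_A s"
begin

abbreviation "avg_copow E \<equiv> vol E powr (1 - avg (recip s) E)"
abbreviation "avg_pow E \<equiv> vol E powr avg (recip s) E"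

lemma avg_copow_mult_avg_pow: "0 < vol E \<Longrightarrow> avg_copow E * avg_pow E = vol E"
  by (simp add: powr_add[symmetric])

text \<open>
  Apart from the two plain volume bounds, every instance compares two sets that lie in a ball whose volume is a bounded multiple of the
  volume of the second one. The constant \<open>K\<close> in the proof covers all radii up to \<open>12 n\<close> times the side of
  the cube or the radius of the ball.
\<close>

lemma kernel_comparison:
  obtains C where "1 \<le> C"
    "\<And>x y a l. x \<noteq> y \<Longrightarrow> x \<in> cube a l \<Longrightarrow> y \<in> cube a l \<Longrightarrow> 0 < l \<Longrightarrow> l \<le> 6 * dist x y \<Longrightarrow>
      avg_copow (cube a l) \<le> C * frac_kernel (recip s) x y"
    "\<And>x y c r. x \<noteq> y \<Longrightarrow> x \<in> ball c r \<Longrightarrow> y \<in> ball c r \<Longrightarrow> frac_kernel (recip s) x y \<le> C * avg_copow (ball c r)"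
    "\<And>x y a l. x \<noteq> y \<Longrightarrow> x \<in> cube a l \<Longrightarrow> 0 < l \<Longrightarrow> dist x y < l \<Longrightarrow>
      frac_kernel (recip s) x y \<le> C * avg_copow (cube a l)"
    "\<And>a l. 0 < l \<Longrightarrow> avg_copow (ball a (real CARD('n) * l)) \<le> C * avg_copow (cube a l)"
    "\<And>(a :: real ^ 'n) l. 0 < l \<Longrightarrow> vol (ball a (real CARD('n) * l)) \<le> C * vol (cube a l)"
    "\<And>a l b k. 0 < l \<Longrightarrow> 0 < k \<Longrightarrow> cube a l \<subseteq> cube b k \<Longrightarrow> avg_pow (cube a l) \<le> C * avg_pow (cube b k)"
    "\<And>a l. 0 < l \<Longrightarrow> avg_pow (ball a ((real CARD('n) + 1) * l)) \<le> C * avg_pow (cube a l)"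
    "\<And>(a :: real ^ 'n) l. 0 < l \<Longrightarrow> vol (ball a ((real CARD('n) + 1) * l)) \<le> C * vol (cube a l)"
proof -
  let ?n = "CARD('n)"
  define \<omega> where "\<omega> = unit_ball_vol (real CARD('n))"
  define W where "W = max \<omega> (1 / \<omega>)"
  have w: "0 < \<omega>" unfolding \<omega>_def by simp
  have W1: "1 \<le> W" using w unfolding W_def by (cases "1 \<le> \<omega>") (auto simp: le_max_iff_disj)
  have wW: "\<omega> \<le> W" unfolding W_def by simp
  have n1: "1 \<le> real ?n" by (simp add: Suc_leI)
  have n12: "1 \<le> 12 * real ?n" using n1 by linarith
  define K where "K = W * (12 * real ?n) ^ ?n"
  have K1: "1 \<le> K"
  proof -
    have "1 * 1 \<le> W * (12 * real ?n) ^ ?n" using W1 n12 by (intro mult_mono one_le_power) auto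
    then show ?thesis unfolding K_def by simp
  qed
  obtain C where C: "1 \<le> C"
    "\<And>c r E F k. 0 < r \<Longrightarrow> E \<in> sets lebesgue \<Longrightarrow> F \<in> sets lebesgue \<Longrightarrow> 0 < vol E \<Longrightarrow>
      0 < vol F \<Longrightarrow> E \<subseteq> ball c r \<Longrightarrow> F \<subseteq> ball c r \<Longrightarrow>
      vol (ball c r) \<le> k * vol F \<Longrightarrow>
      avg_copow E \<le> C * k * avg_copow F \<and> avg_pow E \<le> C * k * avg_pow F"
    using one_in_A_comparable_powr[OF s A] by metis
  have cK: "vol (ball z R) \<le> K * vol (cube a l)"
    if "0 < l" "0 \<le> R" "R \<le> 12 * real ?n * l" for z a :: "real ^ 'n" and R l
  proof -
    have "vol (ball z R) \<le> \<omega> * (12 * real ?n * l) ^ ?n"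
      unfolding measure_ball[OF that(2)] \<omega>_def[symmetric] using that w by (intro mult_left_mono power_mono) auto
    also have "\<dots> \<le> W * (12 * real ?n * l) ^ ?n" using wW that by (intro mult_right_mono) auto
    also have "\<dots> = K * vol (cube a l)"
      using that by (simp add: cube_measure K_def power_mult_distrib)
    finally show ?thesis .
  qed
  have bK: "vol (ball z R) \<le> K * vol (ball c r)"
    if "0 < r" "0 \<le> R" "R \<le> 12 * real ?n * r" for z c :: "real ^ 'n" and R r
  proof -
    have "vol (ball z R) \<le> \<omega> * (12 * real ?n * r) ^ ?n"
      unfolding measure_ball[OF that(2)] \<omega>_def[symmetric] using that w by (intro mult_left_mono power_mono) auto
    also have "\<dots> = 1 * (\<omega> * (12 * real ?n * r) ^ ?n)" by simp
    also have "\<dots> \<le> W * (\<omega> * (12 * real ?n * r) ^ ?n)" using W1 w that by (intro mult_right_mono) auto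
    also have "\<dots> = K * vol (ball c r)"
      by (subst measure_ball) (use that in \<open>simp_all add: K_def power_mult_distrib \<omega>_def\<close>)
    finally show ?thesis .
  qed
  have cs: "cube a l \<in> sets lebesgue" "0 < vol (cube a l)" if "0 < l" for a :: "real ^ 'n" and l
    using that by (simp_all add: cube_measure)
  have bs: "ball c r \<in> sets lebesgue" "0 < vol (ball c r)" if "0 < r" for c :: "real ^ 'n" and r
    using measure_ball_pos[OF that, of c] by simp_all
  have cball: "cube a l \<subseteq> ball a R" if "0 < l" "real ?n * l \<le> R" for a :: "real ^ 'n" and l R
    using that cube_dist_less[of _ a l] by (force simp: dist_commute)
  have xball: "cube a l \<subseteq> ball x (2 * real ?n * l)" if "x \<in> cube a l" for x a :: "real ^ 'n" and l
    using that cube_dist_less2[of x a l] by auto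
  have CC: "C \<le> W * C * K" "C * K \<le> W * C * K" "K \<le> W * C * K" "0 \<le> C * K"
  proof -
    have "1 * (C * 1) \<le> W * (C * K)" "1 * (C * K) \<le> W * (C * K)" "1 * (1 * K) \<le> W * (C * K)"
      using W1 C(1) K1 by (intro mult_mono; simp)+
    then show "C \<le> W * C * K" "C * K \<le> W * C * K" "K \<le> W * C * K" by (simp_all add: mult.assoc)
    show "0 \<le> C * K" using C(1) K1 by simp
  qed
  show ?thesis
  proof (rule that[of "W * C * K"])
    show "1 \<le> W * C * K" using CC(1) C(1) by linarith
  next
    fix x y a :: "real ^ 'n" and l :: real
    assume xy: "x \<noteq> y" "x \<in> cube a l" "y \<in> cube a l" "0 < l" "l \<le> 6 * dist x y"
    let ?B = "ball x (dist x y)"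
    have d: "0 < dist x y" using xy by simp
    have "avg_copow (cube a l) \<le> C * K * avg_copow ?B"
    proof (rule C(2)[THEN conjunct1])
      show "0 < 2 * real ?n * l" using xy n1 by simp
      show "?B \<subseteq> ball x (2 * real ?n * l)"
        using cube_dist_less2[OF xy(2,3)] by (intro subset_ball) simp
      show "vol (ball x (2 * real ?n * l)) \<le> K * vol ?B"
        using mult_left_mono[OF xy(5), of "2 * real ?n"] xy n1 d by (intro bK) (auto simp: mult_ac)
    qed (use cs[OF xy(4)] bs[OF d] xball[OF xy(2)] in auto)
    also have "\<dots> \<le> C * K * (W * frac_kernel (recip s) x y)"
      using frac_kernel_ball(1)[OF s xy(1)] CC(4) unfolding W_def \<omega>_def by (intro mult_left_mono)
    finally show "avg_copow (cube a l) \<le> W * C * K * frac_kernel (recip s) x y" by (simp only: mult_ac)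
  next
    fix x y c :: "real ^ 'n" and r :: real
    assume xy: "x \<noteq> y" "x \<in> ball c r" "y \<in> ball c r"
    let ?B = "ball x (dist x y)"
    have d: "0 < dist x y" using xy by simp
    have r: "0 < r" using xy(2) by (metis dist_not_less_zero le_less_trans mem_ball not_less)
    have dr: "dist x y < 2 * r" using xy dist_triangle3[of x y c] by simp
    have "frac_kernel (recip s) x y \<le> W * avg_copow ?B"
      using frac_kernel_ball(2)[OF s xy(1)] unfolding W_def \<omega>_def .
    also have "\<dots> \<le> W * (C * K * avg_copow (ball c r))"
    proof (intro mult_left_mono C(2)[THEN conjunct1])
      show "0 < 3 * r" using r by simp
      show "?B \<subseteq> ball c (3 * r)"
      proof
        fix z assume z: "z \<in> ?B"
        have "dist c z \<le> dist c x + dist x z" by (rule dist_triangle)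
        then show "z \<in> ball c (3 * r)" using z xy(2) dr by simp
      qed
      show "ball c r \<subseteq> ball c (3 * r)" using r by (intro subset_ball) simp
      show "vol (ball c (3 * r)) \<le> K * vol (ball c r)"
      proof -
        have "3 \<le> 12 * real ?n" using n1 by linarith
        then have "3 * r \<le> 12 * real ?n * r" using r by (intro mult_right_mono) auto
        then show ?thesis using r by (intro bK) auto
      qed
    qed (use bs[OF d] bs[OF r] W1 in auto)
    finally show "frac_kernel (recip s) x y \<le> W * C * K * avg_copow (ball c r)" by (simp only: mult_ac)
  next
    fix x y a :: "real ^ 'n" and l :: real
    assume xy: "x \<noteq> y" "x \<in> cube a l" "0 < l" "dist x y < l"
    let ?B = "ball x (dist x y)"
    have d: "0 < dist x y" using xy by simp
    have nl: "1 * l \<le> real ?n * l" using n1 xy by (intro mult_right_mono) auto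
    have "frac_kernel (recip s) x y \<le> W * avg_copow ?B"
      using frac_kernel_ball(2)[OF s xy(1)] unfolding W_def \<omega>_def .
    also have "\<dots> \<le> W * (C * K * avg_copow (cube a l))"
    proof (intro mult_left_mono C(2)[THEN conjunct1])
      show "0 < 2 * real ?n * l" using xy n1 by simp
      show "?B \<subseteq> ball x (2 * real ?n * l)"
        by (intro subset_ball) (use xy(3,4) nl in linarith)
      show "vol (ball x (2 * real ?n * l)) \<le> K * vol (cube a l)"
        using xy n1 by (intro cK) auto
    qed (use cs[OF xy(3)] bs[OF d] xball[OF xy(2)] W1 in auto)
    finally show "frac_kernel (recip s) x y \<le> W * C * K * avg_copow (cube a l)" by (simp only: mult_ac)
  next
    fix a :: "real ^ 'n" and l :: real
    assume l: "0 < l"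
    have R: "0 < real ?n * l" using l n1 by simp
    have m: "vol (ball a (real ?n * l)) \<le> K * vol (cube a l)"
      using l n1 by (intro cK) auto
    also have "\<dots> \<le> W * C * K * vol (cube a l)" by (intro mult_right_mono CC) auto
    finally show "vol (ball a (real ?n * l)) \<le> W * C * K * vol (cube a l)" .
    have "avg_copow (ball a (real ?n * l)) \<le> C * K * avg_copow (cube a l)"
      by (rule C(2)[THEN conjunct1, OF R]) (use m bs[OF R] cs[OF l] cball[OF l] in auto)
    also have "\<dots> \<le> W * C * K * avg_copow (cube a l)" by (intro mult_right_mono CC) auto
    finally show "avg_copow (ball a (real ?n * l)) \<le> W * C * K * avg_copow (cube a l)" .
    have nl: "1 * l \<le> real ?n * l" using n1 l by (intro mult_right_mono) auto
    have R: "0 < (real ?n + 1) * l" using l n1 by simp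
    have m: "vol (ball a ((real ?n + 1) * l)) \<le> K * vol (cube a l)"
    proof (rule cK)
      show "(real ?n + 1) * l \<le> 12 * real ?n * l"
        by (rule mult_right_mono) (use n1 l in linarith)+
    qed (use l in auto)
    also have "\<dots> \<le> W * C * K * vol (cube a l)" by (intro mult_right_mono CC) auto
    finally show "vol (ball a ((real ?n + 1) * l)) \<le> W * C * K * vol (cube a l)" .
    have "avg_pow (ball a ((real ?n + 1) * l)) \<le> C * K * avg_pow (cube a l)"
      by (rule C(2)[THEN conjunct2, OF R]) (use m bs[OF R] cs[OF l] cball[OF l] l in \<open>auto simp: algebra_simps\<close>)
    also have "\<dots> \<le> W * C * K * avg_pow (cube a l)" by (intro mult_right_mono CC) auto
    finally show "avg_pow (ball a ((real ?n + 1) * l)) \<le> W * C * K * avg_pow (cube a l)" .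
  next
    fix a b :: "real ^ 'n" and l k :: real
    assume lk: "0 < l" "0 < k" and sub: "cube a l \<subseteq> cube b k"
    have R: "0 < real ?n * k" using lk n1 by simp
    have m: "vol (ball b (real ?n * k)) \<le> K * vol (cube b k)"
      using lk n1 by (intro cK) auto
    have "avg_pow (cube a l) \<le> C * K * avg_pow (cube b k)"
      by (rule C(2)[THEN conjunct2, OF R cs(1)[OF lk(1)] cs(1)[OF lk(2)] cs(2)[OF lk(1)] cs(2)[OF lk(2)]
            order_trans[OF sub cball[OF lk(2) order_refl]] cball[OF lk(2) order_refl] m])
    also have "\<dots> \<le> W * C * K * avg_pow (cube b k)" by (intro mult_right_mono CC) auto
    finally show "avg_pow (cube a l) \<le> W * C * K * avg_pow (cube b k)" .
  qed
qed

end

section \<open>Limits, packing and averages\<close>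

abbreviation mass :: "(real ^ 'n \<Rightarrow> real) \<Rightarrow> (real ^ 'n) set \<Rightarrow> ennreal" where
  "mass f E \<equiv> \<integral>\<^sup>+y\<in>E. ennreal \<bar>f y\<bar> \<partial>lebesgue"

lemma ennreal_divide_eq_mult: "0 < u \<Longrightarrow> a / ennreal u = a * ennreal (1 / u)"
  by (simp add: divide_ennreal_def inverse_ennreal inverse_eq_divide)

text \<open>
  Monotone convergence. The factor 2 avoids continuity of the power: wherever the supremum is positive
  and finite, some \<open>h N x\<close> exceeds half of it.
\<close>

lemma norm_le_SUP:
  assumes s: "s \<in> exponents" and sfin: "AE x in lebesgue. s x < \<infinity>"
    and h[measurable]: "\<And>N. h N \<in> borel_measurable lebesgue" and inc: "\<And>N x. h N x \<le> h (Suc N) x"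
    and bound: "\<And>N::nat. norm_le s (h N) T"
    and C: "0 < C" and G: "\<And>x. G x \<le> ennreal C * (SUP N. h N x)"
  shows "norm_le s G (2 * C * T)"
proof -
  have T: "0 < T" using bound by (auto simp: norm_le_def)
  have [measurable]: "s \<in> borel_measurable lebesgue" using s by (rule exponents_measurable)
  let ?r = "\<lambda>x. enn2real (s x)"
  have "nmod s (\<lambda>x. G x / ennreal (2 * C * T)) = (\<integral>\<^sup>+x. epow (G x / ennreal (2 * C * T)) (?r x) \<partial>lebesgue)"
    by (rule nmod_finite[OF sfin])
  also have "\<dots> \<le> (\<integral>\<^sup>+x. (SUP N. epow (h N x / ennreal T) (?r x)) \<partial>lebesgue)"
  proof (rule nn_integral_mono_AE, use sfin in eventually_elim)
    case (elim x)
    have r: "1 \<le> ?r x" by (rule enn2real_exponent_ge1[OF s elim])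
    define S where "S = (SUP N. h N x)"
    have GS: "G x / ennreal (2 * C * T) \<le> S / ennreal (2 * T)"
    proof -
      have "G x / ennreal (2 * C * T) \<le> (ennreal C * S) / (ennreal C * ennreal (2 * T))"
        using G[of x] C T unfolding S_def by (simp add: ennreal_mult mult_ac divide_right_mono_ennreal)
      also have "\<dots> = S / ennreal (2 * T)"
        using C by (subst (1 2) mult.commute) (intro divide_mult_eq, auto)
      finally show ?thesis .
    qed
    show ?case
    proof (cases "S = \<infinity>")
      case True
      have "(SUP N. epow (h N x / ennreal T) (?r x)) = top"
      proof (rule ennreal_SUP_eq_top)
        fix n
        have "ennreal ((real n + 1) * T) < S" using True by simp
        then obtain N where N: "ennreal ((real n + 1) * T) < h N x" unfolding S_def less_SUP_iff by auto
        have "ennreal (real n + 1) = ennreal ((real n + 1) * T) / ennreal T" using T by (simp add: divide_ennreal)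
        also have "\<dots> \<le> h N x / ennreal T" using N by (intro divide_right_mono_ennreal) simp
        finally have "epow (ennreal (real n + 1)) (?r x) \<le> epow (h N x / ennreal T) (?r x)"
          by (rule epow_mono) simp
        moreover have "real n \<le> (real n + 1) powr ?r x"
        proof -
          have "real n \<le> (real n + 1) powr 1" by simp
          also have "\<dots> \<le> (real n + 1) powr ?r x" using r by (intro powr_mono) auto
          finally show ?thesis .
        qed
        then have "ennreal (real n) \<le> epow (ennreal (real n + 1)) (?r x)"
          by (subst epow_ennreal) (auto intro: ennreal_leI)
        ultimately have "of_nat n \<le> epow (h N x / ennreal T) (?r x)"
          unfolding ennreal_of_nat_eq_real_of_nat by (meson order_trans)
        then show "\<exists>i\<in>UNIV. of_nat n \<le> epow (h i x / ennreal T) (?r x)" by auto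
      qed
      then show ?thesis by (simp only: top_greatest)
    next
      case False
      then obtain t where t: "0 \<le> t" "S = ennreal t" by (cases S) auto
      show ?thesis
      proof (cases "t = 0")
        case True
        then have "G x / ennreal (2 * C * T) = 0" using GS t by simp
        then show ?thesis using epow_ennreal[of 0] by simp
      next
        case False
        then have "ennreal (t / 2) < S" using t by (simp add: ennreal_less_iff)
        then obtain N where N: "ennreal (t / 2) < h N x" unfolding S_def less_SUP_iff by auto
        note GS
        also have "S / ennreal (2 * T) = ennreal (t / 2) / ennreal T" using t T by (simp add: divide_ennreal)
        also have "\<dots> \<le> h N x / ennreal T" using N by (intro divide_right_mono_ennreal) simp
        finally have "epow (G x / ennreal (2 * C * T)) (?r x) \<le> epow (h N x / ennreal T) (?r x)"
          by (rule epow_mono) simp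
        then show ?thesis by (rule order_trans) (auto intro: SUP_upper)
      qed
    qed
  qed
  also have "\<dots> = (SUP N. \<integral>\<^sup>+x. epow (h N x / ennreal T) (?r x) \<partial>lebesgue)"
  proof (rule nn_integral_monotone_convergence_SUP)
    show "incseq (\<lambda>N x. epow (h N x / ennreal T) (?r x))"
      by (intro incseq_SucI le_funI epow_mono divide_right_mono_ennreal inc) simp
  qed measurable
  also have "\<dots> \<le> 1"
    using bound by (intro SUP_least) (simp add: norm_le_def nmod_finite[OF sfin])
  finally show ?thesis using C T by (simp add: norm_le_def)
qed

lemma C_down_packing:
  assumes fin: "C_down \<alpha> < \<infinity>" and D: "dyadic_lattice D" and P: "P \<in> D" and F: "finite F" "F \<subseteq> D"
  shows "(\<Sum>Q\<in>{Q\<in>F. Q \<subseteq> P}. vol Q powr (1 + avg \<alpha> Q))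
    \<le> enn2real (C_down \<alpha>) * vol P powr (1 + avg \<alpha> P)"
proof -
  let ?w = "\<lambda>Q. vol Q powr (1 + avg \<alpha> Q)"
  have p: "0 < ?w P" using dyadic_lattice_measurable[OF D P] by simp
  have "ennreal (\<Sum>Q\<in>{Q\<in>F. Q \<subseteq> P}. ?w Q) = (\<Sum>Q\<in>{Q\<in>F. Q \<subseteq> P}. ennreal (?w Q))"
    by (rule sum_ennreal[symmetric]) simp
  also have "\<dots> \<le> (\<Sum>\<^sub>\<infinity>Q \<in> {Q \<in> D. Q \<subseteq> P}. ennreal (?w Q))"
    by (subst nonneg_infsum_complete) (use F in \<open>auto intro!: SUP_upper\<close>)
  finally have "ennreal (\<Sum>Q\<in>{Q\<in>F. Q \<subseteq> P}. ?w Q) / ennreal (?w P)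
      \<le> (\<Sum>\<^sub>\<infinity>Q \<in> {Q \<in> D. Q \<subseteq> P}. ennreal (?w Q)) / ennreal (?w P)"
    by (rule divide_right_mono_ennreal)
  also have "\<dots> \<le> (SUP P \<in> D. (\<Sum>\<^sub>\<infinity>Q \<in> {Q \<in> D. Q \<subseteq> P}. ennreal (?w Q)) / ennreal (?w P))"
    by (rule SUP_upper[OF P])
  also have "\<dots> \<le> C_down \<alpha>" unfolding C_down_def
    by (rule SUP_upper2[of D]) (use D in auto)
  also have "\<dots> = ennreal (enn2real (C_down \<alpha>))" using fin by simp
  finally have "ennreal ((\<Sum>Q\<in>{Q\<in>F. Q \<subseteq> P}. ?w Q) / ?w P) \<le> ennreal (enn2real (C_down \<alpha>))"
    using p by (subst (asm) divide_ennreal) (auto intro!: sum_nonneg)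
  then have "(\<Sum>Q\<in>{Q\<in>F. Q \<subseteq> P}. ?w Q) / ?w P \<le> enn2real (C_down \<alpha>)" by simp
  then show ?thesis using p by (simp add: pos_divide_le_eq)
qed

lemma maximal_ball_le:
  fixes f :: "real ^ 'n \<Rightarrow> real"
  assumes "x \<in> ball c r"
  shows "(mass f (ball c r)) / ennreal (vol (ball c r))
      \<le> e2ennreal \<bar>maximal f x\<bar>"
    and "(mass f (ball c r)) / ennreal (vol (ball c r) powr (1 - avg \<alpha> (ball c r)))
      \<le> e2ennreal \<bar>frac_maximal \<alpha> f x\<bar>"
proof -
  have r: "0 < r" using assms by (metis dist_not_less_zero le_less_trans mem_ball not_less)
  show "(mass f (ball c r)) / ennreal (vol (ball c r))
      \<le> e2ennreal \<bar>maximal f x\<bar>"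
    unfolding maximal_def e2ennreal_abs_enn2ereal
    by (rule SUP_upper2[of "(c, r)"]) (use r assms in auto)
  show "(mass f (ball c r)) / ennreal (vol (ball c r) powr (1 - avg \<alpha> (ball c r)))
      \<le> e2ennreal \<bar>frac_maximal \<alpha> f x\<bar>"
    unfolding frac_maximal_def e2ennreal_abs_enn2ereal
    by (rule SUP_upper2[of "(c, r)"]) (use r assms in auto)
qed

lemma average_comparison:
  fixes f :: "'a \<Rightarrow> ennreal"
  assumes "E \<subseteq> F" "v \<le> C * u" "0 < u" "0 < v"
  shows "(\<integral>\<^sup>+y\<in>E. f y \<partial>M) / ennreal u \<le> ennreal C * ((\<integral>\<^sup>+y\<in>F. f y \<partial>M) / ennreal v)"
proof -
  have "0 < C * u" using assms by linarith
  then have C: "0 < C" using assms(3) by (simp add: zero_less_mult_iff)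
  have "1 / u \<le> C * (1 / v)" using assms C by (simp add: field_simps)
  then have "(\<integral>\<^sup>+y\<in>E. f y \<partial>M) * ennreal (1 / u) \<le> (\<integral>\<^sup>+y\<in>F. f y \<partial>M) * ennreal (C * (1 / v))"
    using assms(1) by (intro mult_mono nn_integral_mono ennreal_leI) (auto simp: indicator_def)
  also have "ennreal (C * (1 / v)) = ennreal C * ennreal (1 / v)"
    using assms C by (intro ennreal_mult) auto
  finally show ?thesis using assms by (simp only: ennreal_divide_eq_mult mult_ac)
qed

context fractional_order
begin

lemma cube_average_le_maximal:
  obtains C where "1 \<le> C"
    "\<And>f x a l. 0 < l \<Longrightarrow> x \<in> cube a l \<Longrightarrow>
      (mass f (cube a l)) / ennreal (avg_copow (cube a l)) \<le> ennreal C * e2ennreal \<bar>frac_maximal (recip s) f x\<bar>"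
    "\<And>f x (a :: real ^ 'n) l. 0 < l \<Longrightarrow> x \<in> cube a l \<Longrightarrow>
      (mass f (cube a l)) / ennreal (vol (cube a l)) \<le> ennreal C * e2ennreal \<bar>maximal f x\<bar>"
proof -
  obtain C where C: "1 \<le> C"
    "\<And>a l. 0 < l \<Longrightarrow> avg_copow (ball a (real CARD('n) * l)) \<le> C * avg_copow (cube a l)"
    "\<And>(a :: real ^ 'n) l. 0 < l \<Longrightarrow> vol (ball a (real CARD('n) * l)) \<le> C * vol (cube a l)"
    using kernel_comparison by metis
  show ?thesis
  proof (rule that[OF C(1)])
    fix f :: "real ^ 'n \<Rightarrow> real" and x a :: "real ^ 'n" and l :: real
    assume l: "0 < l" and x: "x \<in> cube a l"
    let ?B = "ball a (real CARD('n) * l)"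
    have sub: "cube a l \<subseteq> ?B" using cube_dist_less[of _ a l] by (auto simp: dist_commute)
    then have xB: "x \<in> ?B" using x by auto
    have m: "0 < vol (cube a l)" "0 < vol ?B"
      using l measure_ball_pos[of "real CARD('n) * l" a] by (simp_all add: cube_measure)
    show "(mass f (cube a l)) / ennreal (avg_copow (cube a l)) \<le> ennreal C * e2ennreal \<bar>frac_maximal (recip s) f x\<bar>"
      by (rule order_trans[OF average_comparison[OF sub C(2)[OF l]] mult_left_mono[OF maximal_ball_le(2)[OF xB]]])
        (use m in simp_all)
    show "(mass f (cube a l)) / ennreal (vol (cube a l)) \<le> ennreal C * e2ennreal \<bar>maximal f x\<bar>"
      by (rule order_trans[OF average_comparison[OF sub C(3)[OF l]] mult_left_mono[OF maximal_ball_le(1)[OF xB]]])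
        (use m in simp_all)
  qed
qed

lemma frac_maximal_le_frac_integral:
  obtains C where "1 \<le> C" "\<And>f x. f \<in> borel_measurable lebesgue \<Longrightarrow>
    e2ennreal \<bar>frac_maximal (recip s) f x\<bar> \<le> ennreal C * e2ennreal \<bar>frac_integral (recip s) (\<lambda>y. \<bar>f y\<bar>) x\<bar>"
proof -
  obtain C where C: "1 \<le> C"
    "\<And>x y c r. x \<noteq> y \<Longrightarrow> x \<in> ball c r \<Longrightarrow> y \<in> ball c r \<Longrightarrow> frac_kernel (recip s) x y \<le> C * avg_copow (ball c r)"
    using kernel_comparison by metis
  show ?thesis
  proof (rule that[OF C(1)])
    fix f :: "real ^ 'n \<Rightarrow> real" and x :: "real ^ 'n"
    assume f[measurable]: "f \<in> borel_measurable lebesgue"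
    note [measurable] = frac_kernel_measurable[OF s, of x]
    define J where "J = (\<integral>\<^sup>+y\<in>-{x}. ennreal (\<bar>f y\<bar> / frac_kernel (recip s) x y) \<partial>lebesgue)"
    have J: "e2ennreal \<bar>frac_integral (recip s) (\<lambda>y. \<bar>f y\<bar>) x\<bar> = J"
      unfolding J_def by (subst frac_integral_abs_le(2)[OF s]) auto
    have "indicator (ball c r) x * (mass f (ball c r))
          / ennreal (vol (ball c r) powr (1 - avg (recip s) (ball c r))) \<le> ennreal C * J"
      if r: "0 < r" for c r
    proof (cases "x \<in> ball c r")
      case True
      have [measurable]: "ball c r \<in> sets lebesgue" by simp
      have u: "0 < avg_copow (ball c r)" using measure_ball_pos[OF r, of c] by simp
      have "(mass f (ball c r)) / ennreal (avg_copow (ball c r))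
          = (\<integral>\<^sup>+y. ennreal \<bar>f y\<bar> * indicator (ball c r) y / ennreal (avg_copow (ball c r)) \<partial>lebesgue)"
        by (rule nn_integral_divide[symmetric]) measurable
      also have "\<dots> \<le> (\<integral>\<^sup>+y. ennreal C * (ennreal (\<bar>f y\<bar> / frac_kernel (recip s) x y) * indicator (-{x}) y) \<partial>lebesgue)"
      proof (rule nn_integral_mono_AE, use AE_completion[OF AE_lborel_singleton[of x]] in eventually_elim)
        case (elim y)
        show ?case
        proof (cases "y \<in> ball c r")
          case y: True
          have k: "frac_kernel (recip s) x y \<le> C * avg_copow (ball c r)" "0 < frac_kernel (recip s) x y"
            using C(2)[OF _ True y] frac_kernel_pos[of x y] elim by auto
          have "\<bar>f y\<bar> / avg_copow (ball c r) \<le> C * (\<bar>f y\<bar> / frac_kernel (recip s) x y)"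
          proof -
            have "1 / avg_copow (ball c r) \<le> C * (1 / frac_kernel (recip s) x y)" using k u by (simp add: field_simps)
            from mult_left_mono[OF this, of "\<bar>f y\<bar>"] show ?thesis by (simp add: mult_ac)
          qed
          then show ?thesis using y u elim C(1) k
            by (simp add: divide_ennreal ennreal_leI flip: ennreal_mult)
        qed simp
      qed
      also have "\<dots> = ennreal C * J" unfolding J_def
        by (rule nn_integral_cmult) (intro borel_measurable_times_ennreal borel_measurable_indicator, measurable, simp)
      finally show ?thesis using True by simp
    qed simp
    then show "e2ennreal \<bar>frac_maximal (recip s) f x\<bar> \<le> ennreal C * e2ennreal \<bar>frac_integral (recip s) (\<lambda>y. \<bar>f y\<bar>) x\<bar>"
      unfolding J frac_maximal_def e2ennreal_abs_enn2ereal by (intro SUP_least) auto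
  qed
qed

section \<open>Bounding the fractional integral by maximal operators\<close>

text \<open>
  The functions \<open>u\<close> and \<open>v\<close> in the proof are maximal functions over the finite family. They are
  measurable, as Hoelder's inequality requires, and bounded pointwise by the given maximal operators,
  so their norms are controlled by monotonicity. The two averages and the weight
  \<open>|Q|\<close> to the power \<open>1 + a\<^sub>Q\<close> multiply to the summand of the conclusion.
\<close>

lemma dyadic_bilinear_bound:
  assumes p: "p \<in> exponents" and q: "q \<in> exponents"
    and qfin: "AE x in lebesgue. 1 < q x \<and> q x < \<infinity>"
    and H: "bounded_op (conj_exponent q) (conj_exponent q) maximal"
    and down: "C_down (recip s) < \<infinity>"
    and M: "bounded_op p q (frac_maximal (recip s))"
  obtains K where "0 < K"
    "\<And>D F f g t b. dyadic_lattice D \<Longrightarrow> finite F \<Longrightarrow> F \<subseteq> D \<Longrightarrow>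
      f \<in> borel_measurable lebesgue \<Longrightarrow> g \<in> borel_measurable lebesgue \<Longrightarrow> (\<And>x. 0 \<le> g x) \<Longrightarrow>
      norm_le p (\<lambda>x. ennreal \<bar>f x\<bar>) t \<Longrightarrow> norm_le (conj_exponent q) (\<lambda>x. ennreal (g x)) b \<Longrightarrow>
      (\<Sum>Q\<in>F. (mass f Q) / ennreal (avg_copow Q) * (\<integral>\<^sup>+y\<in>Q. ennreal (g y) \<partial>lebesgue))
        \<le> ennreal (K * t * b)"
proof -
  have conj: "conj_pair q (conj_exponent q)" using q by (rule conj_pair_conj_exponent)
  have q': "conj_exponent q \<in> exponents" using conj by (simp add: conj_pair_def)
  have qf: "AE x in lebesgue. q x < \<infinity>" using qfin by eventually_elim simp
  have q'f: "AE x in lebesgue. conj_exponent q x < \<infinity>"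
    by (rule conj_exponent_finite[OF q]) (use qfin in \<open>auto elim: eventually_mono\<close>)
  obtain CM where CM: "0 < CM" "\<And>f t. f \<in> borel_measurable lebesgue \<Longrightarrow> norm_le p (\<lambda>x. ennreal \<bar>f x\<bar>) t \<Longrightarrow>
    norm_le q (\<lambda>x. e2ennreal \<bar>frac_maximal (recip s) f x\<bar>) (CM * t)"
    using bounded_opD[OF q qf M] by metis
  obtain CH where CH: "0 < CH" "\<And>f t. f \<in> borel_measurable lebesgue \<Longrightarrow> norm_le (conj_exponent q) (\<lambda>x. ennreal \<bar>f x\<bar>) t \<Longrightarrow>
    norm_le (conj_exponent q) (\<lambda>x. e2ennreal \<bar>maximal f x\<bar>) (CH * t)"
    using bounded_opD[OF q' q'f H] by metis
  obtain CA where CA: "1 \<le> CA"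
    "\<And>f x a l. 0 < l \<Longrightarrow> x \<in> cube a l \<Longrightarrow>
      (mass f (cube a l)) / ennreal (avg_copow (cube a l)) \<le> ennreal CA * e2ennreal \<bar>frac_maximal (recip s) f x\<bar>"
    "\<And>f x (a :: real ^ 'n) l. 0 < l \<Longrightarrow> x \<in> cube a l \<Longrightarrow>
      (mass f (cube a l)) / ennreal (vol (cube a l)) \<le> ennreal CA * e2ennreal \<bar>maximal f x\<bar>"
    by (rule cube_average_le_maximal) (rule that, assumption, blast, blast)
  obtain CL where CL: "1 \<le> CL"
    "\<And>a l b k. 0 < l \<Longrightarrow> 0 < k \<Longrightarrow> cube a l \<subseteq> cube b k \<Longrightarrow> avg_pow (cube a l) \<le> CL * avg_pow (cube b k)"
    using kernel_comparison by metis
  define CD where "CD = enn2real (C_down (recip s))"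
  have CD: "0 \<le> CD" unfolding CD_def by simp
  define K where "K = 72 * CD * CL * 2 * (CA * CM) * (CA * CH) + 1"
  note pos = CD CL(1) CA(1) CM(1) CH(1)
  have "0 \<le> 72 * CD * CL * 2 * (CA * CM) * (CA * CH)" using pos by simp
  then have K: "0 < K" unfolding K_def by linarith
  show ?thesis
  proof (rule that[OF K])
    fix D F :: "(real ^ 'n) set set" and f g :: "real ^ 'n \<Rightarrow> real" and t b :: real
    assume D: "dyadic_lattice D" and F: "finite F" "F \<subseteq> D"
      and f[measurable]: "f \<in> borel_measurable lebesgue" and g[measurable]: "g \<in> borel_measurable lebesgue"
      and g0: "\<And>x. 0 \<le> g x"
      and t: "norm_le p (\<lambda>x. ennreal \<bar>f x\<bar>) t" and b: "norm_le (conj_exponent q) (\<lambda>x. ennreal (g x)) b"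
    have tb: "0 < t" "0 < b" using t b by (auto simp: norm_le_def)
    have Qm: "Q \<in> sets lebesgue" "0 < vol Q" if "Q \<in> F" for Q
      using dyadic_lattice_measurable[OF D] that F by auto
    have Qfin: "emeasure lebesgue Q \<noteq> \<infinity>" if "Q \<in> F" for Q
      using emeasure_lebesgue_finite[OF Qm(2)[OF that]] by simp
    define If where "If Q = enn2real (mass f Q)" for Q
    define Ig where "Ig Q = enn2real (\<integral>\<^sup>+y\<in>Q. ennreal (g y) \<partial>lebesgue)" for Q
    have If: "(mass f Q) = ennreal (If Q)" if "Q \<in> F" for Q
      using norm_le_locally_integrable[OF p _ t Qm(1)[OF that] Qfin[OF that]] unfolding If_def by simp
    have Ig: "(\<integral>\<^sup>+y\<in>Q. ennreal (g y) \<partial>lebesgue) = ennreal (Ig Q)" if "Q \<in> F" for Q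
      using norm_le_locally_integrable[OF q' _ b Qm(1)[OF that] Qfin[OF that]] unfolding Ig_def by simp
    have If0: "0 \<le> If Q" and Ig0: "0 \<le> Ig Q" for Q unfolding If_def Ig_def by auto
    let ?\<phi> = "\<lambda>Q. If Q / vol Q" and ?\<gamma> = "\<lambda>Q. Ig Q / vol Q"
    define u where "u x = Max (insert 0 ((\<lambda>Q. avg_pow Q * ?\<phi> Q * indicator Q x) ` F))" for x
    define v where "v x = Max (insert 0 ((\<lambda>Q. ?\<gamma> Q * indicator Q x) ` F))" for x
    have um[measurable]: "u \<in> borel_measurable lebesgue"
    proof -
      have "(\<lambda>x. Max ((\<lambda>Q. case Q of None \<Rightarrow> 0 | Some Q \<Rightarrow> avg_pow Q * ?\<phi> Q * indicator Q x) ` (insert None (Some ` F))))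
          \<in> borel_measurable lebesgue"
        by (rule borel_measurable_Max) (use F Qm in \<open>auto intro!: borel_measurable_times borel_measurable_indicator\<close>)
      then show ?thesis unfolding u_def[abs_def] by (simp add: image_image)
    qed
    have vm[measurable]: "v \<in> borel_measurable lebesgue"
    proof -
      have "(\<lambda>x. Max ((\<lambda>Q. case Q of None \<Rightarrow> 0 | Some Q \<Rightarrow> ?\<gamma> Q * indicator Q x) ` (insert None (Some ` F))))
          \<in> borel_measurable lebesgue"
        by (rule borel_measurable_Max) (use F Qm in \<open>auto intro!: borel_measurable_times borel_measurable_indicator\<close>)
      then show ?thesis unfolding v_def[abs_def] by (simp add: image_image)
    qed
    have u0: "0 \<le> u x" and v0: "0 \<le> v x" for x using F unfolding u_def v_def by (auto intro: Max_ge)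
    have u1: "avg_pow R * ?\<phi> R \<le> u x" if "R \<in> F" "x \<in> R" for R x
      unfolding u_def by (rule Max_ge) (use F that in \<open>auto intro!: image_eqI[of _ _ R]\<close>)
    have v1: "?\<gamma> R \<le> v x" if "R \<in> F" "x \<in> R" for R x
      unfolding v_def by (rule Max_ge) (use F that in \<open>auto intro!: image_eqI[of _ _ R]\<close>)
    have lu: "avg_pow Q * ?\<phi> Q = If Q / avg_copow Q" if "Q \<in> F" for Q
      using avg_copow_mult_avg_pow[OF Qm(2)[OF that]] Qm(2)[OF that] by (simp add: field_simps)
    have Qcube: "\<exists>a l. 0 < l \<and> Q = cube a l" if "Q \<in> F" for Q
      using dyadic_lattice_cube[OF D] that F by (metis subsetD zero_less_numeral zero_less_power_int)
    have uM: "ennreal (u x) \<le> ennreal CA * e2ennreal \<bar>frac_maximal (recip s) f x\<bar>" for x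
    proof -
      have "u x \<in> insert 0 ((\<lambda>Q. avg_pow Q * ?\<phi> Q * indicator Q x) ` F)"
        unfolding u_def by (rule Max_in) (use F in auto)
      then have "u x = 0 \<or> (\<exists>Q\<in>F. u x = avg_pow Q * ?\<phi> Q * indicator Q x)" by blast
      then have "u x = 0 \<or> (\<exists>Q\<in>F. x \<in> Q \<and> u x = avg_pow Q * ?\<phi> Q)"
        by (metis indicator_simps mult.right_neutral mult_zero_right)
      then consider "u x = 0" | Q where "Q \<in> F" "x \<in> Q" "u x = avg_pow Q * ?\<phi> Q" by blast
      then show ?thesis
      proof cases
        case 2
        obtain a l where Q: "0 < l" "Q = cube a l" using Qcube[OF 2(1)] by blast
        have "ennreal (u x) = (mass f Q) / ennreal (avg_copow Q)"
          using If[OF 2(1)] If0[of Q] Qm(2)[OF 2(1)] 2(3) lu[OF 2(1)] by (simp add: divide_ennreal)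
        then show ?thesis using CA(2)[OF Q(1), of x a f] 2 Q(2) by simp
      qed simp
    qed
    have vM: "ennreal (v x) \<le> ennreal CA * e2ennreal \<bar>maximal g x\<bar>" for x
    proof -
      have "v x \<in> insert 0 ((\<lambda>Q. ?\<gamma> Q * indicator Q x) ` F)"
        unfolding v_def by (rule Max_in) (use F in auto)
      then have "v x = 0 \<or> (\<exists>Q\<in>F. v x = ?\<gamma> Q * indicator Q x)" by blast
      then have "v x = 0 \<or> (\<exists>Q\<in>F. x \<in> Q \<and> v x = ?\<gamma> Q)"
        by (metis indicator_simps mult.right_neutral mult_zero_right)
      then consider "v x = 0" | Q where "Q \<in> F" "x \<in> Q" "v x = ?\<gamma> Q" by blast
      then show ?thesis
      proof cases
        case 2
        obtain a l where Q: "0 < l" "Q = cube a l" using Qcube[OF 2(1)] by blast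
        have "ennreal (v x) = (mass g Q) / ennreal (vol Q)"
          using Ig[OF 2(1)] Ig0[of Q] Qm(2)[OF 2(1)] 2(3) g0 by (simp add: divide_ennreal)
        then show ?thesis using CA(3)[OF Q(1), of x a g] 2 Q(2) by simp
      qed simp
    qed
    have nu: "norm_le q (\<lambda>x. ennreal (u x)) (CA * (CM * t))"
      by (rule norm_le_mono[OF q CM(2)[OF f t] _ _ uM]) (use pos qf in auto)
    have nv: "norm_le (conj_exponent q) (\<lambda>x. ennreal (v x)) (CA * (CH * b))"
      by (rule norm_le_mono[OF q' CH(2)[OF g] _ _ vM]) (use b g0 pos q'f in auto)
    have uv: "(\<integral>\<^sup>+x. ennreal (u x * v x) \<partial>lebesgue) \<le> ennreal (2 * (CA * (CM * t)) * (CA * (CH * b)))"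
      using Hoelder_norm_le[OF conj _ _ nu nv] u0 v0 by (simp add: ennreal_mult)
    have "ennreal (\<Sum>Q\<in>F. vol Q powr (1 + avg (recip s) Q) * ?\<phi> Q * ?\<gamma> Q)
        \<le> ennreal (72 * CD * CL) * (\<integral>\<^sup>+x. ennreal (u x * v x) \<partial>lebesgue)"
    proof (rule laminar_bilinear_bound[where f = "\<lambda>x. \<bar>f x\<bar>" and g = g and b = "\<lambda>Q. avg_pow Q"])
      show "laminar F" by (rule dyadic_lattice_laminar[OF D F(2)])
      show "(\<integral>\<^sup>+x\<in>Q. ennreal \<bar>f x\<bar> \<partial>lebesgue) = ennreal (?\<phi> Q * vol Q)" if "Q \<in> F" for Q
        using If[OF that] Qm(2)[OF that] by simp
      show "(\<integral>\<^sup>+x\<in>Q. ennreal (g x) \<partial>lebesgue) = ennreal (?\<gamma> Q * vol Q)" if "Q \<in> F" for Q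
        using Ig[OF that] Qm(2)[OF that] by simp
      fix P assume P: "P \<in> F"
      have "vol P powr (1 + avg (recip s) P) = vol P * avg_pow P"
        using Qm(2)[OF P] by (simp add: powr_add)
      then show "(\<Sum>Q\<in>{Q \<in> F. Q \<subseteq> P}. vol Q powr (1 + avg (recip s) Q)) \<le> CD * (vol P * avg_pow P)"
        using C_down_packing[OF down D _ F, of P] P F unfolding CD_def by auto
    next
      fix Q P assume QP: "Q \<in> F" "P \<in> F" "Q \<subseteq> P"
      obtain a l b' k where "0 < l" "Q = cube a l" "0 < k" "P = cube b' k"
        using Qcube[OF QP(1)] Qcube[OF QP(2)] by blast
      then show "avg_pow Q \<le> CL * avg_pow P" using CL(2) QP by blast
    qed (use F Qm pos u0 v0 u1 v1 If0 Ig0 in \<open>auto simp: less_imp_le intro!: divide_nonneg_nonneg\<close>)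
    also have "\<dots> \<le> ennreal (72 * CD * CL) * ennreal (2 * (CA * (CM * t)) * (CA * (CH * b)))"
      by (rule mult_left_mono[OF uv]) simp
    also have "\<dots> = ennreal (72 * CD * CL * (2 * (CA * (CM * t)) * (CA * (CH * b))))"
      using pos tb by (intro ennreal_mult[symmetric]) auto
    also have "\<dots> \<le> ennreal (K * t * b)" unfolding K_def using tb by (intro ennreal_leI) (simp add: algebra_simps)
    finally have "ennreal (\<Sum>Q\<in>F. vol Q powr (1 + avg (recip s) Q) * ?\<phi> Q * ?\<gamma> Q) \<le> ennreal (K * t * b)" .
    moreover have "(\<Sum>Q\<in>F. (mass f Q) / ennreal (avg_copow Q) * (\<integral>\<^sup>+y\<in>Q. ennreal (g y) \<partial>lebesgue))
        = ennreal (\<Sum>Q\<in>F. vol Q powr (1 + avg (recip s) Q) * ?\<phi> Q * ?\<gamma> Q)"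
    proof -
      have "(mass f Q) / ennreal (avg_copow Q) * (\<integral>\<^sup>+y\<in>Q. ennreal (g y) \<partial>lebesgue)
        = ennreal (vol Q powr (1 + avg (recip s) Q) * ?\<phi> Q * ?\<gamma> Q)" if Q: "Q \<in> F" for Q
      proof -
        have "vol Q powr (1 + avg (recip s) Q) * ?\<phi> Q * ?\<gamma> Q = (avg_pow Q * ?\<phi> Q) * Ig Q"
          using Qm(2)[OF Q] by (simp add: powr_add)
        also have "\<dots> = If Q / avg_copow Q * Ig Q" by (simp only: lu[OF Q])
        finally have eq: "vol Q powr (1 + avg (recip s) Q) * ?\<phi> Q * ?\<gamma> Q = If Q / avg_copow Q * Ig Q" .
        have "(mass f Q) / ennreal (avg_copow Q) * (\<integral>\<^sup>+y\<in>Q. ennreal (g y) \<partial>lebesgue)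
            = ennreal (If Q / avg_copow Q) * ennreal (Ig Q)"
          using If[OF Q] Ig[OF Q] If0[of Q] Qm(2)[OF Q] by (simp add: divide_ennreal)
        also have "\<dots> = ennreal (If Q / avg_copow Q * Ig Q)"
          using If0 Ig0 by (intro ennreal_mult[symmetric]) auto
        finally show ?thesis by (simp only: eq)
      qed
      then show ?thesis
        using If0 Ig0 by (subst sum_ennreal[symmetric]) (auto intro!: sum.cong mult_nonneg_nonneg)
    qed
    ultimately show "(\<Sum>Q\<in>F. (mass f Q) / ennreal (avg_copow Q) * (\<integral>\<^sup>+y\<in>Q. ennreal (g y) \<partial>lebesgue))
        \<le> ennreal (K * t * b)" by simp
  qed
qed

text \<open>
  For \<open>y \<noteq> x\<close> the kernel is at most a constant times the reciprocal of \<open>avg_copow Q\<close> for a single cube \<open>Q\<close>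
  containing both points; adding all other cubes containing them only enlarges the bound.
\<close>

lemma frac_integral_dyadic_domination:
  obtains C where "1 \<le> C" "\<And>f x. f \<in> borel_measurable lebesgue \<Longrightarrow>
    e2ennreal \<bar>frac_integral (recip s) f x\<bar> \<le> ennreal C *
      (SUP N. \<Sum>Q\<in>grid_cubes_upto N. (mass f Q) / ennreal (avg_copow Q) * indicator Q x)"
proof -
  obtain C where C: "1 \<le> C"
    "\<And>x y a l. x \<noteq> y \<Longrightarrow> x \<in> cube a l \<Longrightarrow> y \<in> cube a l \<Longrightarrow> 0 < l \<Longrightarrow> l \<le> 6 * dist x y \<Longrightarrow>
      avg_copow (cube a l) \<le> C * frac_kernel (recip s) x y"
    using kernel_comparison by metis
  show ?thesis
  proof (rule that[OF C(1)])
    fix f :: "real ^ 'n \<Rightarrow> real" and x :: "real ^ 'n"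
    assume f[measurable]: "f \<in> borel_measurable lebesgue"
    have Qm: "Q \<in> sets lebesgue" "0 < avg_copow Q" if Q: "Q \<in> grid_cubes_upto N" for Q :: "(real ^ 'n) set" and N
    proof -
      obtain u where "Q \<in> shifted_lattice u" using grid_cubes_upto_lattice[OF Q] by blast
      from dyadic_lattice_measurable[OF dyadic_lattice_shifted this]
      show "Q \<in> sets lebesgue" "0 < avg_copow Q" by simp_all
    qed
    let ?h = "\<lambda>N y. \<Sum>Q\<in>grid_cubes_upto N. indicator Q x / ennreal (avg_copow Q) * (ennreal \<bar>f y\<bar> * indicator Q y)"
    have hm: "?h N \<in> borel_measurable lebesgue" for N
      by (intro borel_measurable_sum borel_measurable_times_ennreal borel_measurable_indicator Qm(1))
        measurable
    have point: "ennreal (\<bar>f y\<bar> / frac_kernel (recip s) x y) * indicator (-{x}) y \<le> ennreal C * (SUP N. ?h N y)" for y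
    proof (cases "x = y")
      case False
      obtain u k m where Q: "x \<in> grid_cube u k m" "y \<in> grid_cube u k m" "2 powi k \<le> 6 * dist x y"
        using two_points_in_grid_cube[OF False] by blast
      obtain N where N: "grid_cube u k m \<in> grid_cubes_upto N" using grid_cubes_upto_ex by blast
      let ?Q = "grid_cube u k m"
      have k: "0 < frac_kernel (recip s) x y" by (rule frac_kernel_pos[OF False])
      have up: "avg_copow ?Q \<le> C * frac_kernel (recip s) x y" "0 < avg_copow ?Q"
        using C(2)[of x y "grid_corner u k m" "2 powi k"] False Q Qm(2)[OF N] unfolding grid_cube_def by simp_all
      have "1 / frac_kernel (recip s) x y \<le> C * (1 / avg_copow ?Q)" using up k by (simp add: field_simps)
      from mult_left_mono[OF this, of "\<bar>f y\<bar>"]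
      have "ennreal (\<bar>f y\<bar> / frac_kernel (recip s) x y) \<le> ennreal (C * (1 / avg_copow ?Q * \<bar>f y\<bar>))"
        by (intro ennreal_leI) (simp add: mult_ac)
      also have "\<dots> = ennreal C * (ennreal (1 / avg_copow ?Q) * ennreal \<bar>f y\<bar>)"
        using C(1) up by (subst ennreal_mult ennreal_mult, simp, simp)+ simp
      also have "ennreal (1 / avg_copow ?Q) * ennreal \<bar>f y\<bar>
          = indicator ?Q x / ennreal (avg_copow ?Q) * (ennreal \<bar>f y\<bar> * indicator ?Q y)"
        using Q up by (simp add: ennreal_divide_eq_mult)
      also have "\<dots> \<le> ?h N y" by (rule member_le_sum[OF N _ grid_cubes_upto_finite]) simp
      also have "\<dots> \<le> (SUP N. ?h N y)" by (rule SUP_upper) simp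
      finally show ?thesis using False by (simp add: mult_left_mono)
    qed simp
    have hint: "(\<integral>\<^sup>+y. ?h N y \<partial>lebesgue)
        = (\<Sum>Q\<in>grid_cubes_upto N. (mass f Q) / ennreal (avg_copow Q) * indicator Q x)" for N
    proof -
      have m: "(\<lambda>y. ennreal \<bar>f y\<bar> * indicator Q y) \<in> borel_measurable lebesgue" if "Q \<in> grid_cubes_upto N" for Q :: "(real ^ 'n) set"
        by (intro borel_measurable_times_ennreal borel_measurable_indicator Qm(1)[OF that])
          measurable
      have "(\<integral>\<^sup>+y. ?h N y \<partial>lebesgue) = (\<Sum>Q\<in>grid_cubes_upto N. \<integral>\<^sup>+y. indicator Q x / ennreal (avg_copow Q) * (ennreal \<bar>f y\<bar> * indicator Q y) \<partial>lebesgue)"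
        by (rule nn_integral_sum) (intro borel_measurable_times_ennreal m, simp_all)
      also have "\<dots> = (\<Sum>Q\<in>grid_cubes_upto N. (mass f Q) / ennreal (avg_copow Q) * indicator Q x)"
      proof (rule sum.cong[OF refl])
        fix Q :: "(real ^ 'n) set" assume Q: "Q \<in> grid_cubes_upto N"
        have "(\<integral>\<^sup>+y. indicator Q x / ennreal (avg_copow Q) * (ennreal \<bar>f y\<bar> * indicator Q y) \<partial>lebesgue)
            = indicator Q x / ennreal (avg_copow Q) * (mass f Q)"
          by (rule nn_integral_cmult[OF m[OF Q]])
        also have "\<dots> = (mass f Q) / ennreal (avg_copow Q) * indicator Q x"
          using Qm(2)[OF Q] by (simp only: ennreal_divide_eq_mult mult_ac)
        finally show "(\<integral>\<^sup>+y. indicator Q x / ennreal (avg_copow Q) * (ennreal \<bar>f y\<bar> * indicator Q y) \<partial>lebesgue)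
            = (mass f Q) / ennreal (avg_copow Q) * indicator Q x" .
      qed
      finally show ?thesis .
    qed
    have "e2ennreal \<bar>frac_integral (recip s) f x\<bar>
        \<le> (\<integral>\<^sup>+y\<in>-{x}. ennreal (\<bar>f y\<bar> / frac_kernel (recip s) x y) \<partial>lebesgue)"
      by (rule frac_integral_abs_le(1)[OF s f])
    also have "\<dots> \<le> (\<integral>\<^sup>+y. ennreal C * (SUP N. ?h N y) \<partial>lebesgue)"
      by (rule nn_integral_mono) (rule point)
    also have "\<dots> = ennreal C * (\<integral>\<^sup>+y. (SUP N. ?h N y) \<partial>lebesgue)"
      by (rule nn_integral_cmult) (intro borel_measurable_SUP hm, simp)
    also have "(\<integral>\<^sup>+y. (SUP N. ?h N y) \<partial>lebesgue) = (SUP N. \<integral>\<^sup>+y. ?h N y \<partial>lebesgue)"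
    proof (rule nn_integral_monotone_convergence_SUP[OF _ hm])
      show "incseq ?h"
        by (intro incseq_SucI le_funI sum_mono2 grid_cubes_upto_finite grid_cubes_upto_mono) auto
    qed
    also have "(SUP N. \<integral>\<^sup>+y. ?h N y \<partial>lebesgue) = (SUP N. \<Sum>Q\<in>grid_cubes_upto N. (mass f Q) / ennreal (avg_copow Q) * indicator Q x)"
      by (simp only: hint)
    finally show "e2ennreal \<bar>frac_integral (recip s) f x\<bar> \<le> ennreal C *
      (SUP N. \<Sum>Q\<in>grid_cubes_upto N. (mass f Q) / ennreal (avg_copow Q) * indicator Q x)" .
  qed
qed

text \<open>
  Each finite stage \<open>h N\<close> of the dyadic majorant is bounded with bounded support, so that duality applies
  to it, with a constant that does not depend on \<open>N\<close>.
\<close>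

lemma frac_integral_bounded:
  assumes p: "p \<in> exponents" and q: "q \<in> exponents"
    and qfin: "AE x in lebesgue. 1 < q x \<and> q x < \<infinity>"
    and H: "bounded_op (conj_exponent q) (conj_exponent q) maximal"
    and down: "C_down (recip s) < \<infinity>"
    and M: "bounded_op p q (frac_maximal (recip s))"
  shows "bounded_op p q (frac_integral (recip s))"
proof -
  have qf: "AE x in lebesgue. q x < \<infinity>" using qfin by eventually_elim simp
  obtain K where K: "0 < K"
    "\<And>D F f g t b. dyadic_lattice D \<Longrightarrow> finite F \<Longrightarrow> F \<subseteq> D \<Longrightarrow>
      f \<in> borel_measurable lebesgue \<Longrightarrow> g \<in> borel_measurable lebesgue \<Longrightarrow> (\<And>x. 0 \<le> g x) \<Longrightarrow>
      norm_le p (\<lambda>x. ennreal \<bar>f x\<bar>) t \<Longrightarrow> norm_le (conj_exponent q) (\<lambda>x. ennreal (g x)) b \<Longrightarrow>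
      (\<Sum>Q\<in>F. (mass f Q) / ennreal (avg_copow Q) * (\<integral>\<^sup>+y\<in>Q. ennreal (g y) \<partial>lebesgue))
        \<le> ennreal (K * t * b)"
    by (rule dyadic_bilinear_bound[OF p q qfin H down M]) (rule that, assumption, blast)
  obtain C where C: "1 \<le> C" "\<And>f x. f \<in> borel_measurable lebesgue \<Longrightarrow>
    e2ennreal \<bar>frac_integral (recip s) f x\<bar> \<le> ennreal C *
      (SUP N. \<Sum>Q\<in>grid_cubes_upto N. (mass f Q) / ennreal (avg_copow Q) * indicator Q x)"
    by (rule frac_integral_dyadic_domination) (rule that, assumption, blast)
  \<comment> \<open>The cubes come from one lattice for each of the shifts \<open>u\<close>.\<close>
  define L where "L = real CARD(bool ^ 'n) * K"
  have L: "0 < L" unfolding L_def using K(1) by simp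
  show ?thesis
  proof (rule bounded_opI[of "2 * C * (2 * L)"])
    show "0 < 2 * C * (2 * L)" using L C(1) by simp
    fix f :: "real ^ 'n \<Rightarrow> real" and t
    assume f[measurable]: "f \<in> borel_measurable lebesgue" and t: "norm_le p (\<lambda>x. ennreal \<bar>f x\<bar>) t"
    have t0: "0 < t" using t by (simp add: norm_le_def)
    define w where "w Q = enn2real (mass f Q) / avg_copow Q" for Q
    have w0: "0 \<le> w Q" for Q unfolding w_def by simp
    have Qm: "Q \<in> sets lebesgue" "0 < vol Q" if "Q \<in> grid_cubes_upto N" for Q :: "(real ^ 'n) set" and N
      using grid_cubes_upto_lattice[OF that] dyadic_lattice_measurable[OF dyadic_lattice_shifted] by auto
    have Qfin: "emeasure lebesgue Q \<noteq> \<infinity>" if "Q \<in> grid_cubes_upto N" for Q :: "(real ^ 'n) set" and N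
      using emeasure_lebesgue_finite[OF Qm(2)[OF that]] by simp
    have w: "(mass f Q) / ennreal (avg_copow Q) = ennreal (w Q)"
      if "Q \<in> grid_cubes_upto N" for Q N
    proof -
      have "(mass f Q) < \<infinity>"
        by (rule norm_le_locally_integrable[OF p _ t Qm(1)[OF that] Qfin[OF that]])
          measurable
      then have eq: "(mass f Q) = ennreal (enn2real (mass f Q))"
        by simp
      have "0 < avg_copow Q" using Qm(2)[OF that] by simp
      then show ?thesis unfolding w_def by (subst eq) (rule divide_ennreal[OF enn2real_nonneg])
    qed
    define h where "h N x = (\<Sum>Q\<in>grid_cubes_upto N. w Q * indicator Q x)" for N x
    have hm[measurable]: "h N \<in> borel_measurable lebesgue" for N
      unfolding h_def[abs_def] by (intro borel_measurable_sum borel_measurable_times borel_measurable_indicator Qm(1)) auto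
    have h0: "0 \<le> h N x" for N x unfolding h_def using w0 by (intro sum_nonneg) simp
    have hN: "norm_le q (\<lambda>x. ennreal (h N x)) (2 * (L * t))" for N
    proof (rule norm_le_by_duality[OF q qfin hm h0])
      show "h N x \<le> (\<Sum>Q\<in>grid_cubes_upto N. w Q)" for x
        unfolding h_def using w0 by (intro sum_mono) (auto simp: indicator_def)
      show "(\<Union>(grid_cubes_upto N) :: (real ^ 'n) set) \<in> sets lebesgue"
        by (intro sets.finite_Union grid_cubes_upto_finite subsetI) (rule Qm(1))
      have "emeasure lebesgue (\<Union>(id ` (grid_cubes_upto N :: (real ^ 'n) set set))) \<le> (\<Sum>Q\<in>grid_cubes_upto N. emeasure lebesgue (id Q :: (real ^ 'n) set))"
        by (rule emeasure_subadditive_finite) (use grid_cubes_upto_finite Qm(1) in auto)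
      also have "\<dots> < \<infinity>" 
        using Qfin by (simp add: ennreal_sum_less_top[OF grid_cubes_upto_finite] less_top)
      finally show "emeasure lebesgue (\<Union>(grid_cubes_upto N) :: (real ^ 'n) set) \<noteq> \<infinity>" by simp
      show "h N x = 0" if "x \<notin> \<Union>(grid_cubes_upto N)" for x :: "real ^ 'n"
        unfolding h_def using that by (intro sum.neutral) (auto simp: indicator_def)
      show "0 < L * t" using L t0 by simp
      fix g :: "real ^ 'n \<Rightarrow> real" and b
      assume g[measurable]: "g \<in> borel_measurable lebesgue" and g0: "\<And>x. 0 \<le> g x"
        and b: "norm_le (conj_exponent q) (\<lambda>x. ennreal (g x)) b"
      have b0: "0 < b" using b by (simp add: norm_le_def)
      let ?T = "\<lambda>Q. ennreal (w Q) * (\<integral>\<^sup>+y\<in>Q. ennreal (g y) \<partial>lebesgue)"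
      have gm: "(\<lambda>x. ennreal (g x) * indicator Q x) \<in> borel_measurable lebesgue" if "Q \<in> grid_cubes_upto N" for Q :: "(real ^ 'n) set"
        by (intro borel_measurable_times_ennreal borel_measurable_indicator Qm(1)[OF that])
          measurable
      have "(\<integral>\<^sup>+x. ennreal (h N x * g x) \<partial>lebesgue)
          = (\<integral>\<^sup>+x. (\<Sum>Q\<in>grid_cubes_upto N. ennreal (w Q) * (ennreal (g x) * indicator Q x)) \<partial>lebesgue)"
      proof (rule nn_integral_cong)
        fix x
        have "ennreal (h N x * g x) = ennreal (\<Sum>Q\<in>grid_cubes_upto N. w Q * (g x * indicator Q x))"
          unfolding h_def sum_distrib_right by (simp only: mult_ac)
        also have "\<dots> = (\<Sum>Q\<in>grid_cubes_upto N. ennreal (w Q * (g x * indicator Q x)))"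
          using w0 g0 by (intro sum_ennreal[symmetric]) simp
        also have "\<dots> = (\<Sum>Q\<in>grid_cubes_upto N. ennreal (w Q) * (ennreal (g x) * indicator Q x))"
          using w0 g0 by (intro sum.cong) (auto simp: indicator_def ennreal_mult)
        finally show "ennreal (h N x * g x) = (\<Sum>Q\<in>grid_cubes_upto N. ennreal (w Q) * (ennreal (g x) * indicator Q x))" .
      qed
      also have "\<dots> = (\<Sum>Q\<in>grid_cubes_upto N. \<integral>\<^sup>+x. ennreal (w Q) * (ennreal (g x) * indicator Q x) \<partial>lebesgue)"
        by (rule nn_integral_sum) (intro borel_measurable_times_ennreal gm, simp_all)
      also have "\<dots> = (\<Sum>Q\<in>grid_cubes_upto N. ?T Q)"
        by (intro sum.cong refl nn_integral_cmult gm)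
      also have "\<dots> \<le> (\<Sum>Q\<in>grid_cubes_upto N. \<Sum>u\<in>{u\<in>(UNIV :: (bool ^ 'n) set). Q \<in> shifted_lattice u}. ?T Q)"
      proof (rule sum_mono)
        fix Q :: "(real ^ 'n) set" assume "Q \<in> grid_cubes_upto N"
        then obtain u where "Q \<in> shifted_lattice u" using grid_cubes_upto_lattice by blast
        then show "?T Q \<le> (\<Sum>u\<in>{u\<in>(UNIV :: (bool ^ 'n) set). Q \<in> shifted_lattice u}. ?T Q)"
          by (intro member_le_sum[of u]) auto
      qed
      also have "\<dots> = (\<Sum>u\<in>(UNIV :: (bool ^ 'n) set). \<Sum>Q\<in>{Q\<in>grid_cubes_upto N. Q \<in> shifted_lattice u}. ?T Q)"
        by (rule sum.swap_restrict[OF grid_cubes_upto_finite]) simp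
      also have "\<dots> \<le> (\<Sum>u\<in>(UNIV :: (bool ^ 'n) set). ennreal (K * t * b))"
      proof (rule sum_mono)
        fix u :: "bool ^ 'n"
        have "(\<Sum>Q\<in>{Q\<in>grid_cubes_upto N. Q \<in> shifted_lattice u}. ?T Q) = (\<Sum>Q\<in>{Q\<in>grid_cubes_upto N. Q \<in> shifted_lattice u}.
          (mass f Q) / ennreal (avg_copow Q) * (\<integral>\<^sup>+y\<in>Q. ennreal (g y) \<partial>lebesgue))"
          by (intro sum.cong refl) (use w in auto)
        also have "\<dots> \<le> ennreal (K * t * b)"
          by (rule K(2)[OF dyadic_lattice_shifted _ _ f g g0 t b])
            (auto intro: finite_subset[OF _ grid_cubes_upto_finite[of N]])
        finally show "(\<Sum>Q\<in>{Q\<in>grid_cubes_upto N. Q \<in> shifted_lattice u}. ?T Q) \<le> ennreal (K * t * b)" .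
      qed
      also have "\<dots> = ennreal (L * t * b)"
        unfolding L_def using K(1) t0 b0
        by (simp add: ennreal_of_nat_eq_real_of_nat mult.assoc flip: ennreal_mult)
      finally show "(\<integral>\<^sup>+x. ennreal (h N x * g x) \<partial>lebesgue) \<le> ennreal (L * t * b)" .
    qed
    have "norm_le q (\<lambda>x. e2ennreal \<bar>frac_integral (recip s) f x\<bar>) (2 * C * (2 * (L * t)))"
    proof (rule norm_le_SUP[OF q qf _ _ hN])
      show "0 < C" using C(1) by simp
      show "ennreal (h N x) \<le> ennreal (h (Suc N) x)" for N x
        unfolding h_def using w0 grid_cubes_upto_finite
        by (intro ennreal_leI sum_mono2 grid_cubes_upto_mono) auto
      fix x
      have "(\<Sum>Q\<in>grid_cubes_upto N. (mass f Q) / ennreal (avg_copow Q) * indicator Q x)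
          = ennreal (h N x)" for N
      proof -
        have "ennreal (h N x) = (\<Sum>Q\<in>grid_cubes_upto N. ennreal (w Q * indicator Q x))"
          unfolding h_def by (rule sum_ennreal[symmetric]) (simp add: w0)
        also have "\<dots> = (\<Sum>Q\<in>grid_cubes_upto N.
            (mass f Q) / ennreal (avg_copow Q) * indicator Q x)"
        proof (rule sum.cong[OF refl])
          fix Q :: "(real ^ 'n) set" assume Q: "Q \<in> grid_cubes_upto N"
          show "ennreal (w Q * indicator Q x)
              = (mass f Q) / ennreal (avg_copow Q) * indicator Q x"
            unfolding w[OF Q] by (cases "x \<in> Q") simp_all
        qed
        finally show ?thesis by (rule sym)
      qed
      then show "e2ennreal \<bar>frac_integral (recip s) f x\<bar> \<le> ennreal C * (SUP N. ennreal (h N x))"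
        using C(2)[OF f, of x] by simp
    qed measurable
    then show "norm_le q (\<lambda>x. e2ennreal \<bar>frac_integral (recip s) f x\<bar>) (2 * C * (2 * L) * t)"
      by (simp only: mult_ac)
  qed
qed

section \<open>Consequences of the boundedness of the fractional integral\<close>

lemma frac_maximal_bounded:
  assumes q: "q \<in> exponents" and qf: "AE x in lebesgue. q x < \<infinity>"
    and I: "bounded_op p q (frac_integral (recip s))"
  shows "bounded_op p q (frac_maximal (recip s))"
proof -
  obtain CI where CI: "0 < CI" "\<And>f t. f \<in> borel_measurable lebesgue \<Longrightarrow> norm_le p (\<lambda>x. ennreal \<bar>f x\<bar>) t \<Longrightarrow>
    norm_le q (\<lambda>x. e2ennreal \<bar>frac_integral (recip s) f x\<bar>) (CI * t)"
    using bounded_opD[OF q qf I] by metis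
  obtain C where C: "1 \<le> C" "\<And>f x. f \<in> borel_measurable lebesgue \<Longrightarrow>
    e2ennreal \<bar>frac_maximal (recip s) f x\<bar> \<le> ennreal C * e2ennreal \<bar>frac_integral (recip s) (\<lambda>y. \<bar>f y\<bar>) x\<bar>"
    by (rule frac_maximal_le_frac_integral) (rule that, assumption, blast)
  show ?thesis
  proof (rule bounded_opI[of "C * CI"])
    show "0 < C * CI" using C(1) CI(1) by simp
    fix f :: "real ^ 'n \<Rightarrow> real" and t
    assume f[measurable]: "f \<in> borel_measurable lebesgue" and t: "norm_le p (\<lambda>x. ennreal \<bar>f x\<bar>) t"
    have "norm_le q (\<lambda>x. e2ennreal \<bar>frac_integral (recip s) (\<lambda>y. \<bar>f y\<bar>) x\<bar>) (CI * t)"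
      by (rule CI(2)) (use t in simp_all)
    then have "norm_le q (\<lambda>x. e2ennreal \<bar>frac_maximal (recip s) f x\<bar>) (C * (CI * t))"
      by (rule norm_le_mono[OF q _ disjI2[OF qf] _ C(2)[OF f]]) (use C(1) in simp)
    then show "norm_le q (\<lambda>x. e2ennreal \<bar>frac_maximal (recip s) f x\<bar>) (C * CI * t)"
      by (simp only: mult.assoc)
  qed
qed

text \<open>
  Halving the radius removes at most half of the volume, whatever the dimension.
\<close>

lemma measure_shell:
  fixes x :: "real ^ 'n"
  assumes "0 < l"
  shows "unit_ball_vol (real CARD('n)) / 2 * l ^ CARD('n) \<le> vol (ball x l - ball x (l / 2))"
proof -
  let ?\<omega> = "unit_ball_vol (real CARD('n))"
  have "(l / 2) ^ CARD('n) = l ^ CARD('n) / 2 ^ CARD('n)" by (rule power_divide)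
  also have "\<dots> \<le> l ^ CARD('n) / 2 ^ 1"
    using assms by (intro divide_left_mono power_increasing) (auto simp: Suc_leI)
  finally have half: "(l / 2) ^ CARD('n) \<le> l ^ CARD('n) / 2" by simp
  have "vol (ball x l - ball x (l / 2)) = vol (ball x l) - vol (ball x (l / 2))"
    using assms by (intro measurable_measure_Diff subset_ball) auto
  also have "\<dots> = ?\<omega> * l ^ CARD('n) - ?\<omega> * (l / 2) ^ CARD('n)"
    using assms by (simp only: measure_ball less_imp_le half_gt_zero)
  finally show ?thesis using mult_left_mono[OF half, of ?\<omega>] by simp
qed

lemma shells_disjoint:
  fixes x y :: "real ^ 'n"
  assumes "y \<in> ball x (2 powi j) - ball x (2 powi j / 2)" "y \<in> ball x (2 powi k) - ball x (2 powi k / 2)"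
  shows "j = k"
proof -
  have less: False if "j < k" "y \<in> ball x (2 powi j)" "y \<notin> ball x (2 powi k / 2)" for j k
  proof -
    have "(2::real) powi j \<le> 2 powi (k - 1)" by (rule power_int_increasing) (use that(1) in auto)
    also have "\<dots> = 2 powi k / 2" by (simp add: power_int_diff)
    finally show False using that(2,3) by simp
  qed
  show ?thesis using less[of j k] less[of k j] assms by (metis DiffD1 DiffD2 linorder_neqE_linordered_idom)
qed

text \<open>
  The cubes of the lattice that contain \<open>x\<close> have distinct sides, so the dyadic shells \<open>R Q\<close> around \<open>x\<close>
  with radii given by these sides are disjoint. On \<open>R Q\<close> the kernel is at most a multiple of
  \<open>avg_copow Q\<close>, and the volume of \<open>R Q\<close> is a fixed fraction of the volume of \<open>Q\<close>. The factor \<open>n + 1\<close> makes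
  the ball contain all shells, since \<open>x\<close> is within \<open>n l\<close> of the corner \<open>a\<close>.
\<close>

lemma dyadic_sum_le_frac_integral:
  obtains C where "1 \<le> C" "\<And>D Q0 F a l x. dyadic_lattice D \<Longrightarrow> Q0 = cube a l \<Longrightarrow> 0 < l \<Longrightarrow> finite F \<Longrightarrow> F \<subseteq> {Q \<in> D. Q \<subseteq> Q0} \<Longrightarrow>
    ennreal (\<Sum>Q\<in>F. avg_pow Q * indicator Q x)
      \<le> ennreal C * e2ennreal \<bar>frac_integral (recip s) (indicator (ball a ((real CARD('n) + 1) * l))) x\<bar>"
proof -
  let ?n = "real CARD('n)"
  let ?\<omega> = "unit_ball_vol (real CARD('n))"
  have w: "0 < ?\<omega>" by simp
  obtain C where C: "1 \<le> C"
    "\<And>x y a l. x \<noteq> y \<Longrightarrow> x \<in> cube a l \<Longrightarrow> 0 < l \<Longrightarrow> dist x y < l \<Longrightarrow>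
      frac_kernel (recip s) x y \<le> C * avg_copow (cube a l)"
    using kernel_comparison by metis
  show ?thesis
  proof (rule that[of "max 1 (2 * C / ?\<omega>)"])
    fix D F :: "(real ^ 'n) set set" and Q0 :: "(real ^ 'n) set" and a x :: "real ^ 'n" and l :: real
    assume D: "dyadic_lattice D" and Q0: "Q0 = cube a l" and l: "0 < l" and F: "finite F" "F \<subseteq> {Q \<in> D. Q \<subseteq> Q0}"
    let ?B = "ball a ((?n + 1) * l)"
    let ?X = "{Q \<in> F. x \<in> Q}"
    have "\<forall>Q\<in>F. \<exists>c k. Q = cube c (2 powi k)" using F dyadic_lattice_cube[OF D] by blast
    then obtain c k where ck: "\<And>Q. Q \<in> F \<Longrightarrow> Q = cube (c Q) (2 powi (k Q))" by metis
    define R where "R Q = ball x (2 powi k Q) - ball x (2 powi k Q / 2)" for Q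
    have Rm: "R Q \<in> sets lebesgue" for Q unfolding R_def by simp
    have Qm: "0 < vol Q" if "Q \<in> F" for Q
      using dyadic_lattice_measurable(2)[OF D] F that by blast
    have side: "2 powi k Q \<le> l" if "Q \<in> F" for Q
    proof -
      have "Q \<subseteq> Q0" using that F by blast
      moreover have "Q0 \<in> lmeasurable"
      proof (rule fmeasurableI)
        show "Q0 \<in> sets lebesgue" unfolding Q0 using l by (intro cube_measure) simp
        have "0 < vol Q0" unfolding Q0 using l by (subst cube_measure) simp_all
        from emeasure_lebesgue_finite[OF this] show "emeasure lebesgue Q0 < \<infinity>" by simp
      qed
      moreover have "Q \<in> sets lebesgue" using dyadic_lattice_measurable(1)[OF D] F that by blast
      ultimately have "vol Q \<le> vol Q0" by (intro measure_mono_fmeasurable)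
      moreover have "vol Q = (2 powi k Q) ^ CARD('n)"
        by (subst ck[OF that]) (rule cube_measure, simp)
      ultimately have "(2 powi k Q) ^ CARD('n) \<le> l ^ CARD('n)" unfolding Q0 using l by (simp add: cube_measure)
      then show ?thesis using l by (simp add: power_mono_iff)
    qed
    have RB: "R Q \<subseteq> ?B" if "Q \<in> ?X" for Q
    proof
      fix y assume "y \<in> R Q"
      then have "dist x y < 2 powi k Q" unfolding R_def by simp
      moreover have "x \<in> Q0" using that F by auto
      then have "dist x a < ?n * l" unfolding Q0 by (rule cube_dist_less)
      moreover have "2 powi k Q \<le> l" using side that by simp
      moreover have "dist a y \<le> dist x a + dist x y" using dist_triangle3[of a y x] by (simp add: dist_commute)
      ultimately have "dist a y < l + ?n * l" by linarith
      then show "y \<in> ?B" by (simp add: algebra_simps)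
    qed
    have R1: "Q = P" if "Q \<in> ?X" "P \<in> ?X" "y \<in> R Q" "y \<in> R P" for Q P y
    proof -
      have kk: "k Q = k P" using shells_disjoint[of y x "k Q" "k P"] that unfolding R_def by blast
      have "laminar F" using dyadic_lattice_laminar[OF D, of F] F by blast
      from laminarD[OF this, of Q P x] have "Q \<subseteq> P \<or> P \<subseteq> Q" using that by blast
      moreover have Qc: "Q = cube (c Q) (2 powi k P)" "P = cube (c P) (2 powi k P)"
        using ck[of Q] ck[of P] that kk by auto
      ultimately have "c Q = c P"
        using cube_subset_imp_eq[of "2 powi k P" "c Q" "c P"] cube_subset_imp_eq[of "2 powi k P" "c P" "c Q"]
        by (metis zero_less_numeral zero_less_power_int)
      then show ?thesis using Qc by simp
    qed
    let ?K = "\<lambda>y. ennreal (\<bar>indicator ?B y\<bar> / frac_kernel (recip s) x y) * indicator (-{x}) y"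
    have point: "(\<Sum>Q\<in>?X. ennreal (1 / (C * avg_copow Q)) * indicator (R Q) y) \<le> ?K y" for y
    proof (cases "\<exists>Q\<in>?X. y \<in> R Q")
      case True
      then obtain Q where Q: "Q \<in> ?X" "y \<in> R Q" by blast
      have ne: "x \<noteq> y" using Q(2) unfolding R_def by auto
      have "(\<Sum>P\<in>?X. ennreal (1 / (C * avg_copow P)) * indicator (R P) y)
          = (\<Sum>P\<in>{Q}. ennreal (1 / (C * avg_copow P)) * indicator (R P) y)"
      proof (rule sum.mono_neutral_right)
        show "\<forall>P\<in>?X - {Q}. ennreal (1 / (C * avg_copow P)) * indicator (R P) y = 0"
        proof
          fix P assume "P \<in> ?X - {Q}"
          then have "y \<notin> R P" using R1[of P Q y] Q by blast
          then show "ennreal (1 / (C * avg_copow P)) * indicator (R P) y = 0" by simp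
        qed
      qed (use F Q in auto)
      also have "\<dots> = ennreal (1 / (C * avg_copow Q))" using Q by simp
      also have "\<dots> \<le> ennreal (1 / frac_kernel (recip s) x y)"
      proof (intro ennreal_leI divide_left_mono)
        have "x \<in> cube (c Q) (2 powi k Q)" using Q(1) ck[of Q] by auto
        then have "frac_kernel (recip s) x y \<le> C * avg_copow (cube (c Q) (2 powi k Q))"
          by (rule C(2)[OF ne]) (use Q(2) in \<open>auto simp: R_def\<close>)
        then show "frac_kernel (recip s) x y \<le> C * avg_copow Q" using ck[of Q] Q(1) by simp
        show "0 < C * avg_copow Q * frac_kernel (recip s) x y"
          using C(1) Qm[of Q] Q(1) frac_kernel_pos[OF ne, of "recip s"] by simp
      qed simp
      also have "\<dots> = ?K y" using RB[OF Q(1)] Q(2) ne by (simp add: subset_iff)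
      finally show ?thesis .
    next
      case False
      then have "(\<Sum>Q\<in>?X. ennreal (1 / (C * avg_copow Q)) * indicator (R Q) y) = 0" by (intro sum.neutral) auto
      then show ?thesis by simp
    qed
    have term_le: "ennreal (avg_pow Q) \<le> ennreal (2 * C / ?\<omega>) * (ennreal (1 / (C * avg_copow Q)) * emeasure lebesgue (R Q))"
      if "Q \<in> F" for Q
    proof -
      have fin: "emeasure lebesgue (R Q) \<noteq> \<infinity>"
        using emeasure_bounded_finite[of "R Q"] bounded_subset[OF bounded_ball[of x "2 powi k Q"], of "R Q"]
        unfolding R_def by auto
      have "vol Q = (2 powi k Q) ^ CARD('n)" by (subst ck[OF that]) (rule cube_measure, simp)
      then have "?\<omega> / 2 * vol Q \<le> vol (R Q)"
        using measure_shell[of "2 powi k Q" x] unfolding R_def by simp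
      moreover have "vol Q = avg_copow Q * avg_pow Q" using avg_copow_mult_avg_pow[OF Qm[OF that]] by simp
      ultimately have "avg_pow Q \<le> 2 * C / ?\<omega> * (1 / (C * avg_copow Q) * vol (R Q))"
        using C(1) Qm[OF that] w by (simp add: field_simps)
      then have "ennreal (avg_pow Q) \<le> ennreal (2 * C / ?\<omega> * (1 / (C * avg_copow Q) * vol (R Q)))"
        by (rule ennreal_leI)
      also have "\<dots> = ennreal (2 * C / ?\<omega>) * ennreal (1 / (C * avg_copow Q) * vol (R Q))"
        by (rule ennreal_mult) (use C(1) in simp_all)
      also have "ennreal (1 / (C * avg_copow Q) * vol (R Q))
          = ennreal (1 / (C * avg_copow Q)) * ennreal (vol (R Q))"
        by (rule ennreal_mult) (use C(1) in simp_all)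
      finally show ?thesis using fin by (simp add: emeasure_eq_ennreal_measure)
    qed
    have "ennreal (\<Sum>Q\<in>F. avg_pow Q * indicator Q x) = (\<Sum>Q\<in>F. ennreal (avg_pow Q * indicator Q x))"
      by (rule sum_ennreal[symmetric]) simp
    also have "\<dots> = (\<Sum>Q\<in>?X. ennreal (avg_pow Q))"
      by (rule sum.mono_neutral_cong_right[OF F(1)]) (auto simp: indicator_def)
    also have "\<dots> \<le> (\<Sum>Q\<in>?X. ennreal (2 * C / ?\<omega>) * (ennreal (1 / (C * avg_copow Q)) * emeasure lebesgue (R Q)))"
      by (intro sum_mono term_le) simp
    also have "\<dots> = ennreal (2 * C / ?\<omega>) * (\<Sum>Q\<in>?X. \<integral>\<^sup>+y. ennreal (1 / (C * avg_copow Q)) * indicator (R Q) y \<partial>lebesgue)"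
      unfolding sum_distrib_left by (intro sum.cong refl) (simp add: nn_integral_cmult_indicator Rm)
    also have "(\<Sum>Q\<in>?X. \<integral>\<^sup>+y. ennreal (1 / (C * avg_copow Q)) * indicator (R Q) y \<partial>lebesgue)
        = (\<integral>\<^sup>+y. (\<Sum>Q\<in>?X. ennreal (1 / (C * avg_copow Q)) * indicator (R Q) y) \<partial>lebesgue)"
      by (rule nn_integral_sum[symmetric]) (use Rm in auto)
    also have "ennreal (2 * C / ?\<omega>) * \<dots> \<le> ennreal (max 1 (2 * C / ?\<omega>)) * (\<integral>\<^sup>+y. ?K y \<partial>lebesgue)"
      by (intro mult_mono nn_integral_mono point ennreal_leI) auto
    also have "(\<integral>\<^sup>+y. ?K y \<partial>lebesgue) = e2ennreal \<bar>frac_integral (recip s) (indicator ?B) x\<bar>"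
      by (rule frac_integral_abs_le(2)[OF s borel_measurable_indicator, symmetric]) simp_all
    finally show "ennreal (\<Sum>Q\<in>F. avg_pow Q * indicator Q x)
      \<le> ennreal (max 1 (2 * C / ?\<omega>)) * e2ennreal \<bar>frac_integral (recip s) (indicator ?B) x\<bar>" .
  qed simp
qed

text \<open>
  Integrate the pointwise bound for the dyadic sum against the indicator of the ball \<open>B\<close> around \<open>Q\<^sub>0\<close>.
  By Hoelder's inequality, the result is at most the norm of the fractional integral of the indicator
  of \<open>B\<close> times the dual norm of that indicator. These are bounded by \<open>|B|\<close> to the mean of \<open>1/p\<close> and
  \<open>|B|\<close> to one minus the mean of \<open>1/q\<close>, and the exponents add up to \<open>1 + a\<^sub>B\<close>.
\<close>

lemma C_down_finite:
  assumes p: "p \<in> exponents" and q: "q \<in> exponents" and qf: "AE x in lebesgue. q x < \<infinity>"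
    and Ap: "one_in_A p" and Aq: "one_in_A q"
    and \<alpha>: "AE x in lebesgue. recip s x = recip p x - recip q x"
    and I: "bounded_op p q (frac_integral (recip s))"
  shows "C_down (recip s) < \<infinity>"
proof -
  let ?n = "real CARD('n)"
  have conj: "conj_pair q (conj_exponent q)" using q by (rule conj_pair_conj_exponent)
  obtain CI where CI: "0 < CI" "\<And>f t. f \<in> borel_measurable lebesgue \<Longrightarrow> norm_le p (\<lambda>x. ennreal \<bar>f x\<bar>) t \<Longrightarrow>
    norm_le q (\<lambda>x. e2ennreal \<bar>frac_integral (recip s) f x\<bar>) (CI * t)"
    using bounded_opD[OF q qf I] by metis
  obtain Cp where Cp: "0 < Cp"
    "\<And>c r. 0 < r \<Longrightarrow> norm_le p (indicator (ball c r)) (Cp * vol (ball c r) powr avg (recip p) (ball c r))"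
    using one_in_A_indicator_norms[OF p Ap] by metis
  obtain Cq where Cq: "0 < Cq"
    "\<And>c r. 0 < r \<Longrightarrow> norm_le (conj_exponent q) (indicator (ball c r))
      (Cq * vol (ball c r) powr (1 - avg (recip q) (ball c r)))"
    using one_in_A_indicator_norms[OF q Aq] by metis
  obtain CS where CS: "1 \<le> CS" "\<And>D Q0 F a l x. dyadic_lattice D \<Longrightarrow> Q0 = cube a l \<Longrightarrow> 0 < l \<Longrightarrow> finite F \<Longrightarrow> F \<subseteq> {Q \<in> D. Q \<subseteq> Q0} \<Longrightarrow>
    ennreal (\<Sum>Q\<in>F. avg_pow Q * indicator Q x)
      \<le> ennreal CS * e2ennreal \<bar>frac_integral (recip s) (indicator (ball a ((real CARD('n) + 1) * l))) x\<bar>"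
    by (rule dyadic_sum_le_frac_integral) (rule that, assumption, blast)
  obtain CL where CL: "1 \<le> CL"
    "\<And>a l. 0 < l \<Longrightarrow> avg_pow (ball a ((real CARD('n) + 1) * l)) \<le> CL * avg_pow (cube a l)"
    "\<And>(a :: real ^ 'n) l. 0 < l \<Longrightarrow> vol (ball a ((real CARD('n) + 1) * l)) \<le> CL * vol (cube a l)"
    using kernel_comparison by metis
  define K where "K = 2 * (CS * (CI * Cp)) * Cq * (CL * CL)"
  have K0: "0 \<le> K" unfolding K_def using CS(1) CI(1) Cp(1) Cq(1) CL(1) by simp
  have finite_sum: "(\<Sum>Q\<in>F. vol Q powr (1 + avg (recip s) Q))
      \<le> K * vol Q0 powr (1 + avg (recip s) Q0)"
    if D: "dyadic_lattice D" and Q0D: "Q0 \<in> D" and F: "finite F" "F \<subseteq> {Q \<in> D. Q \<subseteq> Q0}" for D Q0 F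
  proof -
    obtain a m where "Q0 = cube a (2 powi m)" using dyadic_lattice_cube[OF D Q0D] .
    then obtain l where Q0: "Q0 = cube a l" and l: "0 < l" by (metis zero_less_numeral zero_less_power_int)
    have Qm: "Q \<in> sets lebesgue" "0 < vol Q" if "Q \<in> F" for Q
      using dyadic_lattice_measurable[OF D, of Q] F that by blast+
    have Q0m: "0 < vol Q0" by (rule dyadic_lattice_measurable(2)[OF D Q0D])
    let ?B = "ball a ((?n + 1) * l)" and ?m = "vol (ball a ((?n + 1) * l))"
    have r: "0 < (?n + 1) * l" using l by (simp add: add_pos_pos)
    note m0 = measure_ball_pos[OF r, of a]
    have Bfin: "emeasure lebesgue ?B \<noteq> \<infinity>" using emeasure_lebesgue_finite[OF m0] by simp
    have Q0B: "Q0 \<subseteq> ?B"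
    proof
      fix y assume "y \<in> Q0"
      then have "dist y a < ?n * l" unfolding Q0 by (rule cube_dist_less)
      then show "y \<in> ?B" using l by (simp add: dist_commute algebra_simps)
    qed
    have avgs: "avg (recip s) ?B = avg (recip p) ?B - avg (recip q) ?B"
    proof -
      have "(LINT x:?B|lebesgue. recip s x) = (LINT x:?B|lebesgue. recip p x - recip q x)"
        using recip_measurable[OF s] recip_measurable[OF p] recip_measurable[OF q] \<alpha>
        unfolding set_lebesgue_integral_def
        by (intro integral_cong_AE borel_measurable_scaleR borel_measurable_indicator borel_measurable_diff)
          (auto elim: eventually_mono)
      also have "\<dots> = (LINT x:?B|lebesgue. recip p x) - (LINT x:?B|lebesgue. recip q x)"
        by (intro set_integral_diff recip_set_integrable p q Bfin) auto
      finally show ?thesis unfolding avg_def by (simp add: diff_divide_distrib)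
    qed
    define u where "u x = (\<Sum>Q\<in>F. avg_pow Q * indicator Q x)" for x
    have u0: "0 \<le> u x" for x unfolding u_def by (intro sum_nonneg) simp
    have um[measurable]: "u \<in> borel_measurable lebesgue"
      unfolding u_def[abs_def] by (intro borel_measurable_sum borel_measurable_times borel_measurable_indicator Qm(1)) auto
    have "norm_le p (\<lambda>x. ennreal \<bar>indicator ?B x\<bar>) (Cp * ?m powr avg (recip p) ?B)"
      using Cp(2)[OF r, of a] by (simp add: ennreal_indicator)
    then have "norm_le q (\<lambda>x. e2ennreal \<bar>frac_integral (recip s) (indicator ?B) x\<bar>) (CI * (Cp * ?m powr avg (recip p) ?B))"
      by (intro CI(2) borel_measurable_indicator) simp_all
    then have "norm_le q (\<lambda>x. ennreal (u x)) (CS * (CI * (Cp * ?m powr avg (recip p) ?B)))"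
      unfolding u_def by (rule norm_le_mono[OF q _ disjI2[OF qf] _ CS(2)[OF D Q0 l F]]) (use CS(1) in simp)
    then have "(\<integral>\<^sup>+x. ennreal (u x) * indicator ?B x \<partial>lebesgue)
      \<le> ennreal (2 * (CS * (CI * (Cp * ?m powr avg (recip p) ?B))) * (Cq * ?m powr (1 - avg (recip q) ?B)))"
      by (rule Hoelder_norm_le[OF conj _ borel_measurable_indicator _ Cq(2)[OF r, of a], rotated 2]) simp_all
    also have "(\<integral>\<^sup>+x. ennreal (u x) * indicator ?B x \<partial>lebesgue) = (\<integral>\<^sup>+x. (\<Sum>Q\<in>F. ennreal (avg_pow Q) * indicator Q x) \<partial>lebesgue)"
    proof (rule nn_integral_cong)
      fix x
      have "ennreal (u x) = (\<Sum>Q\<in>F. ennreal (avg_pow Q * indicator Q x))"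
        unfolding u_def by (rule sum_ennreal[symmetric]) simp
      also have "\<dots> = (\<Sum>Q\<in>F. ennreal (avg_pow Q) * indicator Q x)"
        by (intro sum.cong refl) (simp split: split_indicator)
      finally have "ennreal (u x) = (\<Sum>Q\<in>F. ennreal (avg_pow Q) * indicator Q x)" .
      moreover have "(\<Sum>Q\<in>F. ennreal (avg_pow Q) * indicator Q x) = 0" if "x \<notin> ?B"
      proof (rule sum.neutral, rule ballI)
        fix Q assume "Q \<in> F"
        then have "x \<notin> Q" using that F Q0B by blast
        then show "ennreal (avg_pow Q) * indicator Q x = 0" by simp
      qed
      ultimately show "ennreal (u x) * indicator ?B x = (\<Sum>Q\<in>F. ennreal (avg_pow Q) * indicator Q x)"
        by (cases "x \<in> ?B") simp_all
    qed
    also have "\<dots> = (\<Sum>Q\<in>F. \<integral>\<^sup>+x. ennreal (avg_pow Q) * indicator Q x \<partial>lebesgue)"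
      by (rule nn_integral_sum) (use Qm in auto)
    also have "\<dots> = (\<Sum>Q\<in>F. ennreal (vol Q powr (1 + avg (recip s) Q)))"
    proof (rule sum.cong[OF refl])
      fix Q assume Q: "Q \<in> F"
      have "(\<integral>\<^sup>+x. ennreal (avg_pow Q) * indicator Q x \<partial>lebesgue) = ennreal (avg_pow Q) * ennreal (vol Q)"
        using Qm[OF Q] emeasure_lebesgue_finite[of Q] by (simp add: nn_integral_cmult_indicator)
      also have "\<dots> = ennreal (vol Q powr (1 + avg (recip s) Q))"
        using Qm(2)[OF Q] by (simp add: powr_add mult.commute flip: ennreal_mult)
      finally show "(\<integral>\<^sup>+x. ennreal (avg_pow Q) * indicator Q x \<partial>lebesgue) = ennreal (vol Q powr (1 + avg (recip s) Q))" .
    qed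
    also have "\<dots> = ennreal (\<Sum>Q\<in>F. vol Q powr (1 + avg (recip s) Q))"
      by (rule sum_ennreal) simp
    finally have "(\<Sum>Q\<in>F. vol Q powr (1 + avg (recip s) Q))
      \<le> 2 * (CS * (CI * (Cp * ?m powr avg (recip p) ?B))) * (Cq * ?m powr (1 - avg (recip q) ?B))"
      using CS(1) CI(1) Cp(1) Cq(1) by (subst (asm) ennreal_le_iff) auto
    also have "\<dots> = 2 * (CS * (CI * Cp)) * Cq * (?m powr avg (recip p) ?B * ?m powr (1 - avg (recip q) ?B))"
      by (simp only: mult_ac)
    also have "?m powr avg (recip p) ?B * ?m powr (1 - avg (recip q) ?B) = ?m powr (1 + avg (recip s) ?B)"
      unfolding avgs powr_add[symmetric] by (simp add: algebra_simps)
    also have "\<dots> = ?m * avg_pow ?B" using m0 by (simp add: powr_add)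
    also have "2 * (CS * (CI * Cp)) * Cq * (?m * avg_pow ?B)
        \<le> 2 * (CS * (CI * Cp)) * Cq * ((CL * vol Q0) * (CL * avg_pow Q0))"
      using CS(1) CI(1) Cp(1) Cq(1) CL(1) unfolding Q0
      by (intro mult_left_mono mult_mono CL(2)[OF l] CL(3)[OF l]) auto
    also have "\<dots> = K * (vol Q0 * avg_pow Q0)" unfolding K_def by (simp only: mult_ac)
    also have "vol Q0 * avg_pow Q0 = vol Q0 powr (1 + avg (recip s) Q0)"
      using Q0m by (simp add: powr_add)
    finally show ?thesis .
  qed
  have "C_down (recip s) \<le> ennreal K"
    unfolding C_down_def
  proof (intro SUP_least)
    fix D :: "(real ^ 'n) set set" and Q0 assume "D \<in> {D. dyadic_lattice D}" and Q0: "Q0 \<in> D"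
    then have D: "dyadic_lattice D" by simp
    let ?w = "vol Q0 powr (1 + avg (recip s) Q0)"
    have w: "0 < ?w" using dyadic_lattice_measurable(2)[OF D Q0] by simp
    have "(\<Sum>\<^sub>\<infinity>Q \<in> {Q \<in> D. Q \<subseteq> Q0}. ennreal (vol Q powr (1 + avg (recip s) Q))) \<le> ennreal (K * ?w)"
    proof (subst nonneg_infsum_complete, simp, rule SUP_least)
      fix F assume "F \<in> {F. finite F \<and> F \<subseteq> {Q \<in> D. Q \<subseteq> Q0}}"
      then have "(\<Sum>Q\<in>F. vol Q powr (1 + avg (recip s) Q)) \<le> K * ?w"
        by (intro finite_sum[OF D Q0]) auto
      then show "(\<Sum>Q\<in>F. ennreal (vol Q powr (1 + avg (recip s) Q))) \<le> ennreal (K * ?w)"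
        by (subst sum_ennreal) (auto intro: ennreal_leI)
    qed
    then have "(\<Sum>\<^sub>\<infinity>Q \<in> {Q \<in> D. Q \<subseteq> Q0}. ennreal (vol Q powr (1 + avg (recip s) Q))) / ennreal ?w
        \<le> ennreal (K * ?w) / ennreal ?w" by (rule divide_right_mono_ennreal)
    also have "\<dots> = ennreal K" using w K0 by (subst divide_ennreal) auto
    finally show "(\<Sum>\<^sub>\<infinity>Q \<in> {Q \<in> D. Q \<subseteq> Q0}. ennreal (vol Q powr (1 + avg (recip s) Q))) / ennreal ?w \<le> ennreal K" .
  qed
  then show ?thesis by (rule le_less_trans) simp
qed

end

theorem theorem1p4:
  fixes p q :: "(real ^ 'n) \<Rightarrow> ennreal" and \<alpha> :: "(real ^ 'n) \<Rightarrow> real"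
  assumes "p \<in> exponents" and "q \<in> exponents"
    and "\<forall>x. 0 \<le> \<alpha> x" and "(\<lambda>x. 1 / ennreal (\<alpha> x)) \<in> exponents"
    and "AE x in lebesgue. 1 < p x \<and> p x \<le> q x \<and> q x < \<infinity>"
  shows
    "(bounded_op (conj_exponent q) (conj_exponent q) maximal
        \<and> one_in_A (\<lambda>x. 1 / ennreal (\<alpha> x))
        \<and> C_down \<alpha> < \<infinity>
        \<and> bounded_op p q (frac_maximal \<alpha>)
      \<longrightarrow> bounded_op p q (frac_integral \<alpha>))
     \<and>
     (one_in_A p \<and> one_in_A q
        \<and> one_in_A (\<lambda>x. 1 / ennreal (\<alpha> x))
        \<and> (AE x in lebesgue. \<alpha> x = enn2real (1 / p x) - enn2real (1 / q x))
        \<and> C_up \<alpha> < \<infinity>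
        \<and> bounded_op p q (frac_integral \<alpha>)
      \<longrightarrow> C_down \<alpha> < \<infinity> \<and> bounded_op p q (frac_maximal \<alpha>))"
proof (cases "one_in_A (\<lambda>x. 1 / ennreal (\<alpha> x))")
  case True
  let ?s = "\<lambda>x. 1 / ennreal (\<alpha> x)"
  have \<alpha>: "recip ?s = \<alpha>" using assms(3) by (simp add: recip_def fun_eq_iff)
  interpret fractional_order ?s by unfold_locales (rule assms(4), rule True)
  have q1: "AE x in lebesgue. 1 < q x \<and> q x < \<infinity>" using assms(5) by eventually_elim auto
  have qf: "AE x in lebesgue. q x < \<infinity>" using assms(5) by eventually_elim auto
  show ?thesis
    using frac_integral_bounded[OF assms(1,2) q1] frac_maximal_bounded[OF assms(2) qf, of p]
      C_down_finite[OF assms(1,2) qf]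
    unfolding \<alpha> recip_def by blast
next
  case False
  then show ?thesis by blast
qed

end
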